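(* Assume that $a\in L^2_a(\mu,H)$ with $E[\rho(-\delta a)]=1$ and define $A=I_W+a$. Then $A$ preserves the Wiener measure, i.e. $A\mu=\mu$, if and only if $$E[\dot a_t|\mathcal A_t]=0$$ $dt\times d\mu$-almost surely, where $(\mathcal A_t,\,t\in[0,1])$ denotes the filtration of $A$. In particular, in this case $A$ is equal to its innovation process.
   Context: $(W,H,\mu)$ is the classical Wiener space: $W=C([0,1],\mathbb{R}^d)$, $d\ge1$, $\mu$ is the standard Wiener measure, $(W_t)_{t\in[0,1]}$ is the canonical (coordinate) Wiener process, $H$ is the Cameron-Martin space with $(h,k)_H=\int_0^1\dot h_s\cdot\dot k_s\,ds$ and norm $|\cdot|_H$, and $(\mathcal F_t)_{t\in[0,1]}$ is the canonical filtration completed with $\mu$-null sets. $E$ is expectation under $\mu$. $L^0_a(\mu,H)$ is the set of ($dt\times d\mu$-equivalence classes of) $H$-valued random variables $a(t)=\int_0^t\dot a_s\,ds$ whose Lebesgue density $\dot a$ is adapted to $(\mathcal F_t)$, and $L^2_a(\mu,H)=L^2(\mu,H)\cap L^0_a(\mu,H)$. For $a\in L^0_a(\mu,H)$, $\delta a=\int_0^1\dot a_s\cdot dW_s$ (It\^o integral), and $\rho(-\delta a)=\exp\left(-\int_0^1\dot a_s\cdot dW_s-\frac12\int_0^1|\dot a_s|^2ds\right)$. $I_W$ is the identity of $W$ and $A\mu$ denotes the image of $\mu$ under $A$. Write $A_t(w)=A(w)(t)$; the filtration of $A$ is $\mathcal A_t=\sigma(A_s,\ s\le t)$. The innovation process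 of $A$ is $Z_t=A_t-\int_0^tE[\dot a_s|\mathcal A_s]\,ds$. *)

theory Defs
  imports "HOL-Probability.Probability"
begin

section \<open>Wiener space\<close>

text \<open>
  A path is a function on \<^term>\<open>{0..1::real}\<close>, extended by \<^term>\<open>undefined\<close>, so that path equality is
  equality on \<^term>\<open>{0..1::real}\<close>. The \<sigma>-algebra generated by the coordinates is the Borel
  \<sigma>-algebra of the uniform norm.
\<close>

type_synonym 'd path = "real \<Rightarrow> real ^ 'd"

definition path_algebra :: "('d::finite) path measure" where
  "path_algebra = restrict_space (\<Pi>\<^sub>M t\<in>{0..1}. borel) {w. continuous_on {0..1} w}"

text \<open>
  Wiener measure: the law on path space that makes the coordinate process a standard
  \<^typ>\<open>'d\<close>-dimensional Brownian motion started at 0. The index \<^term>\<open>(k, i)\<close> stands for the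
  \<^term>\<open>i\<close>-th component of the \<^term>\<open>k\<close>-th increment.
\<close>

definition wiener_measure :: "('d::finite) path measure \<Rightarrow> bool" where
  "wiener_measure M \<longleftrightarrow>
     prob_space M \<and>
     sets M = sets path_algebra \<and>
     (AE w in M. w 0 = 0) \<and>
     (\<forall>s t i. 0 \<le> s \<and> s < t \<and> t \<le> 1 \<longrightarrow>
        distributed M lborel (\<lambda>w. (w t - w s) $ i) (normal_density 0 (sqrt (t - s)))) \<and>
     (\<forall>(n::nat) (\<tau>::nat \<Rightarrow> real). (\<forall>k\<le>n. \<tau> k \<in> {0..1}) \<and> (\<forall>k<n. \<tau> k < \<tau> (Suc k)) \<longrightarrow>
        prob_space.indep_vars M (\<lambda>_. borel)
          (\<lambda>(k, i) w. (w (\<tau> (Suc k)) - w (\<tau> k)) $ i) ({..<n} \<times> UNIV))"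

abbreviation unit_time :: "real measure" where
  "unit_time \<equiv> restrict_space lborel {0..1}"

section \<open>Filtrations\<close>

definition natural_filtration ::
    "'w set \<Rightarrow> (real \<Rightarrow> 'w \<Rightarrow> 'b::topological_space) \<Rightarrow> real \<Rightarrow> 'w measure" where
  "natural_filtration \<Omega> X t = sigma \<Omega> {X s -` B \<inter> \<Omega> | s B. 0 \<le> s \<and> s \<le> t \<and> B \<in> sets borel}"

text \<open>
  The canonical filtration, augmented with all null sets of the completed Wiener measure.
  Random variables live on \<^term>\<open>completion M\<close> throughout.
\<close>

definition wiener_filtration :: "('d::finite) path measure \<Rightarrow> real \<Rightarrow> 'd path measure" where
  "wiener_filtration M t =
     sigma (space M)
       (sets (natural_filtration (space M) (\<lambda>s w. w s) t) \<union> null_sets (completion M))"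

section \<open>Adapted Cameron-Martin-valued random variables\<close>

text \<open>
  An element \<open>a\<close> of the Cameron-Martin space is given by its Lebesgue density \<open>f\<close>:
  \<open>a = primitive f\<close>, and the squared Cameron-Martin norm of \<open>a\<close> is \<open>energy f\<close>. A random
  variable with values in that space is given by a process \<open>f s w\<close> (time first, then path),
  which represents its class modulo equality almost everywhere for time times probability.
\<close>

definition primitive :: "(real \<Rightarrow> real ^ 'd) \<Rightarrow> real \<Rightarrow> real ^ ('d::finite)" where
  "primitive f t = (LINT s:{0..t}|lborel. f s)"

definition energy :: "(real \<Rightarrow> real ^ ('d::finite)) \<Rightarrow> real" where
  "energy f = (LINT s:{0..1}|lborel. (norm (f s))\<^sup>2)"

definition L0a :: "('d::finite) path measure \<Rightarrow> (real \<Rightarrow> 'd path \<Rightarrow> real ^ 'd) set" where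
  "L0a M = {f.
     (\<lambda>(s, w). f s w) \<in> borel_measurable (unit_time \<Otimes>\<^sub>M completion M) \<and>
     (\<forall>w\<in>space M. set_integrable lborel {0..1} (\<lambda>s. (norm (f s w))\<^sup>2)) \<and>
     (\<forall>t\<in>{0..1}. f t \<in> borel_measurable (wiener_filtration M t))}"

definition L2a :: "('d::finite) path measure \<Rightarrow> (real \<Rightarrow> 'd path \<Rightarrow> real ^ 'd) set" where
  "L2a M = {f \<in> L0a M. integrable (completion M) (\<lambda>w. energy (\<lambda>s. f s w))}"

section \<open>The Ito integral\<close>

definition tends_in_probability ::
    "'w measure \<Rightarrow> (nat \<Rightarrow> 'w \<Rightarrow> real) \<Rightarrow> ('w \<Rightarrow> real) \<Rightarrow> bool" where
  "tends_in_probability M X Y \<longleftrightarrow>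
     (\<forall>\<epsilon>>0. (\<lambda>j. measure M {w \<in> space M. \<bar>X j w - Y w\<bar> > \<epsilon>}) \<longlonglongrightarrow> 0)"

text \<open>
  A simple adapted process is coded by the number \<open>n\<close> of its steps, its partition points \<open>\<tau>\<close>
  and its values \<open>\<xi>\<close>: it equals \<open>\<xi> k\<close> on the interval from \<open>\<tau> k\<close> (excluded) to
  \<open>\<tau> (Suc k)\<close> (included).
\<close>

type_synonym 'd step_code = "nat \<times> (nat \<Rightarrow> real) \<times> (nat \<Rightarrow> 'd path \<Rightarrow> real ^ 'd)"

definition adapted_step :: "('d::finite) path measure \<Rightarrow> 'd step_code \<Rightarrow> bool" where
  "adapted_step M = (\<lambda>(n, \<tau>, \<xi>).
     (\<forall>k\<le>n. \<tau> k \<in> {0..1}) \<and> (\<forall>k<n. \<tau> k < \<tau> (Suc k)) \<and>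
     (\<forall>k<n. \<xi> k \<in> borel_measurable (wiener_filtration M (\<tau> k)) \<and>
            (\<exists>C. \<forall>w\<in>space M. norm (\<xi> k w) \<le> C)))"

definition step_process :: "('d::finite) step_code \<Rightarrow> real \<Rightarrow> 'd path \<Rightarrow> real ^ 'd" where
  "step_process = (\<lambda>(n, \<tau>, \<xi>) s w. \<Sum>k<n. indicator {\<tau> k<..\<tau> (Suc k)} s *\<^sub>R \<xi> k w)"

definition step_integral :: "('d::finite) step_code \<Rightarrow> 'd path \<Rightarrow> real" where
  "step_integral = (\<lambda>(n, \<tau>, \<xi>) w. \<Sum>k<n. \<xi> k w \<bullet> (w (\<tau> (Suc k)) - w (\<tau> k)))"

text \<open>
  \<open>I\<close> is a version of the Ito integral of \<open>f\<close> over \<^term>\<open>{0..1::real}\<close> with respect to the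
  coordinate process. Such a version exists for every \<open>f\<close> in \<^term>\<open>L0a M\<close> and is unique up
  to null sets.
\<close>

definition ito_integral ::
    "('d::finite) path measure \<Rightarrow> (real \<Rightarrow> 'd path \<Rightarrow> real ^ 'd) \<Rightarrow> ('d path \<Rightarrow> real) \<Rightarrow> bool" where
  "ito_integral M f I \<longleftrightarrow>
     I \<in> borel_measurable (completion M) \<and>
     (\<exists>\<phi>. (\<forall>j. adapted_step M (\<phi> j)) \<and>
        tends_in_probability (completion M)
          (\<lambda>j w. energy (\<lambda>s. step_process (\<phi> j) s w - f s w)) (\<lambda>_. 0) \<and>
        tends_in_probability (completion M) (\<lambda>j. step_integral (\<phi> j)) I)"

text \<open>\<open>\<rho>(-\<delta>a)\<close> for \<open>a\<close> with density \<open>f\<close>, where \<open>\<delta>a\<close> is passed as the argument \<open>I\<close>.\<close>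

definition rho_minus ::
    "(real \<Rightarrow> 'd path \<Rightarrow> real ^ ('d::finite)) \<Rightarrow> ('d path \<Rightarrow> real) \<Rightarrow> 'd path \<Rightarrow> real" where
  "rho_minus f I w = exp (- I w - energy (\<lambda>s. f s w) / 2)"

section \<open>The perturbed path and its innovation process\<close>

definition perturbed :: "(real \<Rightarrow> 'd path \<Rightarrow> real ^ 'd) \<Rightarrow> ('d::finite) path \<Rightarrow> 'd path" where
  "perturbed f w = (\<lambda>t\<in>{0..1}. w t + primitive (\<lambda>s. f s w) t)"

definition perturbed_filtration ::
    "('d::finite) path measure \<Rightarrow> (real \<Rightarrow> 'd path \<Rightarrow> real ^ 'd) \<Rightarrow> real \<Rightarrow> 'd path measure" where
  "perturbed_filtration M f = natural_filtration (space M) (\<lambda>s w. perturbed f w s)"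

text \<open>
  \<open>b\<close> is a version of the process of conditional expectations of \<open>f t\<close> given \<open>F t\<close>. Each of
  these is determined only up to a null set depending on \<open>t\<close>, so statements about almost every
  pair \<open>(t, w)\<close>, or about time integrals, need a jointly measurable version; two such versions
  agree for almost every pair.
\<close>

definition cond_exp_process ::
    "'w measure \<Rightarrow> (real \<Rightarrow> 'w measure) \<Rightarrow> (real \<Rightarrow> 'w \<Rightarrow> real ^ ('d::finite)) \<Rightarrow>
     (real \<Rightarrow> 'w \<Rightarrow> real ^ 'd) \<Rightarrow> bool" where
  "cond_exp_process N F f b \<longleftrightarrow>
     (\<lambda>(t, w). b t w) \<in> borel_measurable (unit_time \<Otimes>\<^sub>M N) \<and>
     (AE t in unit_time. AE w in N. \<forall>i. b t w $ i = real_cond_exp N (F t) (\<lambda>v. f t v $ i) w)"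

definition innovation ::
    "(real \<Rightarrow> 'd path \<Rightarrow> real ^ 'd) \<Rightarrow> (real \<Rightarrow> 'd path \<Rightarrow> real ^ 'd) \<Rightarrow>
     ('d::finite) path \<Rightarrow> real \<Rightarrow> real ^ 'd" where
  "innovation f b w t = perturbed f w t - primitive (\<lambda>s. b s w) t"

end

theory Submission
  imports Defs
begin

text \<open>
  Write \<open>W\<close> for the coordinate process, \<open>a\<close> for the primitive of the density \<open>f\<close>, \<open>A = W + a\<close>, \<open>F\<close> for
  the augmented filtration of \<open>W\<close> and \<open>\<A>\<close> for the filtration of \<open>A\<close>, called \<open>observed\<close> below. Both
  directions compare \<open>A\<close> with \<open>W\<close> on an increment,

    \<open>A t - A u = (W t - W u) + (a t - a u)\<close>,

  tested against a bounded variable \<open>Y\<close> known at time \<open>u\<close> to an observer of \<open>A\<close>. Since \<open>a\<close> is adapted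
  (\<open>drift_adapted\<close>), \<open>\<A> u\<close> is contained in \<open>F u\<close>; hence \<open>W t - W u\<close> is independent of \<open>Y\<close>, whereas by
  Fubini \<open>E[Y (a t - a u)]\<close> is the integral of \<open>E[Y f s]\<close> over \<open>s\<close> from \<open>u\<close> to \<open>t\<close>
  (\<open>weighted_drift_Fubini\<close>).

  Suppose that \<open>A\<close> has the law of \<open>W\<close>. Then its increments are centred and independent of its own
  past, so \<open>E[Y (A t - A u)] = 0\<close>; also \<open>E[Y (W t - W u)] = 0\<close>. Subtracting, the integral of \<open>E[Y f s]\<close>
  vanishes over every interval starting at \<open>u\<close>, and thus \<open>E[Y f s] = 0\<close> for almost every \<open>s > u\<close>. The
  exceptional set depends on \<open>Y\<close>, but by continuity of paths a countable family of variables \<open>Y\<close>, indexed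
  by rational times and a countable base, generates \<open>\<A> s\<close>. So \<open>E[f s | \<A> s] = 0\<close> for almost every \<open>s\<close>
  (\<open>cond_exp_density_zero\<close>).

  Suppose conversely that \<open>E[f s | \<A> s] = 0\<close> for almost every \<open>s\<close>. Then the drift is orthogonal to the
  observed past, and the law of \<open>A\<close> can be found as in Levy's characterisation of Brownian motion, with
  a direct estimate in place of stochastic calculus. Over a step of length \<open>h\<close> the characteristic
  function of an increment of \<open>A\<close>, weighted with \<open>Y\<close>, is expanded to second order in the drift; the
  first-order term vanishes by orthogonality, and the remainder is at most a constant times
  \<open>\<epsilon> h + (1 + 1 / \<epsilon>) h m\<close>, where \<open>m\<close> is the mean energy of the drift on that step
  (\<open>char_one_step\<close>). Summed over \<open>n\<close> equal steps of an interval this is \<open>O(\<epsilon>) + O(1 / n)\<close>, so letting first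
  \<open>n\<close> tend to infinity and then \<open>\<epsilon>\<close> to 0 shows that the weighted characteristic function is exactly the
  Gaussian one (\<open>char_perturbed_increment\<close>). Joint characteristic functions determine joint laws
  (\<open>joint_char_determines_law\<close>), so the law of \<open>A\<close> is a Wiener measure, and there is only one
  (\<open>wiener_measure_unique\<close>).

  Finally, if \<open>E[f s | \<A> s]\<close> vanishes almost everywhere then so does its time integral on almost every
  path, and \<open>A\<close> coincides with its innovation process.
\<close>

section \<open>Joint laws from characteristic functions\<close>

text \<open>
  The measure with density \<open>Z\<close>, once normalised, is a probability, so Levy's uniqueness theorem applies
  to the law of \<open>X\<close> under it. The degenerate case of mean 0 is trivial because then \<open>Z\<close> vanishes.
\<close>

lemma (in prob_space) weighted_law_determined_by_char:
  fixes Z X :: "'a \<Rightarrow> real"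
  assumes Z: "integrable M Z" "\<And>w. 0 \<le> Z w"
    and X [measurable]: "random_variable borel X"
    and nu: "real_distribution \<nu>"
    and char: "\<And>u. (CLINT w|M. complex_of_real (Z w) * iexp (u * X w)) = complex_of_real (expectation Z) * char \<nu> u"
    and C [measurable]: "C \<in> sets borel"
  shows "(\<integral>w. Z w * indicator C (X w) \<partial>M) = expectation Z * measure \<nu> C"
proof (cases "expectation Z = 0")
  case True
  then have "AE w in M. Z w = 0"
    using integral_nonneg_eq_0_iff_AE[OF Z(1)] Z(2) by simp
  then have "(\<integral>w. Z w * indicator C (X w) \<partial>M) = 0"
    by (intro integral_eq_zero_AE) auto
  then show ?thesis using True by simp
next
  case False
  have [measurable]: "Z \<in> borel_measurable M" using Z by auto
  define m where "m = expectation Z"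
  have "0 \<le> expectation Z" using Z(2) by (intro Bochner_Integration.integral_nonneg)
  then have m: "m > 0" using False by (simp add: m_def)
  define D where "D = density M (\<lambda>w. ennreal (Z w / m))"
  have D: "prob_space D"
  proof
    have "emeasure D (space D) = (\<integral>\<^sup>+w. ennreal (Z w / m) \<partial>M)"
      unfolding D_def by (subst emeasure_density) (auto intro!: nn_integral_cong)
    also have "\<dots> = ennreal (\<integral>w. Z w / m \<partial>M)"
      using Z m by (intro nn_integral_eq_integral) auto
    also have "(\<integral>w. Z w / m \<partial>M) = 1" using m by (simp add: m_def)
    finally show "emeasure D (space D) = 1" by simp
  qed
  then interpret D: prob_space D .
  have [measurable]: "X \<in> borel_measurable D" unfolding D_def by simp
  have L: "real_distribution (distr D borel X)" by (rule D.real_distribution_distr) measurable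
  have "char (distr D borel X) u = char \<nu> u" for u
  proof -
    have "char (distr D borel X) u = (CLINT w|D. iexp (u * X w))"
      unfolding char_def by (subst integral_distr) auto
    also have "\<dots> = (CLINT w|M. (Z w / m) *\<^sub>R iexp (u * X w))"
      unfolding D_def using Z m by (intro integral_density) auto
    also have "\<dots> = (CLINT w|M. (complex_of_real (Z w) * iexp (u * X w)) / complex_of_real m)"
      by (intro Bochner_Integration.integral_cong) (auto simp: scaleR_conv_of_real)
    also have "\<dots> = char \<nu> u"
      using char[of u] m by (simp add: m_def[symmetric])
    finally show ?thesis .
  qed
  then have eq: "distr D borel X = \<nu>" using Levy_uniqueness[OF L nu] by blast
  have "measure \<nu> C = (\<integral>x. indicator C x \<partial>distr D borel X)" unfolding eq[symmetric] by simp
  also have "\<dots> = (\<integral>w. indicator C (X w) \<partial>D)" by (subst integral_distr) auto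
  also have "\<dots> = (\<integral>w. (Z w / m) *\<^sub>R indicator C (X w) \<partial>M)"
    unfolding D_def using Z m by (intro integral_density) auto
  also have "\<dots> = (\<integral>w. Z w * indicator C (X w) \<partial>M) / m" by simp
  finally show ?thesis using m by (simp add: m_def[symmetric] field_simps)
qed

text \<open>
  One variable of a factorising joint characteristic function can be traded for an indicator. The
  weight \<open>Y exp(i \<theta>)\<close> is complex, so the previous lemma does not apply to it; but \<open>Y\<close>,
  \<open>Y (1 + cos \<theta>)\<close> and \<open>Y (1 + sin \<theta>)\<close> are nonnegative, and the required characteristic functions follow
  from those for \<open>\<sigma> = 1\<close>, \<open>\<sigma> = -1\<close> and \<open>\<sigma> = 0\<close>. Real and imaginary parts are differences of these weights.
\<close>

lemma (in prob_space) weighted_char_extends_to_indicator: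
  fixes Y X \<theta> :: "'a \<Rightarrow> real"
  assumes Y [measurable]: "random_variable borel Y" and Yb: "\<And>w. 0 \<le> Y w" "\<And>w. Y w \<le> 1"
    and X [measurable]: "random_variable borel X"
    and \<theta> [measurable]: "random_variable borel \<theta>"
    and nu: "real_distribution \<nu>"
    and char: "\<And>\<sigma> u. (CLINT w|M. complex_of_real (Y w) * iexp (\<sigma> * \<theta> w) * iexp (u * X w))
        = (CLINT w|M. complex_of_real (Y w) * iexp (\<sigma> * \<theta> w)) * char \<nu> u"
    and C [measurable]: "C \<in> sets borel"
  shows "(CLINT w|M. complex_of_real (Y w * indicator C (X w)) * iexp (\<theta> w))
        = (CLINT w|M. complex_of_real (Y w) * iexp (\<theta> w)) * measure \<nu> C"
proof -
  let ?e = "\<lambda>\<sigma> w. complex_of_real (Y w) * iexp (\<sigma> * \<theta> w)"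
  have int_bd: "integrable M f" if "f \<in> borel_measurable M" "\<And>w. norm (f w) \<le> 1" for f :: "'a \<Rightarrow> complex"
    using that by (intro integrable_const_bound[where B=1]) auto
  have int_bdr: "integrable M f" if "f \<in> borel_measurable M" "\<And>w. norm (f w) \<le> 2" for f :: "'a \<Rightarrow> real"
    using that by (intro integrable_const_bound[where B=2]) auto
  have ie: "integrable M (\<lambda>w. ?e \<sigma> w * iexp (u * X w))" for \<sigma> u
    by (rule int_bd) (use Yb in \<open>auto simp: norm_mult\<close>)
  have ie0: "integrable M (?e \<sigma>)" for \<sigma>
    by (rule int_bd) (use Yb in \<open>auto simp: norm_mult\<close>)
  have char0: "(CLINT w|M. complex_of_real (Y w) * iexp (u * X w)) = (CLINT w|M. complex_of_real (Y w)) * char \<nu> u" for u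
    using char[of 0 u] by simp
  have base: "(\<integral>w. Y w * indicator C (X w) \<partial>M) = expectation Y * measure \<nu> C"
  proof (rule weighted_law_determined_by_char[OF _ _ X nu _ C])
    show "integrable M Y" by (rule int_bdr) (use Yb in \<open>auto intro: order_trans[OF Yb(2)]\<close>)
  qed (use Yb char0 in \<open>auto simp: integral_complex_of_real\<close>)
  \<comment> \<open>For \<open>g\<close> the cosine or sine of \<open>\<theta>\<close>: apply the real case to the weight \<open>Y (1 + g)\<close> and subtract the one for \<open>Y\<close>.\<close>
  have gen: "(\<integral>w. (Y w * g w) * indicator C (X w) \<partial>M) = (\<integral>w. Y w * g w \<partial>M) * measure \<nu> C"
    if g [measurable]: "g \<in> borel_measurable M" and gb: "\<And>w. \<bar>g w\<bar> \<le> 1"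
      and gexp: "\<And>w. complex_of_real (g w) = a * iexp (1 * \<theta> w) + b * iexp (- 1 * \<theta> w)"
    for g and a b :: complex
  proof -
    have iYg: "integrable M (\<lambda>w. Y w * g w)"
      by (rule integrable_const_bound[where B=1]) (use Yb gb in \<open>auto simp: abs_mult intro!: AE_I2 mult_le_one\<close>)
    have iY: "integrable M Y" by (rule int_bdr) (use Yb in \<open>auto intro: order_trans[OF Yb(2)]\<close>)
    have gl: "- 1 \<le> g w" "g w \<le> 1" for w using gb[of w] by auto
    have cg: "(CLINT w|M. complex_of_real (Y w * g w) * iexp (u * X w)) =
       (CLINT w|M. complex_of_real (Y w * g w)) * char \<nu> u" for u
    proof -
      have "(CLINT w|M. complex_of_real (Y w * g w) * iexp (u * X w))
        = (CLINT w|M. a * (?e 1 w * iexp (u * X w)) + b * (?e (-1) w * iexp (u * X w)))"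
        by (intro Bochner_Integration.integral_cong refl) (simp only: of_real_mult gexp, simp add: algebra_simps)
      also have "\<dots> = a * (CLINT w|M. ?e 1 w * iexp (u * X w)) + b * (CLINT w|M. ?e (-1) w * iexp (u * X w))"
        using ie[of 1 u] ie[of "-1" u] by (subst Bochner_Integration.integral_add) (auto simp del: mult_minus1 mult_1_left)
      also have "\<dots> = (a * (CLINT w|M. ?e 1 w) + b * (CLINT w|M. ?e (-1) w)) * char \<nu> u"
        unfolding char by (simp add: algebra_simps)
      also have "a * (CLINT w|M. ?e 1 w) + b * (CLINT w|M. ?e (-1) w) = (CLINT w|M. a * ?e 1 w + b * ?e (-1) w)"
        using ie0[of 1] ie0[of "-1"] by (subst Bochner_Integration.integral_add) (auto simp del: mult_minus1 mult_1_left)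
      also have "\<dots> = (CLINT w|M. complex_of_real (Y w * g w))"
        by (intro Bochner_Integration.integral_cong refl) (simp only: of_real_mult gexp, simp add: algebra_simps)
      finally show ?thesis .
    qed
    have i1: "integrable M (\<lambda>w. complex_of_real (Y w) * iexp (u * X w))" for u
      using ie[of 0 u] by simp
    have i2: "integrable M (\<lambda>w. complex_of_real (Y w * g w) * iexp (u * X w))" for u
      by (rule int_bd) (use Yb gb in \<open>auto simp: norm_mult abs_mult intro!: mult_le_one\<close>)
    have "(\<integral>w. (Y w * (1 + g w)) * indicator C (X w) \<partial>M) = (\<integral>w. Y w * (1 + g w) \<partial>M) * measure \<nu> C"
    proof (rule weighted_law_determined_by_char[OF _ _ X nu _ C])
      show "integrable M (\<lambda>w. Y w * (1 + g w))"
        using iYg iY by (simp add: distrib_left)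
      show "0 \<le> Y w * (1 + g w)" for w using Yb(1)[of w] gl[of w] by simp
      show "(CLINT w|M. complex_of_real (Y w * (1 + g w)) * iexp (u * X w)) =
         complex_of_real (\<integral>w. Y w * (1 + g w) \<partial>M) * char \<nu> u" for u
      proof -
        have "(CLINT w|M. complex_of_real (Y w * (1 + g w)) * iexp (u * X w))
          = (CLINT w|M. complex_of_real (Y w) * iexp (u * X w) + complex_of_real (Y w * g w) * iexp (u * X w))"
          by (intro Bochner_Integration.integral_cong refl) (simp add: algebra_simps)
        also have "\<dots> = (CLINT w|M. complex_of_real (Y w) * iexp (u * X w)) + (CLINT w|M. complex_of_real (Y w * g w) * iexp (u * X w))"
          by (rule Bochner_Integration.integral_add[OF i1 i2])
        also have "\<dots> = complex_of_real (expectation Y + (\<integral>w. Y w * g w \<partial>M)) * char \<nu> u"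
          unfolding char0 cg by (simp add: integral_complex_of_real distrib_right del: of_real_mult)
        also have "expectation Y + (\<integral>w. Y w * g w \<partial>M) = (\<integral>w. Y w * (1 + g w) \<partial>M)"
          using iYg iY by (simp add: distrib_left)
        finally show ?thesis .
      qed
    qed
    moreover have "integrable M (\<lambda>w. Y w * indicator C (X w))"
      by (rule int_bdr) (use Yb in \<open>auto simp: indicator_def intro: order_trans[OF Yb(2)]\<close>)
    moreover have "integrable M (\<lambda>w. (Y w * g w) * indicator C (X w))"
      by (rule int_bdr) (use Yb gb in \<open>auto simp: indicator_def abs_mult intro!: order_trans[OF mult_le_one]\<close>)
    ultimately show ?thesis
      using base iYg iY by (simp add: distrib_left distrib_right)
  qed
  have cos: "complex_of_real (cos x) = (1/2) * iexp (1 * x) + (1/2) * iexp (- 1 * x)" for x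
    by (simp add: complex_eq_iff Re_exp Im_exp)
  have sin: "complex_of_real (sin x) = (-\<i>/2) * iexp (1 * x) + (\<i>/2) * iexp (- 1 * x)" for x
    by (simp add: complex_eq_iff Re_exp Im_exp)
  have c: "(\<integral>w. (Y w * cos (\<theta> w)) * indicator C (X w) \<partial>M) = (\<integral>w. Y w * cos (\<theta> w) \<partial>M) * measure \<nu> C"
    by (rule gen[OF _ _ cos]) auto
  have s: "(\<integral>w. (Y w * sin (\<theta> w)) * indicator C (X w) \<partial>M) = (\<integral>w. Y w * sin (\<theta> w) \<partial>M) * measure \<nu> C"
    by (rule gen[OF _ _ sin]) auto
  have iC: "integrable M (\<lambda>w. complex_of_real (Y w * indicator C (X w)) * iexp (\<theta> w))"
    by (rule int_bd) (use Yb in \<open>auto simp: norm_mult indicator_def\<close>)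
  have i1: "integrable M (\<lambda>w. complex_of_real (Y w) * iexp (\<theta> w))" using ie0[of 1] by simp
  show ?thesis
  proof (rule complex_eqI)
    show "Re (CLINT w|M. complex_of_real (Y w * indicator C (X w)) * iexp (\<theta> w)) =
        Re ((CLINT w|M. complex_of_real (Y w) * iexp (\<theta> w)) * measure \<nu> C)"
      using c iC i1 by (simp add: integral_Re[symmetric] Re_exp mult_ac)
    show "Im (CLINT w|M. complex_of_real (Y w * indicator C (X w)) * iexp (\<theta> w)) =
        Im ((CLINT w|M. complex_of_real (Y w) * iexp (\<theta> w)) * measure \<nu> C)"
      using s iC i1 by (simp add: integral_Im[symmetric] Im_exp mult_ac)
  qed
qed

text \<open>
  Trading the variables one at a time reduces the multivariate uniqueness theorem to the real one; the
  induction runs over the set \<open>J\<close> of variables that are already indicators.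
\<close>

lemma (in prob_space) joint_char_extends_to_events:
  fixes X :: "'i \<Rightarrow> 'a \<Rightarrow> real" and C :: "'i \<Rightarrow> real set"
  assumes fin: "finite I" and X: "\<And>i. i \<in> I \<Longrightarrow> random_variable borel (X i)"
    and nu: "\<And>i. i \<in> I \<Longrightarrow> real_distribution (\<nu> i)"
    and char: "\<And>u. (CLINT w|M. iexp (\<Sum>i\<in>I. u i * X i w)) = (\<Prod>i\<in>I. char (\<nu> i) (u i))"
    and C: "\<And>i. i \<in> I \<Longrightarrow> C i \<in> sets borel"
    and J: "J \<subseteq> I"
  shows "(CLINT w|M. complex_of_real (\<Prod>i\<in>J. indicator (C i) (X i w)) * iexp (\<Sum>i\<in>I - J. u i * X i w))
       = complex_of_real (\<Prod>i\<in>J. measure (\<nu> i) (C i)) * (\<Prod>i\<in>I - J. char (\<nu> i) (u i))"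
  using finite_subset[OF J fin] J
proof (induction J arbitrary: u rule: finite_subset_induct')
  case empty
  then show ?case using char[of u] by simp
next
  case (insert j J)
  let ?Y = "\<lambda>w. \<Prod>i\<in>J. indicator (C i) (X i w) :: real"
  let ?\<theta> = "\<lambda>w. \<Sum>i\<in>I - insert j J. u i * X i w"
  have X' [measurable]: "random_variable borel (X j)" using X insert by auto
  have C' [measurable]: "C j \<in> sets borel" using C insert by auto
  have nuj: "real_distribution (\<nu> j)" using nu insert by auto
  have Y [measurable]: "?Y \<in> borel_measurable M"
    using X C insert by (intro borel_measurable_prod borel_measurable_indicator') (auto simp: subset_iff)
  have \<theta> [measurable]: "?\<theta> \<in> borel_measurable M"
    using X by (intro borel_measurable_sum borel_measurable_times) auto
  have split: "I - J = insert j (I - insert j J)" using insert by auto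
  have IH: "(CLINT w|M. complex_of_real (?Y w) * iexp (\<sigma> * ?\<theta> w) * iexp (v * X j w))
     = complex_of_real (\<Prod>i\<in>J. measure (\<nu> i) (C i)) * (\<Prod>i\<in>I - insert j J. char (\<nu> i) (\<sigma> * u i)) * char (\<nu> j) v"
    for \<sigma> v
  proof -
    let ?u = "\<lambda>i. if i = j then v else \<sigma> * u i"
    have s: "(\<Sum>i\<in>I - J. ?u i * X i w) = v * X j w + \<sigma> * ?\<theta> w" for w
      using fin unfolding split by (simp add: sum_distrib_left mult.assoc)
    have "(\<Prod>i\<in>I - J. char (\<nu> i) (?u i)) = char (\<nu> j) v * (\<Prod>i\<in>I - insert j J. char (\<nu> i) (\<sigma> * u i))"
      using fin unfolding split by simp
    then show ?thesis using insert.IH[of ?u] unfolding s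
      by (simp add: distrib_left exp_add mult_ac)
  qed
  have "(CLINT w|M. complex_of_real (?Y w * indicator (C j) (X j w)) * iexp (?\<theta> w))
        = (CLINT w|M. complex_of_real (?Y w) * iexp (?\<theta> w)) * measure (\<nu> j) (C j)"
  proof (rule weighted_char_extends_to_indicator[OF Y _ _ X' \<theta> nuj _ C'])
    show "0 \<le> ?Y w" for w by (intro prod_nonneg) auto
    show "?Y w \<le> 1" for w by (intro prod_le_1) auto
    show "(CLINT w|M. complex_of_real (?Y w) * iexp (\<sigma> * ?\<theta> w) * iexp (v * X j w))
        = (CLINT w|M. complex_of_real (?Y w) * iexp (\<sigma> * ?\<theta> w)) * char (\<nu> j) v" for \<sigma> v
      using IH[of \<sigma> v] IH[of \<sigma> 0] real_distribution.char_zero[OF nuj] by simp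
  qed
  also have "(CLINT w|M. complex_of_real (?Y w) * iexp (?\<theta> w)) =
      complex_of_real (\<Prod>i\<in>J. measure (\<nu> i) (C i)) * (\<Prod>i\<in>I - insert j J. char (\<nu> i) (u i))"
    using IH[of 1 0] real_distribution.char_zero[OF nuj] by simp
  finally show ?case using insert by (simp add: mult_ac)
qed

lemma (in prob_space) joint_char_determines_law:
  fixes X :: "'i \<Rightarrow> 'a \<Rightarrow> real"
  assumes fin: "finite I" and X: "\<And>i. i \<in> I \<Longrightarrow> random_variable borel (X i)"
    and nu: "\<And>i. i \<in> I \<Longrightarrow> real_distribution (\<nu> i)"
    and char: "\<And>u. (CLINT w|M. iexp (\<Sum>i\<in>I. u i * X i w)) = (\<Prod>i\<in>I. char (\<nu> i) (u i))"
  shows "indep_vars (\<lambda>_. borel) X I" and "\<And>i. i \<in> I \<Longrightarrow> distr M borel (X i) = \<nu> i"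
proof -
  have joint: "prob (\<Inter>j\<in>J. X j -` C j \<inter> space M) = (\<Prod>j\<in>J. measure (\<nu> j) (C j))"
    if J: "J \<subseteq> I" "J \<noteq> {}" and C: "\<And>j. j \<in> J \<Longrightarrow> C j \<in> sets borel" for J and C :: "'i \<Rightarrow> real set"
  proof -
    have finJ: "finite J" using J fin finite_subset by auto
    define C' where "C' = (\<lambda>i. if i \<in> J then C i else UNIV)"
    have E: "(\<Inter>j\<in>J. X j -` C j \<inter> space M) \<in> events"
      using J X C finJ by (intro sets.finite_INT measurable_sets) auto
    have ind: "(\<Prod>i\<in>I. indicator (C' i) (X i w)) = (indicator (\<Inter>j\<in>J. X j -` C j \<inter> space M) w :: real)"
      if "w \<in> space M" for w
    proof (cases "\<forall>j\<in>J. X j w \<in> C j")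
      case True
      then have "(\<Prod>i\<in>I. indicator (C' i) (X i w) :: real) = 1"
        by (intro prod.neutral) (auto simp: C'_def)
      then show ?thesis using True that by auto
    next
      case False
      then obtain j where j: "j \<in> J" "X j w \<notin> C j" by auto
      then have "(\<Prod>i\<in>I. indicator (C' i) (X i w) :: real) = 0"
        using J fin by (intro prod_zero) (auto intro!: bexI[of _ j] simp: C'_def)
      then show ?thesis using j by (auto simp: indicator_def)
    qed
    have "complex_of_real (prob (\<Inter>j\<in>J. X j -` C j \<inter> space M))
      = complex_of_real (\<integral>w. indicator (\<Inter>j\<in>J. X j -` C j \<inter> space M) w \<partial>M)"
      using E by simp
    also have "\<dots> = (CLINT w|M. complex_of_real (\<Prod>i\<in>I. indicator (C' i) (X i w)))"
      unfolding integral_complex_of_real[symmetric]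
      by (intro Bochner_Integration.integral_cong refl) (simp add: ind del: of_real_prod)
    also have "\<dots> = complex_of_real (\<Prod>i\<in>I. measure (\<nu> i) (C' i))"
      using joint_char_extends_to_events[OF fin X nu char, of C' I "\<lambda>_. 0"] C
      by (simp add: C'_def)
    also have "(\<Prod>i\<in>I. measure (\<nu> i) (C' i)) = (\<Prod>j\<in>J. measure (\<nu> j) (C j))"
    proof -
      have "measure (\<nu> i) UNIV = 1" if "i \<in> I" for i
        using nu[OF that] by (metis prob_space.prob_space real_distribution.axioms(1) real_distribution.space_eq_univ)
      then have "(\<Prod>i\<in>I - J. measure (\<nu> i) (C' i)) = 1"
        by (intro prod.neutral) (auto simp: C'_def)
      moreover have "(\<Prod>i\<in>J. measure (\<nu> i) (C' i)) = (\<Prod>j\<in>J. measure (\<nu> j) (C j))"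
        by (intro prod.cong) (auto simp: C'_def)
      ultimately show ?thesis using prod.subset_diff[OF J(1) fin, of "\<lambda>i. measure (\<nu> i) (C' i)"] by simp
    qed
    finally show ?thesis by (simp only: of_real_eq_iff)
  qed
  have single: "prob (X i -` C \<inter> space M) = measure (\<nu> i) C" if "i \<in> I" "C \<in> sets borel" for i C
    using joint[of "{i}" "\<lambda>_. C"] that by simp
  show "distr M borel (X i) = \<nu> i" if i: "i \<in> I" for i
  proof (rule measure_eqI)
    interpret N: real_distribution "\<nu> i" using nu i by auto
    show "sets (distr M borel (X i)) = sets (\<nu> i)" by simp
    fix A assume "A \<in> sets (distr M borel (X i))"
    then have A: "A \<in> sets borel" by simp
    show "emeasure (distr M borel (X i)) A = emeasure (\<nu> i) A"
      using single[OF i A] A X[OF i] by (simp add: emeasure_distr emeasure_eq_measure N.emeasure_eq_measure)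
  qed
  show "indep_vars (\<lambda>_. borel) X I"
    unfolding indep_vars_def2
  proof (intro conjI ballI indep_setsI)
    fix A J assume J: "J \<noteq> {}" "J \<subseteq> I" "finite J" and A: "\<forall>j\<in>J. A j \<in> {X j -` B \<inter> space M |B. B \<in> sets borel}"
    then have "\<forall>j\<in>J. \<exists>B. A j = X j -` B \<inter> space M \<and> B \<in> sets borel" by auto
    then obtain C where C: "\<And>j. j \<in> J \<Longrightarrow> A j = X j -` C j \<inter> space M" "\<And>j. j \<in> J \<Longrightarrow> C j \<in> sets borel"
      by metis
    have "prob (\<Inter>j\<in>J. A j) = prob (\<Inter>j\<in>J. X j -` C j \<inter> space M)" using C by auto
    also have "\<dots> = (\<Prod>j\<in>J. measure (\<nu> j) (C j))" using J C by (intro joint) auto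
    also have "\<dots> = (\<Prod>j\<in>J. prob (A j))" using J C single by (intro prod.cong) auto
    finally show "prob (\<Inter>j\<in>J. A j) = (\<Prod>j\<in>J. prob (A j))" .
  qed (use X in auto)
qed

lemma char_centred_normal:
  assumes "\<sigma> > 0"
  shows "char (density lborel (normal_density 0 \<sigma>)) u = exp (- (\<sigma>\<^sup>2 * u\<^sup>2) / 2)"
proof -
  interpret S: real_distribution std_normal_distribution by (rule real_dist_normal_dist)
  have "distributed std_normal_distribution lborel (\<lambda>x. x) std_normal_density"
    unfolding distributed_def using distr_id2[of lborel std_normal_distribution] by simp
  from S.normal_density_affine[OF this _, of \<sigma> 0] assms
  have D: "distributed std_normal_distribution lborel (\<lambda>x. \<sigma> * x) (normal_density 0 \<sigma>)"
    by simp
  then have "density lborel (normal_density 0 \<sigma>) = distr std_normal_distribution lborel (\<lambda>x. \<sigma> * x)"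
    unfolding distributed_def by simp
  then have "char (density lborel (normal_density 0 \<sigma>)) u
      = (CLINT x|distr std_normal_distribution lborel (\<lambda>x. \<sigma> * x). iexp (u * x))"
    by (simp add: char_def)
  also have "\<dots> = (CLINT x|std_normal_distribution. iexp (u * (\<sigma> * x)))"
    by (subst integral_distr) (auto simp del: of_real_mult)
  also have "\<dots> = char std_normal_distribution (u * \<sigma>)"
    unfolding char_def by (simp add: mult.assoc)
  also have "\<dots> = exp (- (\<sigma>\<^sup>2 * u\<^sup>2) / 2)"
    unfolding char_std_normal_distribution by (simp add: power_mult_distrib mult.commute)
  finally show ?thesis .
qed

lemma borel_measurable_vec_iff:
  fixes f :: "'a \<Rightarrow> real ^ ('d::finite)"
  shows "f \<in> borel_measurable M \<longleftrightarrow> (\<forall>i. (\<lambda>x. f x $ i) \<in> borel_measurable M)"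
proof -
  have "f \<in> borel_measurable M \<longleftrightarrow> (\<forall>b\<in>Basis. (\<lambda>x. f x \<bullet> b) \<in> borel_measurable M)"
    by (rule borel_measurable_euclidean_space)
  also have "(Basis :: (real ^ 'd) set) = range (\<lambda>i. axis i 1)"
    by (auto simp: Basis_vec_def)
  finally show ?thesis by (simp add: cart_eq_inner_axis)
qed

section \<open>Natural filtrations are generated by cylinders\<close>

definition cylinders :: "'w set \<Rightarrow> (real \<Rightarrow> 'w \<Rightarrow> 'b::topological_space) \<Rightarrow> real set \<Rightarrow> 'w set set" where
  "cylinders \<Omega> X T = {{w \<in> \<Omega>. \<forall>r\<in>J. X r w \<in> B r} | J B. finite J \<and> J \<subseteq> T \<and> (\<forall>r\<in>J. B r \<in> sets borel)}"

lemma Int_stable_cylinders: "Int_stable (cylinders \<Omega> X T)"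
proof (rule Int_stableI)
  fix a b assume "a \<in> cylinders \<Omega> X T" "b \<in> cylinders \<Omega> X T"
  then obtain J B K C where J: "finite J" "J \<subseteq> T" "\<forall>r\<in>J. B r \<in> sets borel" "a = {w \<in> \<Omega>. \<forall>r\<in>J. X r w \<in> B r}"
    and K: "finite K" "K \<subseteq> T" "\<forall>r\<in>K. C r \<in> sets borel" "b = {w \<in> \<Omega>. \<forall>r\<in>K. X r w \<in> C r}"
    unfolding cylinders_def by blast
  let ?D = "\<lambda>r. (if r \<in> J then B r else UNIV) \<inter> (if r \<in> K then C r else UNIV)"
  have "a \<inter> b = {w \<in> \<Omega>. \<forall>r\<in>J \<union> K. X r w \<in> ?D r}" using J K by auto
  moreover have "\<forall>r\<in>J \<union> K. ?D r \<in> sets borel" using J K by auto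
  ultimately show "a \<inter> b \<in> cylinders \<Omega> X T"
    unfolding cylinders_def using J K by (intro CollectI exI[of _ "J \<union> K"] exI[of _ ?D]) auto
qed

lemma space_natural_filtration [simp]: "space (natural_filtration \<Omega> X t) = \<Omega>"
  unfolding natural_filtration_def by (rule space_measure_of) auto

lemma sets_natural_filtration:
  "sets (natural_filtration \<Omega> X t) = sigma_sets \<Omega> {X s -` B \<inter> \<Omega> | s B. 0 \<le> s \<and> s \<le> t \<and> B \<in> sets borel}"
  unfolding natural_filtration_def by (rule sets_measure_of) auto

lemma measurable_natural_filtration:
  "0 \<le> s \<Longrightarrow> s \<le> t \<Longrightarrow> X s \<in> borel_measurable (natural_filtration \<Omega> X t)"
  by (rule measurableI) (auto simp: sets_natural_filtration intro!: sigma_sets.Basic)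

lemma natural_filtration_least:
  assumes "\<And>s. 0 \<le> s \<Longrightarrow> s \<le> t \<Longrightarrow> X s \<in> borel_measurable N" "space N = \<Omega>"
  shows "sets (natural_filtration \<Omega> X t) \<subseteq> sets N"
proof -
  have "{X s -` B \<inter> \<Omega> | s B. 0 \<le> s \<and> s \<le> t \<and> B \<in> sets borel} \<subseteq> sets N"
    using measurable_sets[OF assms(1)] assms(2) by blast
  then show ?thesis unfolding sets_natural_filtration assms(2)[symmetric] by (rule sets.sigma_sets_subset)
qed

lemma finite_event_in_natural_filtration:
  assumes "finite J" "\<And>r B. (r, B) \<in> J \<Longrightarrow> 0 \<le> r \<and> r \<le> t \<and> B \<in> sets borel"
  shows "{w \<in> \<Omega>. \<forall>p\<in>J. X (fst p) w \<in> snd p} \<in> sets (natural_filtration \<Omega> X t)"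
proof -
  have "{w \<in> \<Omega>. X (fst p) w \<in> snd p} \<in> sets (natural_filtration \<Omega> X t)" if "p \<in> J" for p
  proof -
    have "X (fst p) -` snd p \<inter> \<Omega> \<in> sets (natural_filtration \<Omega> X t)"
      unfolding sets_natural_filtration using assms(2)[of "fst p" "snd p"] that
      by (intro sigma_sets.Basic CollectI exI[of _ "fst p"] exI[of _ "snd p"]) auto
    then show ?thesis by (simp add: vimage_def Int_def conj_commute)
  qed
  with sets.sets_Collect_finite_All[of J "natural_filtration \<Omega> X t" "\<lambda>p w. X (fst p) w \<in> snd p"] assms(1)
  show ?thesis by simp
qed

lemma sets_natural_filtration_cylinders:
  "sets (natural_filtration \<Omega> X t) = sigma_sets \<Omega> (cylinders \<Omega> X {0..t})"
proof (rule antisym)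
  show "sets (natural_filtration \<Omega> X t) \<subseteq> sigma_sets \<Omega> (cylinders \<Omega> X {0..t})"
    unfolding sets_natural_filtration
  proof (rule sigma_sets_mono, safe)
    fix s and B :: "'b set" assume *: "0 \<le> s" "s \<le> t" "B \<in> sets borel"
    have "X s -` B \<inter> \<Omega> = {w \<in> \<Omega>. \<forall>r\<in>{s}. X r w \<in> B}" by auto
    also have "\<dots> \<in> cylinders \<Omega> X {0..t}"
      unfolding cylinders_def using * by (intro CollectI exI[of _ "{s}"] exI[of _ "\<lambda>_. B"]) auto
    finally show "X s -` B \<inter> \<Omega> \<in> sigma_sets \<Omega> (cylinders \<Omega> X {0..t})" by auto
  qed
  show "sigma_sets \<Omega> (cylinders \<Omega> X {0..t}) \<subseteq> sets (natural_filtration \<Omega> X t)"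
  proof -
    have "cylinders \<Omega> X {0..t} \<subseteq> sets (natural_filtration \<Omega> X t)"
    proof
      fix a assume "a \<in> cylinders \<Omega> X {0..t}"
      then obtain J B where J: "finite J" "J \<subseteq> {0..t}" "\<forall>r\<in>J. B r \<in> sets borel" "a = {w \<in> \<Omega>. \<forall>r\<in>J. X r w \<in> B r}"
        unfolding cylinders_def by blast
      have "{w \<in> \<Omega>. \<forall>p\<in>(\<lambda>r. (r, B r)) ` J. X (fst p) w \<in> snd p} \<in> sets (natural_filtration \<Omega> X t)"
        by (rule finite_event_in_natural_filtration) (use J in auto)
      then show "a \<in> sets (natural_filtration \<Omega> X t)" using J by simp
    qed
    then show ?thesis using sets.sigma_sets_subset[of _ "natural_filtration \<Omega> X t"] by simp
  qed
qed

section \<open>Increments determine Wiener measure\<close>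

abbreviation increment :: "(nat \<Rightarrow> real) \<Rightarrow> nat \<times> 'd \<Rightarrow> ('d::finite) path \<Rightarrow> real" where
  "increment \<tau> \<equiv> (\<lambda>(k, i) w. (w (\<tau> (Suc k)) - w (\<tau> k)) $ i)"

text \<open>
  Sorting the times of a cylinder yields the partition \<open>\<tau>\<close>; a path started at 0 is recovered at the
  partition points by summing its increments. The set \<open>S\<close> depends on the cylinder alone and not on a
  measure, which is what allows two Wiener measures to be compared.
\<close>

lemma cylinder_determined_by_increments:
  fixes B :: "real \<Rightarrow> (real ^ ('d::finite)) set"
  assumes J: "finite J" "0 \<in> J" "J \<subseteq> {0..1}" and B: "\<And>r. r \<in> J \<Longrightarrow> B r \<in> sets borel"
  obtains n \<tau> S where "\<tau> 0 = 0" "\<tau> n = Max J" "\<forall>k\<le>n. \<tau> k \<in> {0..1}"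
    "\<forall>k<n. \<tau> k < \<tau> (Suc k)" "S \<in> sets (PiM ({..<n} \<times> (UNIV :: 'd set)) (\<lambda>_. borel))"
    "\<And>w. w 0 = 0 \<Longrightarrow> (\<forall>r\<in>J. w r \<in> B r) \<longleftrightarrow> (\<lambda>p\<in>{..<n} \<times> UNIV. increment \<tau> p w) \<in> S"
proof -
  define xs where "xs = sorted_list_of_set J"
  define n where "n = card J - 1"
  define \<tau> where "\<tau> = (\<lambda>k. xs ! k)"
  have len: "length xs = Suc n" using J card_gt_0_iff[of J] by (auto simp: xs_def n_def)
  have set: "set xs = J" using J by (simp add: xs_def)
  have sorted: "sorted_wrt (<) xs" by (simp add: xs_def)
  have mono: "\<tau> k < \<tau> l" if "k < l" "l \<le> n" for k l
    using sorted_wrt_nth_less[OF sorted that(1)] that len by (simp add: \<tau>_def)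
  have Jeq: "J = \<tau> ` {..n}"
    unfolding set[symmetric] \<tau>_def by (auto simp: set_conv_nth len less_Suc_eq_le)
  have le: "\<tau> k \<le> \<tau> l" if "k \<le> l" "l \<le> n" for k l
    using mono[of k l] that by (cases "k = l") auto
  have \<tau>0: "\<tau> 0 = 0"
  proof -
    obtain m where "m \<le> n" "\<tau> m = 0" using J(2) unfolding Jeq by auto
    moreover have "\<tau> 0 \<in> J" unfolding Jeq by auto
    ultimately show ?thesis using le[of 0 m] J(3) by auto
  qed
  have \<tau>n: "\<tau> n = Max J"
    by (rule Max_eqI[symmetric]) (use J in \<open>auto simp: Jeq intro: le\<close>)
  let ?I = "{..<n} \<times> (UNIV :: 'd set)"
  let ?P = "PiM ?I (\<lambda>_. borel :: real measure)"
  define V :: "nat \<Rightarrow> (nat \<times> 'd \<Rightarrow> real) \<Rightarrow> real ^ 'd" where "V = (\<lambda>m x. \<chi> i. \<Sum>k<m. x (k, i))"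
  have V: "V m \<in> borel_measurable ?P" if "m \<le> n" for m
    unfolding borel_measurable_vec_iff V_def using that
    by (auto intro!: borel_measurable_sum measurable_component_singleton)
  define S where "S = {x \<in> space ?P. \<forall>m\<in>{..n}. V m x \<in> B (\<tau> m)}"
  have S: "S \<in> sets ?P"
    unfolding S_def
  proof (rule sets.sets_Collect_finite_All)
    fix m assume "m \<in> {..n}"
    then have "V m -` B (\<tau> m) \<inter> space ?P \<in> sets ?P"
      using B V Jeq by (intro measurable_sets) auto
    also have "V m -` B (\<tau> m) \<inter> space ?P = {x \<in> space ?P. V m x \<in> B (\<tau> m)}" by auto
    finally show "{x \<in> space ?P. V m x \<in> B (\<tau> m)} \<in> sets ?P" .
  qed auto
  have eq: "(\<forall>r\<in>J. w r \<in> B r) \<longleftrightarrow> (\<lambda>p\<in>?I. increment \<tau> p w) \<in> S" if "w 0 = 0" for w :: "'d path"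
  proof -
    have Vw: "V m (\<lambda>p\<in>?I. increment \<tau> p w) = w (\<tau> m)" if "m \<le> n" for m
    proof -
      have "V m (\<lambda>p\<in>?I. increment \<tau> p w) $ i = (\<Sum>k<m. w (\<tau> (Suc k)) $ i - w (\<tau> k) $ i)" for i
        unfolding V_def using that by auto
      then show ?thesis
        using \<open>w 0 = 0\<close> \<tau>0 by (simp add: vec_eq_iff sum_lessThan_telescope[of "\<lambda>k. w (\<tau> k) $ _"])
    qed
    have "(\<lambda>p\<in>?I. increment \<tau> p w) \<in> space ?P" by (auto simp: space_PiM)
    then have "(\<lambda>p\<in>?I. increment \<tau> p w) \<in> S \<longleftrightarrow> (\<forall>m\<in>{..n}. w (\<tau> m) \<in> B (\<tau> m))"
      unfolding S_def using Vw by auto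
    then show ?thesis unfolding Jeq by auto
  qed
  show ?thesis
    by (rule that[OF \<tau>0 \<tau>n _ _ S eq]) (use mono J(3) Jeq in auto)
qed

locale wiener =
  fixes M :: "('d::finite) path measure"
  assumes wiener: "wiener_measure M"

sublocale wiener \<subseteq> prob_space M
  using wiener by (simp add: wiener_measure_def)

context wiener
begin

lemma sets_eq: "sets M = sets path_algebra" using wiener by (simp add: wiener_measure_def)

lemma space_eq: "space M = {w \<in> extensional {0..1}. continuous_on {0..1} w}"
  unfolding sets_eq_imp_space_eq[OF sets_eq] path_algebra_def space_restrict_space space_PiM
  by (auto simp: PiE_def)

lemma measurable_into_PiM: "(\<lambda>w. w) \<in> M \<rightarrow>\<^sub>M (\<Pi>\<^sub>M t\<in>{0..1}. borel)"
  unfolding measurable_cong_sets[OF sets_eq refl] path_algebra_def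
  by (rule measurable_restrict_space1) simp

lemma coordinate_measurable: "t \<in> {0..1} \<Longrightarrow> (\<lambda>w. w t) \<in> borel_measurable M"
  using measurable_comp[OF measurable_into_PiM measurable_component_singleton] by (simp add: comp_def)

lemma start: "AE w in M. w 0 = 0" using wiener by (simp add: wiener_measure_def)

lemma increment_measurable [measurable]:
  assumes "\<forall>k\<le>n. \<tau> k \<in> {0..1}" "p \<in> {..<n} \<times> UNIV"
  shows "increment \<tau> p \<in> borel_measurable M"
proof -
  obtain k i where p: "p = (k, i)" "k < n" using assms(2) by auto
  have "(\<lambda>w. w (\<tau> (Suc k)) - w (\<tau> k)) \<in> borel_measurable M"
    using assms(1) p by (intro borel_measurable_diff coordinate_measurable) auto
  then show ?thesis using p by (simp add: borel_measurable_vec_iff)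
qed

lemma increments_indep:
  assumes "\<forall>k\<le>n. \<tau> k \<in> {0..1}" "\<forall>k<n. \<tau> k < \<tau> (Suc k)"
  shows "indep_vars (\<lambda>_. borel) (increment \<tau>) ({..<n} \<times> UNIV)"
  using wiener assms unfolding wiener_measure_def by blast

lemma increment_distributed:
  "0 \<le> s \<Longrightarrow> s < t \<Longrightarrow> t \<le> 1 \<Longrightarrow>
    distributed M lborel (\<lambda>w. (w t - w s) $ i) (normal_density 0 (sqrt (t - s)))"
  using wiener unfolding wiener_measure_def by blast

lemma increment_distr:
  assumes "0 \<le> s" "s < t" "t \<le> 1"
  shows "distr M borel (\<lambda>w. (w t - w s) $ i) = density lborel (normal_density 0 (sqrt (t - s)))"
proof -
  have "distr M borel (\<lambda>w. (w t - w s) $ i) = distr M lborel (\<lambda>w. (w t - w s) $ i)"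
    by (rule distr_cong) auto
  then show ?thesis using increment_distributed[OF assms, of i] by (simp add: distributed_def)
qed

text \<open>
  The right-hand side does not mention \<open>M\<close>: all Wiener measures give increments the same joint law.
\<close>

lemma increments_law:
  assumes \<tau>: "\<forall>k\<le>n. \<tau> k \<in> {0..1}" "\<forall>k<n. \<tau> k < \<tau> (Suc k)" and n: "0 < n"
  shows "distr M (PiM ({..<n} \<times> UNIV) (\<lambda>_. borel)) (\<lambda>w. \<lambda>p\<in>{..<n} \<times> UNIV. increment \<tau> p w)
    = PiM ({..<n} \<times> UNIV) (\<lambda>(k, i). density lborel (normal_density 0 (sqrt (\<tau> (Suc k) - \<tau> k))))"
proof -
  have "distr M (PiM ({..<n} \<times> UNIV) (\<lambda>_. borel)) (\<lambda>w. \<lambda>p\<in>{..<n} \<times> UNIV. increment \<tau> p w)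
      = PiM ({..<n} \<times> UNIV) (\<lambda>p. distr M borel (increment \<tau> p))"
    using n increments_indep[OF \<tau>] increment_measurable[OF \<tau>(1)]
      indep_vars_iff_distr_eq_PiM'[where I = "{..<n} \<times> UNIV" and M' = "\<lambda>_. borel" and X = "increment \<tau>"]
    by (auto simp: lessThan_empty_iff)
  also have "\<dots> = PiM ({..<n} \<times> UNIV) (\<lambda>(k, i). density lborel (normal_density 0 (sqrt (\<tau> (Suc k) - \<tau> k))))"
  proof (rule PiM_cong[OF refl])
    fix p :: "nat \<times> 'd" assume "p \<in> {..<n} \<times> UNIV"
    then obtain k i where p: "p = (k, i)" "k < n" by auto
    then have "0 \<le> \<tau> k" "\<tau> k < \<tau> (Suc k)" "\<tau> (Suc k) \<le> 1"
      using \<tau>(1)[rule_format, of k] \<tau>(1)[rule_format, of "Suc k"] \<tau>(2) by auto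
    then show "distr M borel (increment \<tau> p) =
        (case p of (k, i) \<Rightarrow> density lborel (normal_density 0 (sqrt (\<tau> (Suc k) - \<tau> k))))"
      unfolding p using increment_distr[of "\<tau> k" "\<tau> (Suc k)" i] by simp
  qed
  finally show ?thesis .
qed

end

text \<open>
  On a cylinder a Wiener measure equals a product of Gaussian laws. The time 1 is added to the times
  of the cylinder so that the partition has at least one step, as the product formula for laws of
  independent families needs a nonempty index set.
\<close>

theorem wiener_measure_unique:
  assumes "wiener_measure M" "wiener_measure (M' :: ('d::finite) path measure)"
  shows "M = M'"
proof -
  interpret M: wiener M by standard fact
  interpret M': wiener M' by standard fact
  let ?P = "\<Pi>\<^sub>M t\<in>{0..1::real}. (borel :: (real ^ 'd) measure)"
  have sp: "space M = space M'" by (simp add: M.space_eq M'.space_eq)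
  have "distr M ?P (\<lambda>w. w) = distr M' ?P (\<lambda>w. w)"
  proof (rule measure_eqI_PiM_infinite)
    show "finite_measure (distr M ?P (\<lambda>w. w))"
      by (intro prob_space.finite_measure M.prob_space_distr M.measurable_into_PiM)
    fix A J assume J: "finite J" "J \<subseteq> {0..1::real}" and A: "\<And>i. i \<in> J \<Longrightarrow> A i \<in> sets (borel :: (real ^ 'd) measure)"
    define B where "B = (\<lambda>r. if r \<in> J then A r else UNIV)"
    have J': "finite (J \<union> {0, 1})" "0 \<in> J \<union> {0, 1}" "J \<union> {0, 1} \<subseteq> {0..1}" using J by auto
    have B: "B r \<in> sets borel" for r using A by (auto simp: B_def)
    obtain n \<tau> S where \<tau>: "\<tau> 0 = 0" "\<tau> n = Max (J \<union> {0, 1})" "\<forall>k\<le>n. \<tau> k \<in> {0..1}"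
      "\<forall>k<n. \<tau> k < \<tau> (Suc k)" and S: "S \<in> sets (PiM ({..<n} \<times> (UNIV :: 'd set)) (\<lambda>_. borel))"
      and eq: "\<And>w. w 0 = 0 \<Longrightarrow> (\<forall>r\<in>J \<union> {0, 1}. w r \<in> B r) \<longleftrightarrow> (\<lambda>p\<in>{..<n} \<times> UNIV. increment \<tau> p w) \<in> S"
      by (rule cylinder_determined_by_increments[of _ B, OF J' B]) (rule that)
    have "1 \<le> Max (J \<union> {0, 1})" using J by (intro Max_ge) auto
    then have n: "0 < n" using \<tau>(1,2) by (cases n) auto
    have law: "emeasure (distr N ?P (\<lambda>w. w)) (prod_emb {0..1} (\<lambda>_. borel) J (Pi\<^sub>E J A))
        = emeasure (PiM ({..<n} \<times> UNIV) (\<lambda>(k, i). density lborel (normal_density 0 (sqrt (\<tau> (Suc k) - \<tau> k))))) S"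
      if "wiener N" for N :: "'d path measure"
    proof -
      interpret N: wiener N by fact
      have E: "prod_emb {0..1} (\<lambda>_. borel) J (Pi\<^sub>E J A) \<in> sets ?P"
        using J A by (intro sets_PiM_I) auto
      let ?D = "\<lambda>w. \<lambda>p\<in>{..<n} \<times> UNIV. increment \<tau> p w"
      have D: "?D \<in> N \<rightarrow>\<^sub>M PiM ({..<n} \<times> UNIV) (\<lambda>_. borel)"
        using N.increment_measurable[OF \<tau>(3)] by (intro measurable_restrict) auto
      have "emeasure (distr N ?P (\<lambda>w. w)) (prod_emb {0..1} (\<lambda>_. borel) J (Pi\<^sub>E J A))
        = emeasure N (prod_emb {0..1} (\<lambda>_. borel) J (Pi\<^sub>E J A) \<inter> space N)"
        using E by (subst emeasure_distr[OF N.measurable_into_PiM]) auto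
      also have "\<dots> = emeasure N (?D -` S \<inter> space N)"
      proof (rule emeasure_eq_AE)
        show "AE w in N. w \<in> prod_emb {0..1} (\<lambda>_. borel) J (Pi\<^sub>E J A) \<inter> space N \<longleftrightarrow> w \<in> ?D -` S \<inter> space N"
          using N.start
        proof eventually_elim
          case (elim w)
          have "w \<in> prod_emb {0..1} (\<lambda>_. borel) J (Pi\<^sub>E J A) \<inter> space N \<longleftrightarrow> w \<in> space N \<and> (\<forall>r\<in>J. w r \<in> A r)"
            by (auto simp: prod_emb_def PiE_iff N.space_eq)
          also have "\<dots> \<longleftrightarrow> w \<in> space N \<and> (\<forall>r\<in>J \<union> {0, 1}. w r \<in> B r)" by (auto simp: B_def)
          also have "\<dots> \<longleftrightarrow> w \<in> ?D -` S \<inter> space N"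
            using eq[of w] elim by auto
          finally show ?case .
        qed
        show "prod_emb {0..1} (\<lambda>_. borel) J (Pi\<^sub>E J A) \<inter> space N \<in> sets N"
          using measurable_sets[OF N.measurable_into_PiM E] by simp
        show "?D -` S \<inter> space N \<in> sets N" by (rule measurable_sets[OF D S])
      qed
      also have "\<dots> = emeasure (distr N (PiM ({..<n} \<times> UNIV) (\<lambda>_. borel)) ?D) S"
        by (rule emeasure_distr[OF D S, symmetric])
      finally show ?thesis unfolding N.increments_law[OF \<tau>(3,4) n] .
    qed
    show "emeasure (distr M ?P (\<lambda>w. w)) (prod_emb {0..1} (\<lambda>_. borel) J (Pi\<^sub>E J A))
        = emeasure (distr M' ?P (\<lambda>w. w)) (prod_emb {0..1} (\<lambda>_. borel) J (Pi\<^sub>E J A))"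
      using law[OF M.wiener_axioms] law[OF M'.wiener_axioms] by simp
  qed auto
  then have eq: "emeasure (distr M ?P (\<lambda>w. w)) A = emeasure (distr M' ?P (\<lambda>w. w)) A" for A by simp
  show ?thesis
  proof (rule measure_eqI)
    show "sets M = sets M'" by (simp add: M.sets_eq M'.sets_eq)
    fix A assume "A \<in> sets M"
    then obtain A' where A': "A' \<in> sets ?P" "A = {w. continuous_on {0..1} w} \<inter> A'"
      unfolding M.sets_eq path_algebra_def sets_restrict_space by auto
    moreover have "A' \<subseteq> extensional {0..1}"
      using sets.sets_into_space[OF A'(1)] by (auto simp: space_PiM PiE_def)
    ultimately have "A = A' \<inter> space M" by (auto simp: M.space_eq)
    then show "emeasure M A = emeasure M' A"
      using eq[of A'] emeasure_distr[OF M.measurable_into_PiM A'(1)] emeasure_distr[OF M'.measurable_into_PiM A'(1)]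
      by (simp add: sp)
  qed
qed

section \<open>Increments are independent of the augmented past\<close>

lemma Int_stable_vimages: "Int_stable {X -` C \<inter> \<Omega> | C. C \<in> sets S}"
proof (rule Int_stableI)
  fix a b assume "a \<in> {X -` C \<inter> \<Omega> | C. C \<in> sets S}" "b \<in> {X -` C \<inter> \<Omega> | C. C \<in> sets S}"
  then obtain C D where "a = X -` C \<inter> \<Omega>" "b = X -` D \<inter> \<Omega>" "C \<in> sets S" "D \<in> sets S" by auto
  then show "a \<inter> b \<in> {X -` C \<inter> \<Omega> | C. C \<in> sets S}" by (intro CollectI exI[of _ "C \<inter> D"]) auto
qed

lemma (in prob_space) indep_var_of_indep_set:
  assumes ind: "indep_set (sets F) {X -` C \<inter> space M | C. C \<in> sets S}"
    and F: "space F = space M"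
    and G: "G \<in> F \<rightarrow>\<^sub>M T" and X: "X \<in> M \<rightarrow>\<^sub>M S" and h: "h \<in> S \<rightarrow>\<^sub>M U"
  shows "indep_var T G U (\<lambda>w. h (X w))"
  unfolding indep_var_eq
proof (intro conjI)
  have sub: "sets F \<subseteq> events" using ind by (rule indep_setD_ev1)
  then show "random_variable T G"
    using G F by (auto simp: measurable_def)
  show "random_variable U (\<lambda>w. h (X w))" using measurable_comp[OF X h] by (simp add: comp_def)
  let ?B = "{X -` C \<inter> space M | C. C \<in> sets S}"
  have "indep_set (sigma_sets (space M) (sets F)) (sigma_sets (space M) ?B)"
  proof (rule indep_set_sigma_sets[OF ind])
    show "Int_stable (sets F)" by (rule sets.Int_stable)
    show "Int_stable ?B" by (rule Int_stable_vimages)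
  qed
  moreover have "sigma_sets (space M) {G -` A \<inter> space M | A. A \<in> sets T} \<subseteq> sigma_sets (space M) (sets F)"
    using measurable_sets[OF G] F by (intro sigma_sets_subseteq) auto
  moreover have "sigma_sets (space M) {(\<lambda>w. h (X w)) -` A \<inter> space M | A. A \<in> sets U} \<subseteq> sigma_sets (space M) ?B"
  proof (intro sigma_sets_subseteq subsetI)
    fix a assume "a \<in> {(\<lambda>w. h (X w)) -` A \<inter> space M | A. A \<in> sets U}"
    then obtain A where A: "a = (\<lambda>w. h (X w)) -` A \<inter> space M" "A \<in> sets U" by auto
    then have "a = X -` (h -` A \<inter> space S) \<inter> space M" using measurable_space[OF X] by auto
    then show "a \<in> ?B" using measurable_sets[OF h A(2)] by (intro CollectI exI[of _ "h -` A \<inter> space S"]) auto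
  qed
  ultimately show "indep_set (sigma_sets (space M) {G -` A \<inter> space M | A. A \<in> sets T})
     (sigma_sets (space M) {(\<lambda>w. h (X w)) -` A \<inter> space M | A. A \<in> sets U})"
    unfolding indep_sets2_eq by blast
qed

context wiener
begin

text \<open>
  The definition of Wiener measure only speaks of finitely many increments. An event in the generating
  cylinders up to time \<open>s\<close> is determined by increments of a partition ending at \<open>s\<close>; adjoining \<open>t\<close> as one
  more partition point makes \<open>W t - W s\<close> the last group of an independent family.
\<close>

lemma past_increment_indep:
  assumes st: "0 \<le> s" "s < t" "t \<le> 1"
  shows "indep_set (sets (natural_filtration (space M) (\<lambda>s w. w s) s)) {(\<lambda>w. w t - w s) -` C \<inter> space M | C. C \<in> sets borel}"
    (is "indep_set _ ?R")
proof -
  have \<Delta> [measurable]: "(\<lambda>w. w t - w s) \<in> borel_measurable M"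
    using st by (intro borel_measurable_diff coordinate_measurable) auto
  have cyl_ev: "cylinders (space M) (\<lambda>s w. w s) {0..s} \<subseteq> events"
  proof -
    have "sets (natural_filtration (space M) (\<lambda>s w. w s) s) \<subseteq> events"
      using st by (intro natural_filtration_least coordinate_measurable) auto
    then show ?thesis unfolding sets_natural_filtration_cylinders by (auto intro: sigma_sets.Basic)
  qed
  have "indep_set (sigma_sets (space M) (cylinders (space M) (\<lambda>s w. w s) {0..s})) (sigma_sets (space M) ?R)"
  proof (rule indep_set_sigma_sets[OF _ Int_stable_cylinders])
    show "Int_stable ?R" by (rule Int_stable_vimages)
    show "indep_set (cylinders (space M) (\<lambda>s w. w s) {0..s}) ?R"
    proof (rule indep_setI[OF cyl_ev])
      show "?R \<subseteq> events" using measurable_sets[OF \<Delta>] by auto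
      fix a b assume a: "a \<in> cylinders (space M) (\<lambda>s w. w s) {0..s}" and b: "b \<in> ?R"
      from b obtain C where C: "b = (\<lambda>w. w t - w s) -` C \<inter> space M" "C \<in> sets borel" by auto
      from a obtain J B0 where J: "finite J" "J \<subseteq> {0..s}" and B0: "\<forall>r\<in>J. B0 r \<in> sets borel"
        and a_eq: "a = {w \<in> space M. \<forall>r\<in>J. w r \<in> B0 r}"
        unfolding cylinders_def by blast
      define B where "B = (\<lambda>r. if r \<in> J then B0 r else UNIV)"
      have B: "B r \<in> sets borel" for r using B0 by (auto simp: B_def)
      have J': "finite (J \<union> {0, s})" "0 \<in> J \<union> {0, s}" "J \<union> {0, s} \<subseteq> {0..1}" using J st by auto
      obtain n \<tau> S where \<tau>: "\<tau> 0 = 0" "\<tau> n = Max (J \<union> {0, s})" "\<forall>k\<le>n. \<tau> k \<in> {0..1}"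
        "\<forall>k<n. \<tau> k < \<tau> (Suc k)" and S: "S \<in> sets (PiM ({..<n} \<times> (UNIV :: 'd set)) (\<lambda>_. borel))"
        and eq: "\<And>w. w 0 = 0 \<Longrightarrow> (\<forall>r\<in>J \<union> {0, s}. w r \<in> B r) \<longleftrightarrow> (\<lambda>p\<in>{..<n} \<times> UNIV. increment \<tau> p w) \<in> S"
        by (rule cylinder_determined_by_increments[of _ B, OF J' B]) (rule that)
      have "Max (J \<union> {0, s}) = s" using J st by (intro Max_eqI) auto
      with \<tau> have \<tau>n: "\<tau> n = s" by simp
      \<comment> \<open>The partition of the past, extended by the future time \<open>t\<close>.\<close>
      define \<sigma> where "\<sigma> = \<tau>(Suc n := t)"
      have \<sigma>: "\<forall>k\<le>Suc n. \<sigma> k \<in> {0..1}" "\<forall>k<Suc n. \<sigma> k < \<sigma> (Suc k)"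
        using \<tau> \<tau>n st by (auto simp: \<sigma>_def less_Suc_eq le_Suc_eq)
      let ?A = "{..<n} \<times> (UNIV :: 'd set)" and ?B = "{n} \<times> (UNIV :: 'd set)"
      have iv: "indep_var (PiM ?A (\<lambda>_. borel)) (\<lambda>w. restrict (\<lambda>p. increment \<sigma> p w) ?A)
                  (PiM ?B (\<lambda>_. borel)) (\<lambda>w. restrict (\<lambda>p. increment \<sigma> p w) ?B)"
        by (rule indep_var_restrict[OF increments_indep[OF \<sigma>]]) auto
      have past: "restrict (\<lambda>p. increment \<sigma> p w) ?A = (\<lambda>p\<in>?A. increment \<tau> p w)" for w
        by (rule restrict_ext) (auto simp: \<sigma>_def)
      define V :: "(nat \<times> 'd \<Rightarrow> real) \<Rightarrow> real ^ 'd" where "V = (\<lambda>x. \<chi> i. x (n, i))"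
      have V: "V \<in> borel_measurable (PiM ?B (\<lambda>_. borel))"
        unfolding borel_measurable_vec_iff V_def by (auto intro!: measurable_component_singleton)
      define S2 where "S2 = V -` C \<inter> space (PiM ?B (\<lambda>_. borel :: real measure))"
      have S2: "S2 \<in> sets (PiM ?B (\<lambda>_. borel))" unfolding S2_def by (rule measurable_sets[OF V C(2)])
      have fut: "restrict (\<lambda>p. increment \<sigma> p w) ?B \<in> S2 \<longleftrightarrow> w t - w s \<in> C" for w
      proof -
        have "V (restrict (\<lambda>p. increment \<sigma> p w) ?B) = w t - w s"
          by (simp add: V_def vec_eq_iff \<sigma>_def \<tau>n)
        then show ?thesis unfolding S2_def by (auto simp: space_PiM)
      qed
      let ?p = "\<lambda>w. \<lambda>p\<in>?A. increment \<tau> p w"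
      let ?f = "\<lambda>w. restrict (\<lambda>p. increment \<sigma> p w) ?B"
      have pm: "?p \<in> M \<rightarrow>\<^sub>M PiM ?A (\<lambda>_. borel)" using indep_var_rv1[OF iv] unfolding past .
      have pS: "?p -` S \<inter> space M \<in> events" by (rule measurable_sets[OF pm S])
      have aev: "a \<in> events" using cyl_ev a by auto
      have bev: "b \<in> events" using measurable_sets[OF \<Delta> C(2)] C(1) by simp
      have ae: "AE w in M. w \<in> a \<longleftrightarrow> w \<in> ?p -` S \<inter> space M"
        using start
      proof eventually_elim
        case (elim w)
        have "w \<in> a \<longleftrightarrow> w \<in> space M \<and> (\<forall>r\<in>J \<union> {0, s}. w r \<in> B r)"
          unfolding a_eq by (auto simp: B_def)
        then show ?case using eq[of w] elim by auto
      qed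
      have b_eq: "b = ?f -` S2 \<inter> space M" unfolding C(1) using fut by auto
      have "prob (a \<inter> b) = prob ((?p -` S \<inter> space M) \<inter> b)"
        using ae pS aev bev by (intro finite_measure_eq_AE) auto
      also have "\<dots> = prob ((\<lambda>x. (?p x, ?f x)) -` (S \<times> S2) \<inter> space M)"
        unfolding b_eq by (rule arg_cong[where f = prob]) auto
      also have "\<dots> = prob (?p -` S \<inter> space M) * prob (?f -` S2 \<inter> space M)"
        using indep_varD[OF iv S S2] unfolding past .
      also have "prob (?p -` S \<inter> space M) = prob a"
        using ae pS aev by (intro finite_measure_eq_AE) auto
      finally show "prob (a \<inter> b) = prob a * prob b" unfolding b_eq[symmetric] .
    qed
  qed
  note ind = this
  have eq: "sets (natural_filtration (space M) (\<lambda>s w. w s) s) = sigma_sets (space M) (cylinders (space M) (\<lambda>s w. w s) {0..s})"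
    by (rule sets_natural_filtration_cylinders)
  show ?thesis
  proof (rule indep_setI)
    show "sets (natural_filtration (space M) (\<lambda>s w. w s) s) \<subseteq> events" unfolding eq using ind by (rule indep_setD_ev1)
    show "?R \<subseteq> events" using measurable_sets[OF \<Delta>] by auto
    fix a b assume "a \<in> sets (natural_filtration (space M) (\<lambda>s w. w s) s)" "b \<in> ?R"
    then show "prob (a \<inter> b) = prob a * prob b"
      unfolding eq by (rule indep_setD[OF ind _ sigma_sets.Basic])
  qed
qed

end

sublocale wiener \<subseteq> C: prob_space "completion M"
  by (rule prob_space_completion)

context wiener
begin

lemma space_wiener_filtration [simp]: "space (wiener_filtration M t) = space M"
  unfolding wiener_filtration_def
  by (rule space_measure_of) (use sets.sets_into_space[of _ "natural_filtration (space M) (\<lambda>s w. w s) t"]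
      sets.sets_into_space[of _ "completion M"] in \<open>auto simp: null_sets_def\<close>)

lemma sets_wiener_filtration:
  "sets (wiener_filtration M t) =
    sigma_sets (space M) (sets (natural_filtration (space M) (\<lambda>s w. w s) t) \<union> null_sets (completion M))"
  unfolding wiener_filtration_def
  by (rule sets_measure_of) (use sets.sets_into_space[of _ "natural_filtration (space M) (\<lambda>s w. w s) t"]
      sets.sets_into_space[of _ "completion M"] in \<open>auto simp: null_sets_def\<close>)

lemma natural_sub: "t \<le> 1 \<Longrightarrow> sets (natural_filtration (space M) (\<lambda>s w. w s) t) \<subseteq> sets M"
  by (intro natural_filtration_least coordinate_measurable) auto

lemma wiener_filtration_sub: "t \<le> 1 \<Longrightarrow> sets (wiener_filtration M t) \<subseteq> sets (completion M)"
  using natural_sub[of t]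
    sets.sigma_sets_subset[of "sets (natural_filtration (space M) (\<lambda>s w. w s) t) \<union> null_sets (completion M)" "completion M"]
  unfolding sets_wiener_filtration by (auto simp: subset_iff)

lemma wiener_filtration_mono:
  assumes "s \<le> t" shows "sets (wiener_filtration M s) \<subseteq> sets (wiener_filtration M t)"
proof -
  have "sets (natural_filtration (space M) (\<lambda>s w. w s) s) \<subseteq> sets (natural_filtration (space M) (\<lambda>s w. w s) t)"
    using assms by (intro natural_filtration_least measurable_natural_filtration) auto
  then show ?thesis unfolding sets_wiener_filtration by (intro sigma_sets_mono') auto
qed

text \<open>
  Null sets are independent of everything, and they are stable under intersection with arbitrary
  events, so adding them to the natural filtration keeps a generator closed under intersections.
\<close>

lemma filtration_increment_indep:
  assumes st: "0 \<le> s" "s < t" "t \<le> 1"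
  shows "C.indep_set (sets (wiener_filtration M s)) {(\<lambda>w. w t - w s) -` C \<inter> space M | C. C \<in> sets borel}"
    (is "C.indep_set _ ?R")
proof -
  let ?G = "sets (natural_filtration (space M) (\<lambda>s w. w s) s)"
  have \<Delta> [measurable]: "(\<lambda>w. w t - w s) \<in> borel_measurable M"
    using st by (intro borel_measurable_diff coordinate_measurable) auto
  have R: "?R \<subseteq> sets M" using measurable_sets[OF \<Delta>] by auto
  have G: "?G \<subseteq> sets M" using natural_sub[of s] st by auto
  have "C.indep_set (?G \<union> null_sets (completion M)) ?R"
  proof (rule C.indep_setI)
    show "?G \<union> null_sets (completion M) \<subseteq> C.events" using G by auto
    show "?R \<subseteq> C.events" using R by auto
    fix a b assume a: "a \<in> ?G \<union> null_sets (completion M)" and b: "b \<in> ?R"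
    have bM: "b \<in> sets M" using R b by auto
    show "C.prob (a \<inter> b) = C.prob a * C.prob b"
    proof (cases "a \<in> ?G")
      case True
      then have "a \<in> sets M" using G by auto
      then show ?thesis using bM indep_setD[OF past_increment_indep[OF st] True b] by simp
    next
      case False
      then have "a \<in> null_sets (completion M)" using a by auto
      moreover from this have "a \<inter> b \<in> null_sets (completion M)" using bM by (intro null_set_Int2) auto
      ultimately show ?thesis by (simp add: measure_eq_0_null_sets)
    qed
  qed
  then have "C.indep_set (sigma_sets (space (completion M)) (?G \<union> null_sets (completion M))) (sigma_sets (space (completion M)) ?R)"
  proof (rule C.indep_set_sigma_sets)
    show "Int_stable ?R" by (rule Int_stable_vimages)
    show "Int_stable (?G \<union> null_sets (completion M))"
    proof (rule Int_stableI)
      fix a b assume a: "a \<in> ?G \<union> null_sets (completion M)" and b: "b \<in> ?G \<union> null_sets (completion M)"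
      then have "a \<in> sets (completion M)" "b \<in> sets (completion M)" using G by auto
      then show "a \<inter> b \<in> ?G \<union> null_sets (completion M)"
        using a b by (auto intro: null_set_Int1 null_set_Int2)
    qed
  qed
  then show ?thesis
    unfolding sets_wiener_filtration C.indep_sets2_eq by (auto intro: sigma_sets.Basic)
qed

lemma increment_integrals:
  assumes st: "0 \<le> s" "s < t" "t \<le> 1"
  shows "integrable (completion M) (\<lambda>w. ((w t - w s) $ i)\<^sup>2)"
    and "(\<integral>w. ((w t - w s) $ i)\<^sup>2 \<partial>completion M) = t - s"
    and "integrable (completion M) (\<lambda>w. (w t - w s) $ i)"
    and "(\<integral>w. (w t - w s) $ i \<partial>completion M) = 0"
proof -
  have d: "distributed M lborel (\<lambda>w. (w t - w s) $ i) (normal_density 0 (sqrt (t - s)))"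
    by (rule increment_distributed[OF st])
  have [measurable]: "(\<lambda>w. (w t - w s) $ i) \<in> borel_measurable M"
    using d by (auto simp: distributed_def)
  have \<sigma>: "0 < sqrt (t - s)" using st by simp
  have m: "expectation (\<lambda>w. (w t - w s) $ i) = 0"
    by (rule normal_distributed_expectation[OF \<sigma> d])
  have i2: "integrable M (\<lambda>w. ((w t - w s) $ i)\<^sup>2)"
    by (rule distributed_integrable[OF d, THEN iffD1])
      (use integrable_normal_moment[OF \<sigma>, of 0 2] in auto)
  have i1: "integrable M (\<lambda>w. (w t - w s) $ i)"
    by (rule distributed_integrable[OF d, THEN iffD1])
      (use integrable_normal_moment[OF \<sigma>, of 0 1] in auto)
  have v: "expectation (\<lambda>w. ((w t - w s) $ i)\<^sup>2) = t - s"
    using normal_distributed_variance[OF \<sigma> d] m st by simp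
  show "integrable (completion M) (\<lambda>w. ((w t - w s) $ i)\<^sup>2)" "integrable (completion M) (\<lambda>w. (w t - w s) $ i)"
    using i1 i2 by (simp_all add: integrable_completion del: vector_minus_component)
  show "(\<integral>w. ((w t - w s) $ i)\<^sup>2 \<partial>completion M) = t - s" "(\<integral>w. (w t - w s) $ i \<partial>completion M) = 0"
    using v m by (simp_all add: integral_completion del: vector_minus_component)
qed

lemma increment_char:
  assumes st: "0 \<le> s" "s < t" "t \<le> 1"
  shows "(CLINT w|completion M. iexp (l \<bullet> (w t - w s))) = exp (- ((norm l)\<^sup>2 * (t - s)) / 2)"
proof -
  define \<tau> where "\<tau> = (\<lambda>k::nat. if k = 0 then s else t)"
  have "indep_vars (\<lambda>_. borel) (increment \<tau>) ({..<1} \<times> UNIV)"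
    by (rule increments_indep) (use st in \<open>auto simp: \<tau>_def\<close>)
  then have iv: "indep_vars (\<lambda>_. borel) (increment \<tau>) ({0} \<times> UNIV)" by (simp add: lessThan_Suc)
  let ?h = "\<lambda>p x. iexp (l $ snd p * x)"
  have iv': "indep_vars (\<lambda>_. borel) (\<lambda>p w. ?h p (increment \<tau> p w)) ({0} \<times> UNIV)"
    by (rule indep_vars_compose2[OF iv]) auto
  have rv: "increment \<tau> p \<in> borel_measurable M" if "p \<in> {0} \<times> UNIV" for p
    using iv that by (auto simp: indep_vars_def)
  have \<Delta>: "(\<lambda>w. w t - w s) \<in> borel_measurable M"
    using st by (intro borel_measurable_diff coordinate_measurable) auto
  have "(CLINT w|completion M. iexp (l \<bullet> (w t - w s))) = (CLINT w|M. iexp (l \<bullet> (w t - w s)))"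
    by (rule integral_completion) (use \<Delta> in measurable)
  also have "\<dots> = (CLINT w|M. (\<Prod>p\<in>{0} \<times> UNIV. ?h p (increment \<tau> p w)))"
  proof (intro Bochner_Integration.integral_cong refl)
    fix w :: "'d path"
    have eq: "{0::nat} \<times> UNIV = Pair 0 ` (UNIV :: 'd set)" by auto
    have "(\<Prod>p\<in>{0::nat} \<times> UNIV. ?h p (increment \<tau> p w)) = exp (\<Sum>p\<in>{0::nat} \<times> UNIV. \<i> * complex_of_real (l $ snd p * increment \<tau> p w))"
      by (rule exp_sum[symmetric]) auto
    also have "(\<Sum>p\<in>{0::nat} \<times> UNIV. \<i> * complex_of_real (l $ snd p * increment \<tau> p w))
        = \<i> * complex_of_real (l \<bullet> (w t - w s))"
      unfolding eq by (subst sum.reindex) (auto simp: inj_on_def inner_vec_def \<tau>_def sum_distrib_left)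
    finally show "iexp (l \<bullet> (w t - w s)) = (\<Prod>p\<in>{0::nat} \<times> UNIV. ?h p (increment \<tau> p w))" ..
  qed
  also have "\<dots> = (\<Prod>p\<in>{0} \<times> UNIV. CLINT w|M. ?h p (increment \<tau> p w))"
  proof (rule indep_vars_lebesgue_integral[OF _ iv'])
    show "integrable M (\<lambda>w. ?h p (increment \<tau> p w))" if "p \<in> {0} \<times> UNIV" for p
      using rv[OF that] by (intro integrable_const_bound[where B=1]) auto
  qed auto
  also have "\<dots> = (\<Prod>p\<in>{0::nat} \<times> (UNIV :: 'd set). complex_of_real (exp (- ((t - s) * (l $ snd p)\<^sup>2) / 2)))"
  proof (rule prod.cong[OF refl])
    fix p :: "nat \<times> 'd" assume p: "p \<in> {0} \<times> UNIV"
    have "(CLINT w|M. ?h p (increment \<tau> p w)) = char (distr M borel (increment \<tau> p)) (l $ snd p)"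
      unfolding char_def using rv[OF p] by (subst integral_distr) auto
    also have "distr M borel (increment \<tau> p) = density lborel (normal_density 0 (sqrt (t - s)))"
      using p increment_distr[OF st, of "snd p"] by (auto simp: \<tau>_def)
    also have "char \<dots> (l $ snd p) = exp (- ((t - s) * (l $ snd p)\<^sup>2) / 2)"
      using st by (subst char_centred_normal) auto
    finally show "(CLINT w|M. ?h p (increment \<tau> p w)) = complex_of_real (exp (- ((t - s) * (l $ snd p)\<^sup>2) / 2))" .
  qed
  also have "\<dots> = exp (- ((norm l)\<^sup>2 * (t - s)) / 2)"
  proof -
    have eq: "{0::nat} \<times> UNIV = Pair 0 ` (UNIV :: 'd set)" by auto
    have "(\<Prod>p\<in>{0::nat} \<times> (UNIV :: 'd set). exp (- ((t - s) * (l $ snd p)\<^sup>2) / 2))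
      = exp (\<Sum>p\<in>{0::nat} \<times> (UNIV :: 'd set). - ((t - s) * (l $ snd p)\<^sup>2) / 2)"
      by (rule exp_sum[symmetric]) auto
    also have "(\<Sum>p\<in>{0::nat} \<times> (UNIV :: 'd set). - ((t - s) * (l $ snd p)\<^sup>2) / 2) = - ((norm l)\<^sup>2 * (t - s)) / 2"
      unfolding eq
      by (subst sum.reindex)
        (auto simp: inj_on_def power2_norm_eq_inner inner_vec_def power2_eq_square[of "l $ _"] sum_distrib_left
          sum_divide_distrib sum_negf mult.commute)
    finally show ?thesis unfolding of_real_prod[symmetric] by (simp only: of_real_eq_iff)
  qed
  finally show ?thesis .
qed

lemma increment_char_past:
  assumes st: "0 \<le> s" "s < t" "t \<le> 1"
    and G: "G \<in> borel_measurable (wiener_filtration M s)" and Gb: "\<And>w. w \<in> space M \<Longrightarrow> norm (G w :: complex) \<le> 1"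
  shows "(CLINT w|completion M. G w * iexp (l \<bullet> (w t - w s)))
       = (CLINT w|completion M. G w) * exp (- ((norm l)\<^sup>2 * (t - s)) / 2)"
proof -
  have \<Delta>: "(\<lambda>w. w t - w s) \<in> borel_measurable (completion M)"
    using st by (intro measurable_completion borel_measurable_diff coordinate_measurable) auto
  have iv: "C.indep_var borel G borel (\<lambda>w. iexp (l \<bullet> (w t - w s)))"
    by (rule C.indep_var_of_indep_set[where F = "wiener_filtration M s" and X = "\<lambda>w. w t - w s" and S = borel
        and h = "\<lambda>x. iexp (l \<bullet> x)"])
      (use filtration_increment_indep[OF st] G \<Delta> in auto)
  have "(CLINT w|completion M. G w * iexp (l \<bullet> (w t - w s)))
       = (CLINT w|completion M. G w) * (CLINT w|completion M. iexp (l \<bullet> (w t - w s)))"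
    by (rule C.indep_var_lebesgue_integral[OF iv])
      (use C.indep_var_rv1[OF iv] C.indep_var_rv2[OF iv] Gb in \<open>auto intro!: C.integrable_const_bound[where B=1]\<close>)
  then show ?thesis unfolding increment_char[OF st] .
qed

lemma increment_mean_past:
  assumes st: "0 \<le> s" "s < t" "t \<le> 1"
    and G: "G \<in> borel_measurable (wiener_filtration M s)" and Gb: "\<And>w. w \<in> space M \<Longrightarrow> \<bar>G w :: real\<bar> \<le> 1"
  shows "(\<integral>w. G w * (w t - w s) $ i \<partial>completion M) = 0"
proof -
  have \<Delta>: "(\<lambda>w. w t - w s) \<in> borel_measurable (completion M)"
    using st by (intro measurable_completion borel_measurable_diff coordinate_measurable) auto
  have iv: "C.indep_var borel G borel (\<lambda>w. (w t - w s) $ i)"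
    by (rule C.indep_var_of_indep_set[where F = "wiener_filtration M s" and X = "\<lambda>w. w t - w s" and S = borel
        and h = "\<lambda>x. x $ i"])
      (use filtration_increment_indep[OF st] G \<Delta> in \<open>auto intro: borel_measurable_vec_iff[THEN iffD1, rule_format] measurable_ident\<close>)
  have "(\<integral>w. G w * (w t - w s) $ i \<partial>completion M)
       = (\<integral>w. G w \<partial>completion M) * (\<integral>w. (w t - w s) $ i \<partial>completion M)"
    by (rule C.indep_var_lebesgue_integral[OF iv])
      (use C.indep_var_rv1[OF iv] increment_integrals(3)[OF st] Gb in \<open>auto intro!: C.integrable_const_bound[where B=1]\<close>)
  then show ?thesis unfolding increment_integrals(4)[OF st] by simp
qed

end

section \<open>The drift as a time integral\<close>

lemma prob_space_unit_time: "prob_space unit_time"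
proof
  show "emeasure unit_time (space unit_time) = 1"
    by (simp add: emeasure_restrict_space space_restrict_space)
qed

interpretation T: prob_space unit_time
  by (rule prob_space_unit_time)

lemma space_unit_time [simp]: "space unit_time = {0..1}"
  by (simp add: space_restrict_space)

lemma indicator_measurable_unit_time [measurable]:
  "A \<in> sets borel \<Longrightarrow> indicator A \<in> borel_measurable unit_time"
  by (rule measurable_restrict_space1) simp

lemma primitive_unit_time:
  "t \<le> 1 \<Longrightarrow> primitive g t = (\<integral>s. indicator {0..t} s *\<^sub>R g s \<partial>unit_time)"
  unfolding primitive_def set_lebesgue_integral_def
  by (subst integral_restrict_space) (auto intro!: Bochner_Integration.integral_cong simp: indicator_def)

lemma integrable_indicator_unit_time:
  fixes g :: "real \<Rightarrow> 'b :: {banach, second_countable_topology}"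
  assumes "integrable unit_time g" "A \<in> sets borel"
  shows "integrable unit_time (\<lambda>s. indicator A s *\<^sub>R g s)"
proof (rule Bochner_Integration.integrable_bound[OF assms(1)])
  show "(\<lambda>s. indicator A s *\<^sub>R g s) \<in> borel_measurable unit_time"
    using assms by (intro borel_measurable_scaleR indicator_measurable_unit_time) auto
qed (simp add: indicator_def)

lemma primitive_diff_nth:
  fixes g :: "real \<Rightarrow> real ^ ('d::finite)"
  assumes g: "integrable unit_time g" and ut: "0 \<le> u" "u \<le> t" "t \<le> 1"
  shows "(primitive g t - primitive g u) $ i = (\<integral>s. indicator {u<..t} s * g s $ i \<partial>unit_time)"
proof -
  have int: "integrable unit_time (\<lambda>s. indicator {0..v} s *\<^sub>R g s)" for v
    by (rule integrable_indicator_unit_time[OF g]) simp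
  have "primitive g t - primitive g u = (\<integral>s. indicator {0..t} s *\<^sub>R g s - indicator {0..u} s *\<^sub>R g s \<partial>unit_time)"
    using ut int by (simp add: primitive_unit_time)
  also have "\<dots> = (\<integral>s. indicator {u<..t} s *\<^sub>R g s \<partial>unit_time)"
    using ut by (intro Bochner_Integration.integral_cong) (auto simp: indicator_def)
  also have "\<dots> $ i = (\<integral>s. (indicator {u<..t} s *\<^sub>R g s) $ i \<partial>unit_time)"
    by (rule integral_bounded_linear[OF bounded_linear_vec_nth integrable_indicator_unit_time[OF g], symmetric]) simp
  finally show ?thesis by simp
qed

lemma primitive_0: "primitive g 0 = 0"
proof -
  have "(\<lambda>s::real. indicator {0..0} s *\<^sub>R g s) = (\<lambda>s. indicator {0} s *\<^sub>R g s)" by simp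
  moreover have "AE s in lborel. s \<noteq> (0::real)" by (rule AE_lborel_singleton)
  then have "AE s in lborel. indicator {0::real} s *\<^sub>R g s = 0" by eventually_elim (simp add: indicator_def)
  ultimately show ?thesis unfolding primitive_def set_lebesgue_integral_def by (simp add: integral_eq_zero_AE)
qed

lemma primitive_continuous:
  fixes g :: "real \<Rightarrow> real ^ ('d::finite)"
  assumes g: "integrable unit_time g"
  shows "continuous_on {0..1} (primitive g)"
proof -
  have s: "set_integrable lborel {0..1} g"
    using g unfolding set_integrable_def by (subst (asm) integrable_restrict_space) auto
  have "primitive g t = integral {0..t} g" if "t \<in> {0..1}" for t
  proof -
    have "set_integrable lborel {0..t} g"
      by (rule set_integrable_subset[OF s]) (use that in auto)
    then show ?thesis unfolding primitive_def by (rule set_borel_integral_eq_integral(2))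
  qed
  moreover have "continuous_on {0..1} (\<lambda>t. integral {0..t} g)"
    by (rule indefinite_integral_continuous_1) (rule set_borel_integral_eq_integral(1)[OF s])
  ultimately show ?thesis
    using continuous_on_cong[of "{0..1}" "{0..1}" "primitive g" "\<lambda>t. integral {0..t} g"] by blast
qed

text \<open>
  Cauchy-Schwarz on the interval, obtained by expanding the integral of \<open>(g - c)\<^sup>2\<close> where \<open>c\<close> is the mean
  of \<open>g\<close> there.
\<close>

lemma integral_interval_power2_le:
  fixes g :: "real \<Rightarrow> real"
  assumes g: "integrable unit_time g" "integrable unit_time (\<lambda>s. (g s)\<^sup>2)" and ut: "0 \<le> u" "u < t" "t \<le> 1"
  shows "(\<integral>s. indicator {u<..t} s * g s \<partial>unit_time)\<^sup>2 \<le> (t - u) * (\<integral>s. indicator {u<..t} s * (g s)\<^sup>2 \<partial>unit_time)"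
proof -
  let ?I = "\<lambda>s. indicator {u<..t} s :: real"
  define h where "h = t - u"
  define m where "m = (\<integral>s. ?I s * g s \<partial>unit_time)"
  have h: "h > 0" using ut by (simp add: h_def)
  have i0: "integrable unit_time ?I" by (rule T.integrable_const_bound[where B=1]) auto
  have I0: "(\<integral>s. ?I s \<partial>unit_time) = h"
  proof -
    have "(\<lambda>s. indicator {0..1} s *\<^sub>R ?I s) = ?I" using ut by (auto simp: indicator_def fun_eq_iff)
    then have "(\<integral>s. ?I s \<partial>unit_time) = (\<integral>s. ?I s \<partial>lborel)"
      by (subst integral_restrict_space) auto
    then show ?thesis using ut by (simp add: h_def)
  qed
  have i1: "integrable unit_time (\<lambda>s. ?I s * g s)" using integrable_indicator_unit_time[OF g(1), of "{u<..t}"] by simp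
  have i2: "integrable unit_time (\<lambda>s. ?I s * (g s)\<^sup>2)" using integrable_indicator_unit_time[OF g(2), of "{u<..t}"] by simp
  have "0 \<le> (\<integral>s. ?I s * (g s - m / h)\<^sup>2 \<partial>unit_time)"
    by (intro Bochner_Integration.integral_nonneg) auto
  also have "\<dots> = (\<integral>s. ?I s * (g s)\<^sup>2 - (2 * m / h) * (?I s * g s) + (m / h)\<^sup>2 * ?I s \<partial>unit_time)"
    by (intro Bochner_Integration.integral_cong) (auto simp: power2_eq_square algebra_simps)
  also have "\<dots> = (\<integral>s. ?I s * (g s)\<^sup>2 \<partial>unit_time) - (2 * m / h) * m + (m / h)\<^sup>2 * h"
    using i0 i1 i2 I0 by (simp add: m_def)
  also have "\<dots> = (\<integral>s. ?I s * (g s)\<^sup>2 \<partial>unit_time) - m\<^sup>2 / h"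
    using h by (simp add: power2_eq_square)
  finally have "m\<^sup>2 / h \<le> (\<integral>s. ?I s * (g s)\<^sup>2 \<partial>unit_time)" by simp
  then show ?thesis using h unfolding m_def[symmetric] h_def[symmetric]
    by (simp add: pos_divide_le_eq mult.commute)
qed

locale drifted_wiener = wiener M for M :: "('d::finite) path measure" +
  fixes f :: "real \<Rightarrow> 'd path \<Rightarrow> real ^ 'd"
  assumes drift_L2a: "f \<in> L2a M"

sublocale drifted_wiener \<subseteq> TC: pair_prob_space unit_time "completion M" ..

sublocale drifted_wiener \<subseteq> CT: pair_prob_space "completion M" unit_time ..

context drifted_wiener
begin

abbreviation drift :: "real \<Rightarrow> 'd path \<Rightarrow> real ^ 'd" where
  "drift t w \<equiv> primitive (\<lambda>s. f s w) t"

lemma f_measurable: "(\<lambda>(s, w). f s w) \<in> borel_measurable (unit_time \<Otimes>\<^sub>M completion M)"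
  using drift_L2a by (simp add: L2a_def L0a_def)

lemma f_measurable_swap: "(\<lambda>(w, s). f s w) \<in> borel_measurable (completion M \<Otimes>\<^sub>M unit_time)"
  using measurable_pair_swap[OF f_measurable] by (simp add: case_prod_beta')

lemma f_adapted: "t \<in> {0..1} \<Longrightarrow> f t \<in> borel_measurable (wiener_filtration M t)"
  using drift_L2a by (simp add: L2a_def L0a_def)

lemma f_path_measurable: "w \<in> space M \<Longrightarrow> (\<lambda>s. f s w) \<in> borel_measurable unit_time"
  using measurable_compose[OF measurable_Pair2' f_measurable, of w] by simp

lemma f_time_measurable: "s \<in> {0..1} \<Longrightarrow> f s \<in> borel_measurable (completion M)"
  using measurable_compose[OF measurable_Pair1' f_measurable, of s] by simp

lemma f_path_square_integrable: "w \<in> space M \<Longrightarrow> integrable unit_time (\<lambda>s. (norm (f s w))\<^sup>2)"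
  using drift_L2a by (subst integrable_restrict_space) (auto simp: L2a_def L0a_def set_integrable_def)

lemma energy_unit_time: "energy (\<lambda>s. f s w) = (\<integral>s. (norm (f s w))\<^sup>2 \<partial>unit_time)"
  unfolding energy_def set_lebesgue_integral_def by (subst integral_restrict_space) auto

lemma f_square_integrable: "integrable (unit_time \<Otimes>\<^sub>M completion M) (\<lambda>(s, w). (norm (f s w))\<^sup>2)"
proof -
  have m: "(\<lambda>(w, s). (norm (f s w))\<^sup>2) \<in> borel_measurable (completion M \<Otimes>\<^sub>M unit_time)"
    using f_measurable_swap by (simp add: case_prod_beta')
  have "integrable (completion M \<Otimes>\<^sub>M unit_time) (\<lambda>(w, s). (norm (f s w))\<^sup>2)"
  proof (rule CT.Fubini_integrable[OF m])
    show "integrable (completion M) (\<lambda>w. \<integral>s. norm (case (w, s) of (w, s) \<Rightarrow> (norm (f s w))\<^sup>2) \<partial>unit_time)"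
      using drift_L2a unfolding L2a_def by (simp add: energy_unit_time)
    show "AE w in completion M. integrable unit_time (\<lambda>s. case (w, s) of (w, s) \<Rightarrow> (norm (f s w))\<^sup>2)"
      using f_path_square_integrable by (intro AE_I2) simp
  qed
  from CT.integrable_product_swap[OF this] show ?thesis by (simp add: case_prod_beta')
qed

lemma norm_le_norm_square: "norm (x :: real ^ 'd) \<le> 1 + (norm x)\<^sup>2"
proof -
  have "0 \<le> (2 * norm x - 1)\<^sup>2" by simp
  then show ?thesis by (simp add: power2_diff power_mult_distrib)
qed

lemma f_integrable: "integrable (unit_time \<Otimes>\<^sub>M completion M) (\<lambda>(s, w). f s w)"
proof (rule Bochner_Integration.integrable_bound)
  show "integrable (unit_time \<Otimes>\<^sub>M completion M) (\<lambda>x. 1 + (norm (f (fst x) (snd x)))\<^sup>2)"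
    using f_square_integrable by (intro Bochner_Integration.integrable_add) (auto simp: case_prod_beta')
  show "(\<lambda>(s, w). f s w) \<in> borel_measurable (unit_time \<Otimes>\<^sub>M completion M)" by (rule f_measurable)
qed (use norm_le_norm_square in \<open>auto simp: case_prod_beta'\<close>)

lemma f_path_integrable:
  assumes "w \<in> space M" shows "integrable unit_time (\<lambda>s. f s w)"
proof (rule Bochner_Integration.integrable_bound)
  show "integrable unit_time (\<lambda>s. 1 + (norm (f s w))\<^sup>2)"
    using f_path_square_integrable[OF assms] by auto
  show "(\<lambda>s. f s w) \<in> borel_measurable unit_time" by (rule f_path_measurable[OF assms])
qed (use norm_le_norm_square in auto)

lemma drift_diff_nth:
  assumes "w \<in> space M" "0 \<le> u" "u \<le> t" "t \<le> 1"
  shows "(drift t w - drift u w) $ i = (\<integral>s. indicator {u<..t} s * f s w $ i \<partial>unit_time)"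
  by (rule primitive_diff_nth[OF f_path_integrable]) fact+

lemma drift_measurable: "t \<le> 1 \<Longrightarrow> drift t \<in> borel_measurable (completion M)"
proof -
  assume t: "t \<le> 1"
  have "(\<lambda>(w, s). indicator {0..t} s *\<^sub>R f s w) \<in> borel_measurable (completion M \<Otimes>\<^sub>M unit_time)"
  proof -
    have "(\<lambda>x. indicator {0..t} (snd x)) \<in> borel_measurable (completion M \<Otimes>\<^sub>M unit_time)"
      by (rule measurable_compose[OF measurable_snd indicator_measurable_unit_time]) simp
    then show ?thesis using f_measurable_swap unfolding case_prod_beta' by (intro borel_measurable_scaleR)
  qed
  then have "(\<lambda>w. \<integral>s. indicator {0..t} s *\<^sub>R f s w \<partial>unit_time) \<in> borel_measurable (completion M)"
    by (rule T.borel_measurable_lebesgue_integral)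
  then show ?thesis using t by (simp add: primitive_unit_time)
qed

lemma drift_diff_measurable: "0 \<le> u \<Longrightarrow> u \<le> t \<Longrightarrow> t \<le> 1 \<Longrightarrow> (\<lambda>w. (drift t w - drift u w) $ i) \<in> borel_measurable (completion M)"
  using drift_measurable[of u] drift_measurable[of t] borel_measurable_vec_iff[THEN iffD1, rule_format, OF borel_measurable_diff]
  by auto

lemma weighted_drift_Fubini:
  assumes Y: "Y \<in> borel_measurable (completion M)" "\<And>w. w \<in> space M \<Longrightarrow> \<bar>Y w\<bar> \<le> (1::real)"
    and ut: "0 \<le> u" "u \<le> t" "t \<le> 1"
  shows "integrable unit_time (\<lambda>s. \<integral>w. Y w * f s w $ i \<partial>completion M)"
    and "AE s in unit_time. integrable (completion M) (\<lambda>w. Y w * f s w $ i)"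
    and "integrable (completion M) (\<lambda>w. Y w * (drift t w - drift u w) $ i)"
    and "(\<integral>w. Y w * (drift t w - drift u w) $ i \<partial>completion M)
       = (\<integral>s. indicator {u<..t} s * (\<integral>w. Y w * f s w $ i \<partial>completion M) \<partial>unit_time)"
proof -
  let ?P = "unit_time \<Otimes>\<^sub>M completion M"
  have Y': "(\<lambda>x. Y (snd x)) \<in> borel_measurable ?P" by (rule measurable_compose[OF measurable_snd Y(1)])
  have fi: "(\<lambda>x. f (fst x) (snd x) $ i) \<in> borel_measurable ?P"
    using f_measurable unfolding case_prod_beta' borel_measurable_vec_iff by auto
  have ind: "(\<lambda>x. indicator {u<..t} (fst x) :: real) \<in> borel_measurable ?P"
    by (rule measurable_compose[OF measurable_fst indicator_measurable_unit_time]) simp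
  have int: "integrable ?P (\<lambda>(s, w). Y w * f s w $ i)"
  proof (rule Bochner_Integration.integrable_bound[OF f_integrable])
    show "(\<lambda>(s, w). Y w * f s w $ i) \<in> borel_measurable ?P"
      unfolding case_prod_beta' using Y' fi by (intro borel_measurable_times)
    show "AE x in ?P. norm (case x of (s, w) \<Rightarrow> Y w * f s w $ i) \<le> norm (case x of (s, w) \<Rightarrow> f s w)"
    proof (rule AE_I2)
      fix x assume x: "x \<in> space ?P"
      then have "\<bar>Y (snd x)\<bar> * \<bar>f (fst x) (snd x) $ i\<bar> \<le> 1 * norm (f (fst x) (snd x))"
        using Y(2) by (intro mult_mono component_le_norm_cart) (auto simp: space_pair_measure)
      then show "norm (case x of (s, w) \<Rightarrow> Y w * f s w $ i) \<le> norm (case x of (s, w) \<Rightarrow> f s w)"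
        by (simp add: case_prod_beta' abs_mult)
    qed
  qed
  have int2: "integrable ?P (\<lambda>(s, w). indicator {u<..t} s * (Y w * f s w $ i))"
  proof (rule Bochner_Integration.integrable_bound[OF int])
    show "(\<lambda>(s, w). indicator {u<..t} s * (Y w * f s w $ i)) \<in> borel_measurable ?P"
      unfolding case_prod_beta' using Y' fi ind by (intro borel_measurable_times)
  qed (auto simp: indicator_def)
  show "integrable unit_time (\<lambda>s. \<integral>w. Y w * f s w $ i \<partial>completion M)"
    using TC.integrable_fst[OF int] .
  show "AE s in unit_time. integrable (completion M) (\<lambda>w. Y w * f s w $ i)"
    using TC.AE_integrable_fst[OF int] .
  have eq: "(\<integral>s. indicator {u<..t} s * (Y w * f s w $ i) \<partial>unit_time) = Y w * (drift t w - drift u w) $ i"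
    if "w \<in> space M" for w
    unfolding drift_diff_nth[OF that ut] by (subst integral_mult_right_zero[symmetric]) (simp add: mult.left_commute)
  show "integrable (completion M) (\<lambda>w. Y w * (drift t w - drift u w) $ i)"
    using TC.integrable_snd[OF int2] by (rule Bochner_Integration.integrable_cong[THEN iffD1, rotated 2]) (auto simp: eq)
  have "(\<integral>w. Y w * (drift t w - drift u w) $ i \<partial>completion M)
      = (\<integral>w. (\<integral>s. indicator {u<..t} s * (Y w * f s w $ i) \<partial>unit_time) \<partial>completion M)"
    by (rule Bochner_Integration.integral_cong) (auto simp: eq)
  also have "\<dots> = (\<integral>s. (\<integral>w. indicator {u<..t} s * (Y w * f s w $ i) \<partial>completion M) \<partial>unit_time)"
    unfolding TC.integral_snd[OF int2] TC.integral_fst[OF int2] ..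
  also have "\<dots> = (\<integral>s. indicator {u<..t} s * (\<integral>w. Y w * f s w $ i \<partial>completion M) \<partial>unit_time)"
    by simp
  finally show "(\<integral>w. Y w * (drift t w - drift u w) $ i \<partial>completion M)
       = (\<integral>s. indicator {u<..t} s * (\<integral>w. Y w * f s w $ i \<partial>completion M) \<partial>unit_time)" .
qed

definition mean_energy :: "real \<Rightarrow> real \<Rightarrow> real" where
  "mean_energy u t = (\<integral>s. indicator {u<..t} s * (\<integral>w. (norm (f s w))\<^sup>2 \<partial>completion M) \<partial>unit_time)"

lemma mean_energy_integrable: "integrable unit_time (\<lambda>s. indicator {u<..t} s * (\<integral>w. (norm (f s w))\<^sup>2 \<partial>completion M))"
  using integrable_indicator_unit_time[OF TC.integrable_fst[OF f_square_integrable], of "{u<..t}"] by simp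

lemma mean_energy_add:
  assumes "u \<le> v" "v \<le> t" shows "mean_energy u v + mean_energy v t = mean_energy u t"
  unfolding mean_energy_def Bochner_Integration.integral_add[OF mean_energy_integrable mean_energy_integrable, symmetric]
  using assms by (intro Bochner_Integration.integral_cong refl) (auto simp: indicator_def)

text \<open>
  The factor \<open>t - u\<close> is what makes the quadratic error of a short step negligible: summed over a
  partition of mesh \<open>h\<close> the squares contribute at most \<open>h\<close> times the total mean energy.
\<close>

lemma drift_diff_power2:
  assumes ut: "0 \<le> u" "u < t" "t \<le> 1"
  shows "integrable (completion M) (\<lambda>w. ((drift t w - drift u w) $ i)\<^sup>2)"
    and "(\<integral>w. ((drift t w - drift u w) $ i)\<^sup>2 \<partial>completion M) \<le> (t - u) * mean_energy u t"
proof -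
  let ?P = "unit_time \<Otimes>\<^sub>M completion M"
  have ut': "u \<le> t" using ut by simp
  have ind: "(\<lambda>x. indicator {u<..t} (fst x) :: real) \<in> borel_measurable ?P"
    by (rule measurable_compose[OF measurable_fst indicator_measurable_unit_time]) simp
  have int2: "integrable ?P (\<lambda>(s, w). indicator {u<..t} s * (norm (f s w))\<^sup>2)"
  proof (rule Bochner_Integration.integrable_bound[OF f_square_integrable])
    show "(\<lambda>(s, w). indicator {u<..t} s * (norm (f s w))\<^sup>2) \<in> borel_measurable ?P"
      unfolding case_prod_beta' using ind f_measurable by (intro borel_measurable_times borel_measurable_power borel_measurable_norm) (simp_all add: case_prod_beta')
  qed (auto simp: indicator_def)
  let ?K = "\<lambda>w. (t - u) * (\<integral>s. indicator {u<..t} s * (norm (f s w))\<^sup>2 \<partial>unit_time)"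
  have bd: "((drift t w - drift u w) $ i)\<^sup>2 \<le> ?K w" if w: "w \<in> space M" for w
  proof -
    have fi: "integrable unit_time (\<lambda>s. f s w $ i)"
      using integrable_bounded_linear[OF bounded_linear_vec_nth f_path_integrable[OF w]] .
    have le: "(f s w $ i)\<^sup>2 \<le> (norm (f s w))\<^sup>2" for s
      using component_le_norm_cart[of "f s w" i] by (metis abs_ge_zero power2_abs power_mono)
    have fi2: "integrable unit_time (\<lambda>s. (f s w $ i)\<^sup>2)"
      by (rule Bochner_Integration.integrable_bound[OF f_path_square_integrable[OF w]])
        (use fi le in \<open>auto intro!: borel_measurable_power\<close>)
    have "((drift t w - drift u w) $ i)\<^sup>2 \<le> (t - u) * (\<integral>s. indicator {u<..t} s * (f s w $ i)\<^sup>2 \<partial>unit_time)"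
      unfolding drift_diff_nth[OF w ut(1) ut' ut(3)] by (rule integral_interval_power2_le[OF fi fi2 ut])
    also have "\<dots> \<le> ?K w"
      using ut integrable_indicator_unit_time[OF fi2, of "{u<..t}"] integrable_indicator_unit_time[OF f_path_square_integrable[OF w], of "{u<..t}"] le
      by (intro mult_left_mono Bochner_Integration.integral_mono) (auto intro: mult_left_mono)
    finally show ?thesis .
  qed
  have K: "integrable (completion M) ?K" using TC.integrable_snd[OF int2] by auto
  have m: "(\<lambda>w. ((drift t w - drift u w) $ i)\<^sup>2) \<in> borel_measurable (completion M)"
    by (intro borel_measurable_power drift_diff_measurable ut ut')
  show int: "integrable (completion M) (\<lambda>w. ((drift t w - drift u w) $ i)\<^sup>2)"
    by (rule Bochner_Integration.integrable_bound[OF K m], rule AE_I2)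
       (use bd in \<open>auto intro: order_trans[OF _ abs_ge_self]\<close>)
  have "(\<integral>w. ((drift t w - drift u w) $ i)\<^sup>2 \<partial>completion M) \<le> (\<integral>w. ?K w \<partial>completion M)"
    using bd by (intro Bochner_Integration.integral_mono[OF int K]) auto
  also have "\<dots> = (t - u) * (\<integral>w. (\<integral>s. indicator {u<..t} s * (norm (f s w))\<^sup>2 \<partial>unit_time) \<partial>completion M)" by simp
  also have "(\<integral>w. (\<integral>s. indicator {u<..t} s * (norm (f s w))\<^sup>2 \<partial>unit_time) \<partial>completion M)
     = (\<integral>s. (\<integral>w. indicator {u<..t} s * (norm (f s w))\<^sup>2 \<partial>completion M) \<partial>unit_time)"
    unfolding TC.integral_snd[OF int2] TC.integral_fst[OF int2] ..
  also have "\<dots> = mean_energy u t" unfolding mean_energy_def by simp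
  finally show "(\<integral>w. ((drift t w - drift u w) $ i)\<^sup>2 \<partial>completion M) \<le> (t - u) * mean_energy u t" .
qed

lemma perturbed_eq: "t \<in> {0..1} \<Longrightarrow> perturbed f w t = w t + drift t w"
  by (simp add: perturbed_def)

lemma perturbed_in_space: "w \<in> space M \<Longrightarrow> perturbed f w \<in> space M"
  unfolding space_eq
proof safe
  assume w: "w \<in> extensional {0..1}" "continuous_on {0..1} w"
  then have "w \<in> space M" by (simp add: space_eq)
  then have "continuous_on {0..1} (\<lambda>t. w t + drift t w)"
    using w by (intro continuous_on_add primitive_continuous f_path_integrable)
  then show "continuous_on {0..1} (perturbed f w)"
    by (rule continuous_on_cong[THEN iffD1, rotated 2]) (auto simp: perturbed_eq)
qed (simp add: perturbed_def)

lemma perturbed_coordinate_measurable: "t \<in> {0..1} \<Longrightarrow> (\<lambda>w. perturbed f w t) \<in> borel_measurable (completion M)"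
  using measurable_completion[OF coordinate_measurable, of t] drift_measurable[of t]
  by (simp add: perturbed_eq)

lemma perturbed_measurable: "perturbed f \<in> completion M \<rightarrow>\<^sub>M M"
  unfolding measurable_cong_sets[OF refl sets_eq] path_algebra_def
proof (rule measurable_restrict_space2)
  show "perturbed f \<in> space (completion M) \<rightarrow> {w. continuous_on {0..1} w}"
    using perturbed_in_space by (auto simp: space_eq)
  have "(\<lambda>w. \<lambda>t\<in>{0..1}. perturbed f w t) \<in> completion M \<rightarrow>\<^sub>M (\<Pi>\<^sub>M t\<in>{0..1}. borel)"
    by (rule measurable_restrict) (rule perturbed_coordinate_measurable)
  also have "(\<lambda>w. \<lambda>t\<in>{0..1}. perturbed f w t) = perturbed f"
    by (auto simp: perturbed_def fun_eq_iff)
  finally show "perturbed f \<in> completion M \<rightarrow>\<^sub>M (\<Pi>\<^sub>M t\<in>{0..1}. borel)" .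
qed

end

section \<open>The drift is adapted\<close>

lemma (in wiener) AE_eq_measurable_wiener_filtration:
  fixes X E :: "'d path \<Rightarrow> 'b :: topological_space"
  assumes E: "E \<in> borel_measurable (wiener_filtration M t)"
    and ae: "AE w in completion M. X w = E w"
  shows "X \<in> borel_measurable (wiener_filtration M t)"
proof (rule measurableI)
  obtain Z where Z: "{w \<in> space M. X w \<noteq> E w} \<subseteq> Z" "Z \<in> null_sets (completion M)"
    using ae by (auto simp: eventually_ae_filter)
  have null: "Z' \<in> sets (wiener_filtration M t)" if "Z' \<in> null_sets (completion M)" for Z'
    unfolding sets_wiener_filtration using that by (intro sigma_sets.Basic) auto
  fix B :: "'b set" assume B: "B \<in> sets borel"
  let ?W = "space (wiener_filtration M t)"
  have eq: "X -` B \<inter> ?W = (E -` B \<inter> ?W - Z) \<union> (X -` B \<inter> space M \<inter> Z)"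
    using Z(1) by auto
  have "X -` B \<inter> space M \<inter> Z \<in> null_sets (completion M)"
    by (rule null_sets_completion_subset[OF _ Z(2)]) auto
  then show "X -` B \<inter> ?W \<in> sets (wiener_filtration M t)"
    unfolding eq by (intro sets.Un sets.Diff measurable_sets[OF E B] null Z)
qed auto

context drifted_wiener
begin

text \<open>
  The density is adapted and jointly measurable, but not assumed progressively measurable, so that
  \<open>drift t\<close> is not visibly a function of the past. Instead it is shown to agree almost surely with its
  conditional expectation \<open>E\<close>: for every event \<open>A\<close>, Fubini and the adaptedness of each \<open>f s\<close> allow \<open>A\<close> to be
  replaced by its conditional probability in the integral of the drift over \<open>A\<close>. Since the filtration
  contains all null sets, the agreement suffices.
\<close>

lemma drift_adapted:
  assumes t: "t \<in> {0..1}" shows "drift t \<in> borel_measurable (wiener_filtration M t)"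
  unfolding borel_measurable_vec_iff
proof
  fix i
  let ?N = "completion M" and ?F = "wiener_filtration M t"
  interpret F: finite_measure_subalgebra ?N ?F
    by standard (use wiener_filtration_sub[of t] t in \<open>auto simp: subalgebra_def\<close>)
  define \<xi> where "\<xi> = (\<lambda>w. (drift t w - drift 0 w) $ i)"
  have t': "0 \<le> (0::real)" "0 \<le> t" "t \<le> 1" using t by auto
  have \<xi>: "integrable ?N \<xi>" using weighted_drift_Fubini(3)[of "\<lambda>_. 1", OF _ _ t'] by (simp add: \<xi>_def)
  define E where "E = real_cond_exp ?N ?F \<xi>"
  have E: "integrable ?N E" "E \<in> borel_measurable ?F"
    unfolding E_def using F.real_cond_exp_int(1)[OF \<xi>] by auto
  have "AE w in ?N. \<xi> w = E w"
  proof (rule C.density_unique_banach[OF \<xi> E(1)])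
    fix A assume A: "A \<in> sets ?N"
    let ?J = "indicator A :: _ \<Rightarrow> real"
    have i1: "integrable ?N ?J" using A by (simp add: C.emeasure_eq_measure)
    define c where "c = real_cond_exp ?N ?F ?J"
    have c: "c \<in> borel_measurable ?F" unfolding c_def by auto
    \<comment> \<open>A version of the conditional probability that is bounded everywhere and not only almost surely.\<close>
    define Y where "Y = (\<lambda>w. max 0 (min 1 (c w)))"
    have Y: "Y \<in> borel_measurable ?F" unfolding Y_def using c by (intro borel_measurable_max borel_measurable_min) auto
    have Yb: "\<bar>Y w\<bar> \<le> 1" for w unfolding Y_def by auto
    have YN: "Y \<in> borel_measurable ?N" by (rule measurable_from_subalg[OF F.subalg Y])
    have "AE w in ?N. 0 \<le> c w" "AE w in ?N. c w \<le> 1"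
      unfolding c_def using i1 by (auto intro!: F.real_cond_exp_ge_c F.real_cond_exp_le_c)
    then have cY: "AE w in ?N. c w = Y w" by eventually_elim (auto simp: Y_def)
    have cN: "c \<in> borel_measurable ?N" by (rule measurable_from_subalg[OF F.subalg c])
    have EN: "E \<in> borel_measurable ?N" using E by auto
    have "(\<integral>w. E w * ?J w \<partial>?N) = (\<integral>w. E w * c w \<partial>?N)"
      unfolding c_def using A E by (intro F.real_cond_exp_intg(2)[symmetric] integrable_real_mult_indicator) auto
    also have "\<dots> = (\<integral>w. Y w * E w \<partial>?N)"
      using cY cN YN EN by (intro integral_cong_AE) auto
    also have "\<dots> = (\<integral>w. Y w * \<xi> w \<partial>?N)"
      unfolding E_def using Y YN Yb \<xi> weighted_drift_Fubini(3)[OF YN _ t', of i]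
      by (intro F.real_cond_exp_intg(2)) (auto simp: \<xi>_def)
    also have "\<dots> = (\<integral>s. indicator {0<..t} s * (\<integral>w. Y w * f s w $ i \<partial>?N) \<partial>unit_time)"
      unfolding \<xi>_def using YN Yb t' by (intro weighted_drift_Fubini(4))
    also have "\<dots> = (\<integral>s. indicator {0<..t} s * (\<integral>w. ?J w * f s w $ i \<partial>?N) \<partial>unit_time)"
    proof (rule integral_cong_AE)
      have 1: "?J \<in> borel_measurable ?N" "\<And>w. \<bar>?J w\<bar> \<le> 1" using A by auto
      show "(\<lambda>s. indicator {0<..t} s * (\<integral>w. Y w * f s w $ i \<partial>?N)) \<in> borel_measurable unit_time"
        using weighted_drift_Fubini(1)[OF YN _ t', of i] Yb by (intro borel_measurable_times) auto
      show "(\<lambda>s. indicator {0<..t} s * (\<integral>w. ?J w * f s w $ i \<partial>?N)) \<in> borel_measurable unit_time"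
        using weighted_drift_Fubini(1)[OF 1 t', of i] by (intro borel_measurable_times) auto
      show "AE s in unit_time. indicator {0<..t} s * (\<integral>w. Y w * f s w $ i \<partial>?N) = indicator {0<..t} s * (\<integral>w. ?J w * f s w $ i \<partial>?N)"
        using weighted_drift_Fubini(2)[OF 1 t', of i]
      proof eventually_elim
        case (elim s)
        show ?case
        proof (cases "s \<in> {0<..t}")
          case True
          then have s: "s \<in> {0..1}" "s \<le> t" using t by auto
          have "f s \<in> borel_measurable ?F"
            using f_adapted[OF s(1)] wiener_filtration_mono[OF s(2)] by (auto simp: measurable_def)
          then have fF: "(\<lambda>w. f s w $ i) \<in> borel_measurable ?F" by (simp add: borel_measurable_vec_iff)
          have fN: "(\<lambda>w. f s w $ i) \<in> borel_measurable ?N" by (rule measurable_from_subalg[OF F.subalg fF])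
          have "(\<integral>w. f s w $ i * c w \<partial>?N) = (\<integral>w. f s w $ i * ?J w \<partial>?N)"
            unfolding c_def using elim fF 1 by (intro F.real_cond_exp_intg(2)) (auto simp: mult.commute)
          moreover have "(\<integral>w. f s w $ i * c w \<partial>?N) = (\<integral>w. Y w * f s w $ i \<partial>?N)"
            using cY cN YN fN by (intro integral_cong_AE) auto
          ultimately show ?thesis by (simp add: mult.commute)
        qed simp
      qed
    qed
    also have "\<dots> = (\<integral>w. ?J w * \<xi> w \<partial>?N)"
      unfolding \<xi>_def using A t' by (intro weighted_drift_Fubini(4)[symmetric]) auto
    finally show "set_lebesgue_integral ?N A \<xi> = set_lebesgue_integral ?N A E"
      unfolding set_lebesgue_integral_def by (simp add: mult.commute)
  qed
  then have "\<xi> \<in> borel_measurable ?F" by (rule AE_eq_measurable_wiener_filtration[OF E(2)])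
  then show "(\<lambda>w. drift t w $ i) \<in> borel_measurable ?F" by (simp add: \<xi>_def primitive_0)
qed

abbreviation observed :: "real \<Rightarrow> 'd path measure" where "observed \<equiv> perturbed_filtration M f"

lemma space_observed [simp]: "space (observed t) = space M"
  by (simp add: perturbed_filtration_def)

lemma observed_mono: "s \<le> t \<Longrightarrow> sets (observed s) \<subseteq> sets (observed t)"
  unfolding perturbed_filtration_def by (intro natural_filtration_least measurable_natural_filtration) auto

lemma observed_measurable_mono: "s \<le> t \<Longrightarrow> Y \<in> borel_measurable (observed s) \<Longrightarrow> Y \<in> borel_measurable (observed t)"
  using observed_mono[of s t] by (auto simp: measurable_def)

lemma perturbed_observed: "0 \<le> s \<Longrightarrow> s \<le> t \<Longrightarrow> (\<lambda>w. perturbed f w s) \<in> borel_measurable (observed t)"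
  unfolding perturbed_filtration_def by (rule measurable_natural_filtration)

lemma observed_sub_wiener_filtration:
  assumes "t \<le> 1" shows "sets (observed t) \<subseteq> sets (wiener_filtration M t)"
  unfolding perturbed_filtration_def
proof (rule natural_filtration_least)
  fix s assume s: "0 \<le> s" "s \<le> t"
  have "(\<lambda>w. w s) \<in> borel_measurable (natural_filtration (space M) (\<lambda>s w. w s) s)"
    using s by (intro measurable_natural_filtration) auto
  then have "(\<lambda>w. w s) \<in> borel_measurable (wiener_filtration M s)"
    by (auto simp: measurable_def sets_wiener_filtration)
  then have "(\<lambda>w. w s + drift s w) \<in> borel_measurable (wiener_filtration M s)"
    using s assms by (intro borel_measurable_add drift_adapted) auto
  then have "(\<lambda>w. perturbed f w s) \<in> borel_measurable (wiener_filtration M s)"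
    using s assms by (simp add: perturbed_eq)
  then show "(\<lambda>w. perturbed f w s) \<in> borel_measurable (wiener_filtration M t)"
    using wiener_filtration_mono[OF s(2)] by (auto simp: measurable_def)
qed simp

lemma observed_measurable_wiener_filtration:
  "t \<le> 1 \<Longrightarrow> Y \<in> borel_measurable (observed t) \<Longrightarrow> Y \<in> borel_measurable (wiener_filtration M t)"
  using observed_sub_wiener_filtration[of t] by (auto simp: measurable_def)

lemma observed_subalgebra: "t \<le> 1 \<Longrightarrow> subalgebra (completion M) (observed t)"
  using observed_sub_wiener_filtration[of t] wiener_filtration_sub[of t] by (auto simp: subalgebra_def)

lemma observed_measurable_completion:
  "t \<le> 1 \<Longrightarrow> Y \<in> borel_measurable (observed t) \<Longrightarrow> Y \<in> borel_measurable (completion M)"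
  by (rule measurable_from_subalg[OF observed_subalgebra])

end

section \<open>An unobserved drift leaves increments Gaussian\<close>

text \<open>
  The product \<open>D R\<close> of a Brownian and a drift increment is split by the weighted mean inequality: the
  Brownian increment has variance of the order of the step, hence only a small multiple of its square
  is affordable.
\<close>

lemma iexp_second_order:
  fixes D R \<epsilon> :: real
  assumes "0 < \<epsilon>"
  shows "cmod (iexp (D + R) - iexp D - \<i> * complex_of_real R) \<le> \<epsilon> * D\<^sup>2 + (1 + 1 / \<epsilon>) * R\<^sup>2"
proof -
  have 1: "cmod (iexp R - (1 + \<i> * complex_of_real R)) \<le> R\<^sup>2 / 2"
    using iexp_approx1[of R 1] by (simp add: numeral_2_eq_2)
  have 0: "cmod (iexp D - 1) \<le> \<bar>D\<bar>" using iexp_approx1[of D 0] by simp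
  have "iexp (D + R) - iexp D - \<i> * complex_of_real R
      = iexp D * (iexp R - (1 + \<i> * complex_of_real R)) + (iexp D - 1) * (\<i> * complex_of_real R)"
    by (simp add: distrib_left exp_add algebra_simps)
  then have "cmod (iexp (D + R) - iexp D - \<i> * complex_of_real R)
      \<le> cmod (iexp D * (iexp R - (1 + \<i> * complex_of_real R))) + cmod ((iexp D - 1) * (\<i> * complex_of_real R))"
    by (simp only: norm_triangle_ineq)
  also have "\<dots> \<le> R\<^sup>2 / 2 + \<bar>D\<bar> * \<bar>R\<bar>"
    using 1 0 by (intro add_mono) (auto simp: norm_mult intro!: mult_right_mono)
  also have "\<bar>D\<bar> * \<bar>R\<bar> \<le> \<epsilon> * D\<^sup>2 + R\<^sup>2 / \<epsilon>"
  proof -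
    have "0 \<le> (\<epsilon> * \<bar>D\<bar> - \<bar>R\<bar>)\<^sup>2 / \<epsilon> + \<bar>D\<bar> * \<bar>R\<bar>" using assms by simp
    also have "\<dots> = \<epsilon> * D\<^sup>2 + R\<^sup>2 / \<epsilon> - \<bar>D\<bar> * \<bar>R\<bar>"
      using assms by (simp add: power2_eq_square field_simps)
    finally show ?thesis by simp
  qed
  also have "R\<^sup>2 / 2 + (\<epsilon> * D\<^sup>2 + R\<^sup>2 / \<epsilon>) \<le> \<epsilon> * D\<^sup>2 + (1 + 1 / \<epsilon>) * R\<^sup>2"
    by (simp add: distrib_right)
  finally show ?thesis by simp
qed

lemma inner_power2_le_sum:
  fixes l x :: "real ^ ('d::finite)"
  shows "(l \<bullet> x)\<^sup>2 \<le> (norm l)\<^sup>2 * (\<Sum>i\<in>UNIV. (x $ i)\<^sup>2)"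
proof -
  have "(l \<bullet> x)\<^sup>2 \<le> (norm l * norm x)\<^sup>2"
    using Cauchy_Schwarz_ineq2[of l x] by (metis abs_ge_zero power2_abs power_mono)
  then show ?thesis
    by (simp add: power_mult_distrib power2_norm_eq_inner[of x] inner_vec_def power2_eq_square[of "x $ _"])
qed

lemma (in prob_space) char_expansion_bound:
  fixes Y :: "'a \<Rightarrow> complex" and D R :: "'a \<Rightarrow> real"
  assumes Y: "Y \<in> borel_measurable M" "\<And>w. w \<in> space M \<Longrightarrow> norm (Y w) \<le> 1"
    and D: "D \<in> borel_measurable M" "integrable M (\<lambda>w. (D w)\<^sup>2)"
    and R: "R \<in> borel_measurable M" "integrable M (\<lambda>w. (R w)\<^sup>2)" "integrable M R"
    and orth: "(CLINT w|M. Y w * complex_of_real (R w)) = 0" and \<epsilon>: "0 < \<epsilon>"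
  shows "cmod ((CLINT w|M. Y w * iexp (D w + R w)) - (CLINT w|M. Y w * iexp (D w)))
    \<le> \<epsilon> * expectation (\<lambda>w. (D w)\<^sup>2) + (1 + 1 / \<epsilon>) * expectation (\<lambda>w. (R w)\<^sup>2)"
proof -
  have bd: "integrable M (\<lambda>w. Y w * iexp (h w))" if "h \<in> borel_measurable M" for h :: "'a \<Rightarrow> real"
    using that Y by (intro integrable_const_bound[where B=1]) (auto simp: norm_mult)
  have iR: "integrable M (\<lambda>w. Y w * complex_of_real (R w))"
    by (rule Bochner_Integration.integrable_bound[OF R(3)])
      (use Y R(1) in \<open>auto simp: norm_mult intro!: AE_I2 mult_left_le_one_le\<close>)
  have "(CLINT w|M. Y w * iexp (D w + R w)) - (CLINT w|M. Y w * iexp (D w))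
      = (CLINT w|M. Y w * iexp (D w + R w)) - (CLINT w|M. Y w * iexp (D w)) - (CLINT w|M. \<i> * (Y w * complex_of_real (R w)))"
    using orth by simp
  also have "\<dots> = (CLINT w|M. Y w * iexp (D w + R w) - Y w * iexp (D w) - \<i> * (Y w * complex_of_real (R w)))"
    using bd[of "\<lambda>w. D w + R w"] bd[of D] iR D R by (subst Bochner_Integration.integral_diff Bochner_Integration.integrable_diff; auto)+
  also have "cmod \<dots> \<le> (\<integral>w. \<epsilon> * (D w)\<^sup>2 + (1 + 1 / \<epsilon>) * (R w)\<^sup>2 \<partial>M)"
  proof (rule order_trans[OF integral_norm_bound Bochner_Integration.integral_mono])
    show "integrable M (\<lambda>w. cmod (Y w * iexp (D w + R w) - Y w * iexp (D w) - \<i> * (Y w * complex_of_real (R w))))"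
      using bd[of "\<lambda>w. D w + R w"] bd[of D] iR D R by auto
    show "integrable M (\<lambda>w. \<epsilon> * (D w)\<^sup>2 + (1 + 1 / \<epsilon>) * (R w)\<^sup>2)" using D R by auto
    fix w assume w: "w \<in> space M"
    have "Y w * iexp (D w + R w) - Y w * iexp (D w) - \<i> * (Y w * complex_of_real (R w))
       = Y w * (iexp (D w + R w) - iexp (D w) - \<i> * complex_of_real (R w))" by (simp add: algebra_simps)
    also have "cmod \<dots> \<le> 1 * cmod (iexp (D w + R w) - iexp (D w) - \<i> * complex_of_real (R w))"
      unfolding norm_mult using Y(2)[OF w] by (intro mult_right_mono) auto
    also have "\<dots> \<le> \<epsilon> * (D w)\<^sup>2 + (1 + 1 / \<epsilon>) * (R w)\<^sup>2" using iexp_second_order[OF \<epsilon>] by simp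
    finally show "cmod (Y w * iexp (D w + R w) - Y w * iexp (D w) - \<i> * (Y w * complex_of_real (R w)))
      \<le> \<epsilon> * (D w)\<^sup>2 + (1 + 1 / \<epsilon>) * (R w)\<^sup>2" .
  qed
  also have "\<dots> = \<epsilon> * expectation (\<lambda>w. (D w)\<^sup>2) + (1 + 1 / \<epsilon>) * expectation (\<lambda>w. (R w)\<^sup>2)"
    using D R by simp
  finally show ?thesis .
qed

lemma approximate_geometric_progression:
  fixes \<phi> :: "nat \<Rightarrow> complex" and q :: complex and e :: "nat \<Rightarrow> real"
  assumes "\<And>k. k < n \<Longrightarrow> cmod (\<phi> (Suc k) - \<phi> k * q) \<le> e k" and "cmod q \<le> 1"
  shows "cmod (\<phi> n - \<phi> 0 * q ^ n) \<le> (\<Sum>k<n. e k)"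
  using assms(1)
proof (induction n)
  case (Suc n)
  have "\<phi> (Suc n) - \<phi> 0 * q ^ Suc n = (\<phi> (Suc n) - \<phi> n * q) + (\<phi> n - \<phi> 0 * q ^ n) * q"
    by (simp add: algebra_simps)
  also have "cmod \<dots> \<le> cmod (\<phi> (Suc n) - \<phi> n * q) + cmod ((\<phi> n - \<phi> 0 * q ^ n) * q)"
    by (rule norm_triangle_ineq)
  also have "\<dots> \<le> e n + (\<Sum>k<n. e k) * 1"
    unfolding norm_mult using Suc assms(2) by (intro add_mono mult_mono) (auto intro: order_trans[OF norm_ge_zero])
  finally show ?case by simp
qed simp

locale unobserved_drift = drifted_wiener M f
  for M :: "('d::finite) path measure" and f :: "real \<Rightarrow> 'd path \<Rightarrow> real ^ 'd" +
  assumes cond_exp_zero: "AE s in unit_time. \<forall>i. AE w in completion M. real_cond_exp (completion M) (observed s) (\<lambda>w. f s w $ i) w = 0"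
begin

lemma drift_increment_orthogonal:
  assumes Y: "Y \<in> borel_measurable (observed u)" "\<And>w. w \<in> space M \<Longrightarrow> \<bar>Y w\<bar> \<le> (1::real)"
    and ut: "0 \<le> u" "u \<le> t" "t \<le> 1"
  shows "(\<integral>w. Y w * (drift t w - drift u w) $ i \<partial>completion M) = 0"
proof -
  have YN: "Y \<in> borel_measurable (completion M)" using Y(1) ut by (intro observed_measurable_completion[of u]) auto
  have F2: "AE s in unit_time. integrable (completion M) (\<lambda>w. Y w * f s w $ i)"
    by (rule weighted_drift_Fubini(2)[OF YN _ ut]) (rule Y(2))
  have F4: "(\<integral>w. Y w * (drift t w - drift u w) $ i \<partial>completion M)
       = (\<integral>s. indicator {u<..t} s * (\<integral>w. Y w * f s w $ i \<partial>completion M) \<partial>unit_time)"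
    by (rule weighted_drift_Fubini(4)[OF YN _ ut]) (rule Y(2))
  have "AE s in unit_time. indicator {u<..t} s * (\<integral>w. Y w * f s w $ i \<partial>completion M) = 0"
    using cond_exp_zero F2 AE_space
  proof eventually_elim
    case (elim s)
    show ?case
    proof (cases "s \<in> {u<..t}")
      case True
      then have s: "u \<le> s" "s \<in> {0..1}" using ut by auto
      interpret S: finite_measure_subalgebra "completion M" "observed s"
        by standard (use s in \<open>auto intro: observed_subalgebra\<close>)
      have fN: "(\<lambda>w. f s w $ i) \<in> borel_measurable (completion M)"
        using f_time_measurable[OF s(2)] by (simp add: borel_measurable_vec_iff)
      have "(\<integral>w. Y w * f s w $ i \<partial>completion M) = (\<integral>w. Y w * real_cond_exp (completion M) (observed s) (\<lambda>w. f s w $ i) w \<partial>completion M)"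
        using elim(2) fN observed_measurable_mono[OF s(1) Y(1)] by (intro S.real_cond_exp_intg(2)[symmetric]) auto
      also have "\<dots> = 0"
      proof (rule integral_eq_zero_AE)
        show "AE w in completion M. Y w * real_cond_exp (completion M) (observed s) (\<lambda>w. f s w $ i) w = 0"
          using elim(1)[rule_format, of i] by eventually_elim simp
      qed
      finally show ?thesis by simp
    qed simp
  qed
  then show ?thesis
    unfolding F4 by (intro integral_eq_zero_AE)
qed

text \<open>
  The Brownian increment contributes the exact Gaussian factor since it is independent of \<open>Y\<close>; the
  linear term in the drift is killed by orthogonality to the observed past.
\<close>

lemma char_one_step:
  assumes Y: "Y \<in> borel_measurable (observed u)" "\<And>w. w \<in> space M \<Longrightarrow> cmod (Y w) \<le> 1"
    and ut: "0 \<le> u" "u < t" "t \<le> 1" and \<epsilon>: "0 < \<epsilon>"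
  shows "cmod ((CLINT w|completion M. Y w * iexp (l \<bullet> (perturbed f w t - perturbed f w u)))
      - (CLINT w|completion M. Y w) * complex_of_real (exp (- ((norm l)\<^sup>2 * (t - u)) / 2)))
    \<le> (norm l)\<^sup>2 * CARD('d) * (\<epsilon> * (t - u) + (1 + 1 / \<epsilon>) * ((t - u) * mean_energy u t))"
proof -
  let ?N = "completion M"
  have ut': "u \<le> t" "u \<le> 1" "0 \<le> t" using ut by auto
  define D where "D = (\<lambda>w :: 'd path. l \<bullet> (w t - w u))"
  define R where "R = (\<lambda>w. l \<bullet> (drift t w - drift u w))"
  have YN: "Y \<in> borel_measurable ?N" using Y(1) ut by (intro observed_measurable_completion[of u]) auto
  have \<Delta>: "(\<lambda>w. w t - w u) \<in> borel_measurable ?N"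
    using ut by (intro measurable_completion borel_measurable_diff coordinate_measurable) auto
  have \<Delta>d: "(\<lambda>w. drift t w - drift u w) \<in> borel_measurable ?N"
    using ut by (intro borel_measurable_diff drift_measurable) auto
  have Dm: "D \<in> borel_measurable ?N" unfolding D_def using \<Delta> by measurable
  have Rm: "R \<in> borel_measurable ?N" unfolding R_def using \<Delta>d by measurable
  have square: "integrable ?N (\<lambda>w. (l \<bullet> X w)\<^sup>2) \<and> (\<integral>w. (l \<bullet> X w)\<^sup>2 \<partial>?N) \<le> (norm l)\<^sup>2 * (CARD('d) * K)"
    if X: "X \<in> borel_measurable ?N" and int: "\<And>i. integrable ?N (\<lambda>w. (X w $ i)\<^sup>2)"
      and K: "\<And>i. (\<integral>w. (X w $ i)\<^sup>2 \<partial>?N) \<le> K" for X :: "'d path \<Rightarrow> real ^ 'd" and K :: real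
  proof -
    have intS: "integrable ?N (\<lambda>w. (norm l)\<^sup>2 * (\<Sum>i\<in>UNIV. (X w $ i)\<^sup>2))" using int by auto
    have i: "integrable ?N (\<lambda>w. (l \<bullet> X w)\<^sup>2)"
      by (rule Bochner_Integration.integrable_bound[OF intS])
        (use X inner_power2_le_sum[of l] in \<open>auto intro: order_trans[OF _ abs_ge_self]\<close>)
    have "(\<integral>w. (l \<bullet> X w)\<^sup>2 \<partial>?N) \<le> (\<integral>w. (norm l)\<^sup>2 * (\<Sum>i\<in>UNIV. (X w $ i)\<^sup>2) \<partial>?N)"
      using i intS inner_power2_le_sum[of l] by (intro Bochner_Integration.integral_mono) auto
    also have "\<dots> = (norm l)\<^sup>2 * (\<Sum>i\<in>UNIV. \<integral>w. (X w $ i)\<^sup>2 \<partial>?N)" using int by simp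
    also have "(\<Sum>i\<in>UNIV. \<integral>w. (X w $ i)\<^sup>2 \<partial>?N) \<le> CARD('d) * K" using K by (intro sum_bounded_above) auto
    finally show ?thesis using i by (simp add: mult_left_mono)
  qed
  have D2: "integrable ?N (\<lambda>w. (D w)\<^sup>2)" "(\<integral>w. (D w)\<^sup>2 \<partial>?N) \<le> (norm l)\<^sup>2 * (CARD('d) * (t - u))"
    using square[OF \<Delta>, of "t - u"] increment_integrals(1,2)[OF ut] by (auto simp: D_def)
  have R2: "integrable ?N (\<lambda>w. (R w)\<^sup>2)" "(\<integral>w. (R w)\<^sup>2 \<partial>?N) \<le> (norm l)\<^sup>2 * (CARD('d) * ((t - u) * mean_energy u t))"
    using square[OF \<Delta>d, of "(t - u) * mean_energy u t"] drift_diff_power2[OF ut] by (auto simp: R_def)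
  have Ri: "integrable ?N (\<lambda>w. (drift t w - drift u w) $ i)" for i
    using weighted_drift_Fubini(3)[of "\<lambda>_. 1" u t i] ut ut' by simp
  have Req: "R w = (\<Sum>i\<in>UNIV. l $ i * (drift t w - drift u w) $ i)" for w
    by (simp add: R_def inner_vec_def)
  have R1: "integrable ?N R" unfolding Req[abs_def] using Ri by auto
  have real_orth: "(\<integral>w. Z w * R w \<partial>?N) = 0"
    if Z: "Z \<in> borel_measurable (observed u)" "\<And>w. w \<in> space M \<Longrightarrow> \<bar>Z w\<bar> \<le> 1" for Z
  proof -
    have ZN: "Z \<in> borel_measurable ?N" using Z(1) ut by (intro observed_measurable_completion[of u]) auto
    have "(\<integral>w. Z w * R w \<partial>?N) = (\<integral>w. (\<Sum>i\<in>UNIV. l $ i * (Z w * (drift t w - drift u w) $ i)) \<partial>?N)"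
      unfolding Req by (intro Bochner_Integration.integral_cong refl) (simp add: sum_distrib_left mult_ac)
    also have "\<dots> = (\<Sum>i\<in>UNIV. l $ i * (\<integral>w. Z w * (drift t w - drift u w) $ i \<partial>?N))"
    proof (subst Bochner_Integration.integral_sum)
      show "integrable ?N (\<lambda>w. l $ i * (Z w * (drift t w - drift u w) $ i))" for i
        by (intro integrable_mult_right weighted_drift_Fubini(3)[OF ZN _ ut(1) ut'(1) ut(3)]) (rule Z(2))
    qed simp
    also have "\<dots> = 0"
    proof -
      have "(\<integral>w. Z w * (drift t w - drift u w) $ i \<partial>?N) = 0" for i
        by (rule drift_increment_orthogonal[OF Z(1) _ ut(1) ut'(1) ut(3)]) (rule Z(2))
      then show ?thesis by simp
    qed
    finally show ?thesis .
  qed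
  have YR: "integrable ?N (\<lambda>w. Y w * complex_of_real (R w))"
    by (rule Bochner_Integration.integrable_bound[OF R1])
      (use Y(2) YN Rm in \<open>auto simp: norm_mult intro!: AE_I2 mult_left_le_one_le\<close>)
  have orth: "(CLINT w|?N. Y w * complex_of_real (R w)) = 0"
  proof (rule complex_eqI)
    have "Re (CLINT w|?N. Y w * complex_of_real (R w)) = (\<integral>w. Re (Y w) * R w \<partial>?N)"
      using YR by (simp add: integral_Re[symmetric])
    also have "\<dots> = 0" using Y(1) by (intro real_orth) (auto intro: order_trans[OF abs_Re_le_cmod Y(2)])
    finally show "Re (CLINT w|?N. Y w * complex_of_real (R w)) = Re 0" by simp
    have "Im (CLINT w|?N. Y w * complex_of_real (R w)) = (\<integral>w. Im (Y w) * R w \<partial>?N)"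
      using YR by (simp add: integral_Im[symmetric])
    also have "\<dots> = 0" using Y(1) by (intro real_orth) (auto intro: order_trans[OF abs_Im_le_cmod Y(2)])
    finally show "Im (CLINT w|?N. Y w * complex_of_real (R w)) = Im 0" by simp
  qed
  have eq: "l \<bullet> (perturbed f w t - perturbed f w u) = D w + R w" for w
    using ut ut' by (simp add: perturbed_eq D_def R_def inner_diff_right inner_add_right)
  have q: "(CLINT w|?N. Y w * iexp (D w)) = (CLINT w|?N. Y w) * complex_of_real (exp (- ((norm l)\<^sup>2 * (t - u)) / 2))"
    unfolding D_def using Y ut' by (intro increment_char_past ut observed_measurable_wiener_filtration)
  have "cmod ((CLINT w|?N. Y w * iexp (D w + R w)) - (CLINT w|?N. Y w * iexp (D w)))
     \<le> \<epsilon> * (\<integral>w. (D w)\<^sup>2 \<partial>?N) + (1 + 1 / \<epsilon>) * (\<integral>w. (R w)\<^sup>2 \<partial>?N)"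
    by (rule C.char_expansion_bound[OF YN _ Dm D2(1) Rm R2(1) R1 orth \<epsilon>]) (use Y in auto)
  also have "\<dots> \<le> \<epsilon> * ((norm l)\<^sup>2 * (CARD('d) * (t - u))) + (1 + 1 / \<epsilon>) * ((norm l)\<^sup>2 * (CARD('d) * ((t - u) * mean_energy u t)))"
    using D2(2) R2(2) \<epsilon> by (intro add_mono mult_left_mono) auto
  also have "\<dots> = (norm l)\<^sup>2 * CARD('d) * (\<epsilon> * (t - u) + (1 + 1 / \<epsilon>) * ((t - u) * mean_energy u t))"
    by (simp add: algebra_simps)
  finally show ?thesis unfolding eq q .
qed

lemma mean_energy_sum:
  assumes "mono g" shows "(\<Sum>k<n. mean_energy (g k) (g (Suc k))) = mean_energy (g 0) (g n)"
proof (induction n)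
  case 0
  show ?case by (simp add: mean_energy_def)
next
  case (Suc n)
  then show ?case using mean_energy_add[of "g 0" "g n" "g (Suc n)"] monoD[OF assms, of 0 n] monoD[OF assms, of n "Suc n"] by simp
qed

text \<open>
  On a uniform grid each step multiplies the weighted characteristic function by the factor of a
  Gaussian of variance \<open>h\<close>, up to the error of \<open>char_one_step\<close>; the errors do not grow since that factor
  is at most 1. The parameter \<open>\<epsilon>\<close> is free, so both limits may be taken separately.
\<close>

lemma char_perturbed_increment:
  assumes Y: "Y \<in> borel_measurable (observed s)" "\<And>w. w \<in> space M \<Longrightarrow> cmod (Y w) \<le> 1"
    and st: "0 \<le> s" "s < t" "t \<le> 1"
  shows "(CLINT w|completion M. Y w * iexp (l \<bullet> (perturbed f w t - perturbed f w s)))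
      = (CLINT w|completion M. Y w) * complex_of_real (exp (- ((norm l)\<^sup>2 * (t - s)) / 2))" (is "?L = ?R")
proof -
  define K where "K = (norm l)\<^sup>2 * CARD('d)"
  have K: "0 \<le> K" by (simp add: K_def)
  define m where "m = mean_energy s t"
  have approx: "cmod (?L - ?R) \<le> K * (\<epsilon> * (t - s)) + K * ((1 + 1 / \<epsilon>) * ((t - s) * m)) / real n"
    if \<epsilon>: "0 < \<epsilon>" and n: "0 < n" for \<epsilon> and n :: nat
  proof -
    define h where "h = (t - s) / n"
    define g where "g = (\<lambda>k. s + real k * h)"
    have h: "0 < h" using st n by (simp add: h_def)
    have g0: "g 0 = s" and gn: "g n = t" using n by (auto simp: g_def h_def)
    have gS: "g (Suc k) = g k + h" for k by (simp add: g_def algebra_simps)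
    have gmono: "mono g" using h by (intro monoI) (simp add: g_def mult_right_mono)
    define \<phi> where "\<phi> = (\<lambda>k. CLINT w|completion M. Y w * iexp (l \<bullet> (perturbed f w (g k) - perturbed f w s)))"
    define q where "q = complex_of_real (exp (- ((norm l)\<^sup>2 * h) / 2))"
    have "cmod (\<phi> n - \<phi> 0 * q ^ n) \<le> (\<Sum>k<n. K * (\<epsilon> * h + (1 + 1 / \<epsilon>) * (h * mean_energy (g k) (g (Suc k)))))"
    proof (rule approximate_geometric_progression)
      show "cmod q \<le> 1" using h by (simp add: q_def)
      fix k assume k: "k < n"
      have gk: "s \<le> g k" "g k < g (Suc k)" "g (Suc k) \<le> t"
        using monoD[OF gmono, of 0 k] monoD[OF gmono, of "Suc k" n] k h by (auto simp: g0 gn gS)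
      let ?Y = "\<lambda>w. Y w * iexp (l \<bullet> (perturbed f w (g k) - perturbed f w s))"
      have Am: "(\<lambda>w. perturbed f w (g k) - perturbed f w s) \<in> borel_measurable (observed (g k))"
        using gk st by (intro borel_measurable_diff perturbed_observed) auto
      have Yk: "?Y \<in> borel_measurable (observed (g k))"
        using observed_measurable_mono[OF gk(1) Y(1)] Am by measurable
      have "cmod ((CLINT w|completion M. ?Y w * iexp (l \<bullet> (perturbed f w (g (Suc k)) - perturbed f w (g k))))
        - (CLINT w|completion M. ?Y w) * complex_of_real (exp (- ((norm l)\<^sup>2 * (g (Suc k) - g k)) / 2)))
        \<le> (norm l)\<^sup>2 * CARD('d) * (\<epsilon> * (g (Suc k) - g k) + (1 + 1 / \<epsilon>) * ((g (Suc k) - g k) * mean_energy (g k) (g (Suc k))))"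
        by (rule char_one_step[OF Yk]) (use gk st Y \<epsilon> in \<open>auto simp: norm_mult\<close>)
      moreover have "(CLINT w|completion M. ?Y w * iexp (l \<bullet> (perturbed f w (g (Suc k)) - perturbed f w (g k)))) = \<phi> (Suc k)"
        unfolding \<phi>_def by (intro Bochner_Integration.integral_cong refl)
          (simp add: mult.assoc exp_add[symmetric] inner_diff_right algebra_simps)
      moreover have "(CLINT w|completion M. ?Y w) = \<phi> k" by (simp add: \<phi>_def)
      moreover have "g (Suc k) - g k = h" by (simp add: gS)
      ultimately show "cmod (\<phi> (Suc k) - \<phi> k * q) \<le> K * (\<epsilon> * h + (1 + 1 / \<epsilon>) * (h * mean_energy (g k) (g (Suc k))))"
        by (simp add: q_def K_def)
    qed
    also have "\<dots> = K * (\<epsilon> * (real n * h)) + K * ((1 + 1 / \<epsilon>) * (h * (\<Sum>k<n. mean_energy (g k) (g (Suc k)))))"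
      by (simp add: sum.distrib sum_distrib_left[symmetric] distrib_left mult_ac)
    also have "(\<Sum>k<n. mean_energy (g k) (g (Suc k))) = m"
      using mean_energy_sum[OF gmono, of n] by (simp add: g0 gn m_def)
    also have "real n * h = t - s" using n by (simp add: h_def)
    also have "K * ((1 + 1 / \<epsilon>) * (h * m)) = K * ((1 + 1 / \<epsilon>) * ((t - s) * m)) / real n" by (simp add: h_def)
    also have "q ^ n = complex_of_real (exp (- ((norm l)\<^sup>2 * (t - s)) / 2))"
    proof -
      have "q ^ n = complex_of_real (exp (real n * (- ((norm l)\<^sup>2 * h) / 2)))"
        unfolding q_def exp_of_nat_mult by simp
      then show ?thesis using n by (simp add: h_def)
    qed
    also have "\<phi> n = ?L" by (simp add: \<phi>_def gn)
    also have "\<phi> 0 = (CLINT w|completion M. Y w)" by (simp add: \<phi>_def g0)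
    finally show ?thesis .
  qed
  have le: "cmod (?L - ?R) \<le> K * (\<epsilon> * (t - s))" if \<epsilon>: "0 < \<epsilon>" for \<epsilon>
  proof (rule LIMSEQ_le_const)
    have "(\<lambda>n. c / real n) \<longlonglongrightarrow> 0" for c :: real by (rule lim_const_over_n)
    from tendsto_add[OF tendsto_const this]
    show "(\<lambda>n. K * (\<epsilon> * (t - s)) + K * ((1 + 1 / \<epsilon>) * ((t - s) * m)) / real n) \<longlonglongrightarrow> K * (\<epsilon> * (t - s))" by simp
    show "\<exists>N. \<forall>n\<ge>N. cmod (?L - ?R) \<le> K * (\<epsilon> * (t - s)) + K * ((1 + 1 / \<epsilon>) * ((t - s) * m)) / real n"
      using approx[OF \<epsilon>] by (intro exI[of _ 1]) auto
  qed
  have "cmod (?L - ?R) \<le> 0"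
  proof (rule tendsto_lowerbound)
    show "((\<lambda>\<epsilon>. K * (\<epsilon> * (t - s))) \<longlongrightarrow> 0) (at_right 0)"
      by (rule tendsto_eq_intros refl | simp)+
    show "\<forall>\<^sub>F \<epsilon> in at_right 0. cmod (?L - ?R) \<le> K * (\<epsilon> * (t - s))"
      using le by (auto simp: eventually_at_right_field intro: exI[of _ 1])
  qed simp
  then show ?thesis by simp
qed

end

context unobserved_drift
begin

lemma char_perturbed_increments:
  assumes "\<forall>k\<le>n. \<tau> k \<in> {0..1}" "\<forall>k<n. \<tau> k < \<tau> (Suc k)"
  shows "(CLINT w|completion M. iexp (\<Sum>k<n. l k \<bullet> (perturbed f w (\<tau> (Suc k)) - perturbed f w (\<tau> k))))
      = (\<Prod>k<n. complex_of_real (exp (- ((norm (l k))\<^sup>2 * (\<tau> (Suc k) - \<tau> k)) / 2)))"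
  using assms
proof (induction n)
  case 0
  show ?case using C.prob_space by simp
next
  case (Suc n)
  let ?A = "\<lambda>k w. l k \<bullet> (perturbed f w (\<tau> (Suc k)) - perturbed f w (\<tau> k))"
  let ?Y = "\<lambda>w. iexp (\<Sum>k<n. ?A k w)"
  have IH: "(CLINT w|completion M. ?Y w) = (\<Prod>k<n. complex_of_real (exp (- ((norm (l k))\<^sup>2 * (\<tau> (Suc k) - \<tau> k)) / 2)))"
    using Suc by auto
  have \<tau>le: "\<tau> k \<le> \<tau> n" if "k \<le> n" for k
    using that
  proof (induction rule: inc_induct)
    case (step m)
    then show ?case using Suc.prems(2)[rule_format, of m] by auto
  qed simp
  have n: "0 \<le> \<tau> n" "\<tau> n < \<tau> (Suc n)" "\<tau> (Suc n) \<le> 1" using Suc.prems by auto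
  have "?A k \<in> borel_measurable (observed (\<tau> n))" if "k < n" for k
  proof -
    have "(\<lambda>w. perturbed f w (\<tau> (Suc k)) - perturbed f w (\<tau> k)) \<in> borel_measurable (observed (\<tau> n))"
      using that \<tau>le[of k] \<tau>le[of "Suc k"] Suc.prems(1) by (intro borel_measurable_diff perturbed_observed) auto
    then show ?thesis by measurable
  qed
  then have Y: "?Y \<in> borel_measurable (observed (\<tau> n))" by measurable
  have "(CLINT w|completion M. iexp (\<Sum>k<Suc n. ?A k w)) = (CLINT w|completion M. ?Y w * iexp (?A n w))"
    by (intro Bochner_Integration.integral_cong refl) (simp add: distrib_left exp_add)
  also have "\<dots> = (CLINT w|completion M. ?Y w) * complex_of_real (exp (- ((norm (l n))\<^sup>2 * (\<tau> (Suc n) - \<tau> n)) / 2))"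
    by (rule char_perturbed_increment[OF Y _ n]) auto
  finally show ?case unfolding IH by simp
qed

text \<open>
  Grouping the coefficients of the components of one increment into a vector \<open>l k\<close> turns the joint
  characteristic function of all components into the one computed for the vector increments, and the
  Gaussian factor of \<open>l k\<close> splits into one factor for each component.
\<close>

lemma perturbed_increments:
  assumes \<tau>: "\<forall>k\<le>n. \<tau> k \<in> {0..1}" "\<forall>k<n. \<tau> k < \<tau> (Suc k)"
  shows "C.indep_vars (\<lambda>_. borel) (\<lambda>p w. increment \<tau> p (perturbed f w)) ({..<n} \<times> UNIV)"
    and "k < n \<Longrightarrow> distr (completion M) borel (\<lambda>w. increment \<tau> (k, i) (perturbed f w))
       = density lborel (normal_density 0 (sqrt (\<tau> (Suc k) - \<tau> k)))"
proof -
  define \<nu> where "\<nu> = (\<lambda>p :: nat \<times> 'd. density lborel (normal_density 0 (sqrt (\<tau> (Suc (fst p)) - \<tau> (fst p)))))"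
  have fin: "finite ({..<n} \<times> (UNIV :: 'd set))" by simp
  have rv: "C.random_variable borel (\<lambda>w. increment \<tau> p (perturbed f w))" if "p \<in> {..<n} \<times> UNIV" for p
    using measurable_comp[OF perturbed_measurable increment_measurable[OF \<tau>(1) that]] by (simp add: comp_def)
  have nu: "real_distribution (\<nu> p)" if "p \<in> {..<n} \<times> UNIV" for p
  proof -
    have "0 < sqrt (\<tau> (Suc (fst p)) - \<tau> (fst p))" using that \<tau>(2) by auto
    then show ?thesis
      unfolding \<nu>_def real_distribution_def real_distribution_axioms_def by (simp add: prob_space_normal_density)
  qed
  have char: "(CLINT w|completion M. iexp (\<Sum>p\<in>{..<n} \<times> UNIV. u p * increment \<tau> p (perturbed f w)))
      = (\<Prod>p\<in>{..<n} \<times> UNIV. char (\<nu> p) (u p))" for u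
  proof -
    define l :: "nat \<Rightarrow> real ^ 'd" where "l = (\<lambda>k. \<chi> i. u (k, i))"
    have s: "(\<Sum>p\<in>{..<n} \<times> UNIV. u p * increment \<tau> p w) = (\<Sum>k<n. l k \<bullet> (w (\<tau> (Suc k)) - w (\<tau> k)))" for w
      by (simp add: sum.cartesian_product' l_def inner_vec_def)
    have p: "(\<Prod>i\<in>UNIV. char (\<nu> (k, i)) (u (k, i))) = complex_of_real (exp (- ((norm (l k))\<^sup>2 * (\<tau> (Suc k) - \<tau> k)) / 2))"
      if "k < n" for k
    proof -
      have "(\<Prod>i\<in>UNIV. char (\<nu> (k, i)) (u (k, i))) = (\<Prod>i\<in>UNIV. complex_of_real (exp (- ((\<tau> (Suc k) - \<tau> k) * (u (k, i))\<^sup>2) / 2)))"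
        unfolding \<nu>_def using that \<tau>(2) by (intro prod.cong refl) (simp add: char_centred_normal less_imp_le)
      also have "\<dots> = complex_of_real (exp (\<Sum>i\<in>UNIV. - ((\<tau> (Suc k) - \<tau> k) * (u (k, i))\<^sup>2) / 2))"
        unfolding of_real_prod[symmetric] by (simp add: exp_sum)
      also have "(\<Sum>i\<in>UNIV. - ((\<tau> (Suc k) - \<tau> k) * (u (k, i))\<^sup>2) / 2) = - ((norm (l k))\<^sup>2 * (\<tau> (Suc k) - \<tau> k)) / 2"
        by (simp add: power2_norm_eq_inner inner_vec_def l_def power2_eq_square[of "u _"] sum_distrib_left
          sum_divide_distrib sum_negf mult.commute)
      finally show ?thesis .
    qed
    have "(\<Prod>p\<in>{..<n} \<times> UNIV. char (\<nu> p) (u p)) = (\<Prod>k<n. \<Prod>i\<in>UNIV. char (\<nu> (k, i)) (u (k, i)))"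
      by (simp add: prod.cartesian_product')
    also have "\<dots> = (\<Prod>k<n. complex_of_real (exp (- ((norm (l k))\<^sup>2 * (\<tau> (Suc k) - \<tau> k)) / 2)))"
      using p by (intro prod.cong) auto
    finally show ?thesis unfolding s char_perturbed_increments[OF \<tau>] ..
  qed
  note * = C.joint_char_determines_law[OF fin rv nu char]
  show "C.indep_vars (\<lambda>_. borel) (\<lambda>p w. increment \<tau> p (perturbed f w)) ({..<n} \<times> UNIV)" by (rule *(1))
  show "distr (completion M) borel (\<lambda>w. increment \<tau> (k, i) (perturbed f w)) = density lborel (normal_density 0 (sqrt (\<tau> (Suc k) - \<tau> k)))"
    if "k < n" using *(2)[of "(k, i)"] that by (simp add: \<nu>_def)
qed

theorem perturbed_law_wiener: "wiener_measure (distr (completion M) M (perturbed f))"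
  unfolding wiener_measure_def
proof (intro conjI allI impI)
  let ?P = "distr (completion M) M (perturbed f)"
  interpret P: prob_space ?P by (rule C.prob_space_distr[OF perturbed_measurable])
  show "prob_space ?P" by (rule P.prob_space_axioms)
  show "sets ?P = sets path_algebra" by (simp add: sets_eq)
  show "AE w in ?P. w 0 = 0"
  proof (subst AE_distr_iff[OF perturbed_measurable])
    have "(\<lambda>w. w 0) -` {0} \<inter> space M \<in> sets M" by (rule measurable_sets[OF coordinate_measurable]) auto
    then show "{w \<in> space M. w 0 = 0} \<in> sets M" by (simp add: vimage_def Int_def conj_commute)
    show "AE w in completion M. perturbed f w 0 = 0"
      using AE_completion[OF start] by eventually_elim (simp add: perturbed_eq primitive_0)
  qed
  have incr_distr: "distr ?P borel X = distr (completion M) borel (\<lambda>w. X (perturbed f w))"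
    if "X \<in> borel_measurable M" for X :: "'d path \<Rightarrow> real"
    using distr_distr[OF that perturbed_measurable] by (simp add: comp_def)
  show "distributed ?P lborel (\<lambda>w. (w t - w s) $ i) (normal_density 0 (sqrt (t - s)))"
    if st: "0 \<le> s \<and> s < t \<and> t \<le> 1" for s t i
  proof -
    define \<tau> where "\<tau> = (\<lambda>k::nat. if k = 0 then s else t)"
    have \<tau>: "\<forall>k\<le>1. \<tau> k \<in> {0..1}" "\<forall>k<1. \<tau> k < \<tau> (Suc k)" using st by (auto simp: \<tau>_def)
    have m: "increment \<tau> (0, i) \<in> borel_measurable M" by (rule increment_measurable[OF \<tau>(1)]) auto
    have "distr ?P lborel (increment \<tau> (0, i)) = distr ?P borel (increment \<tau> (0, i))" by (rule distr_cong) auto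
    also have "\<dots> = density lborel (normal_density 0 (sqrt (t - s)))"
      unfolding incr_distr[OF m] using perturbed_increments(2)[OF \<tau>, of 0 i] by (simp add: \<tau>_def)
    finally have "distr ?P lborel (\<lambda>w. (w t - w s) $ i) = density lborel (normal_density 0 (sqrt (t - s)))"
      by (simp add: \<tau>_def)
    moreover have "(\<lambda>w. (w t - w s) $ i) \<in> borel_measurable ?P" using m by (simp add: \<tau>_def)
    ultimately show ?thesis unfolding distributed_def by simp
  qed
  show "P.indep_vars (\<lambda>_. borel) (\<lambda>(k, i) w. (w (\<tau> (Suc k)) - w (\<tau> k)) $ i) ({..<n} \<times> UNIV)"
    if \<tau>: "(\<forall>k\<le>n. \<tau> k \<in> {0..1}) \<and> (\<forall>k<n. \<tau> k < \<tau> (Suc k))" for n \<tau>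
  proof (cases "n = 0")
    case True
    then show ?thesis by (simp add: P.indep_vars_def P.indep_sets_def)
  next
    case False
    let ?I = "{..<n} \<times> (UNIV :: 'd set)"
    have I: "?I \<noteq> {}" using False by (auto simp: lessThan_empty_iff)
    have \<tau>1: "\<forall>k\<le>n. \<tau> k \<in> {0..1}" and \<tau>2: "\<forall>k<n. \<tau> k < \<tau> (Suc k)" using \<tau> by auto
    have m: "increment \<tau> p \<in> borel_measurable M" if "p \<in> ?I" for p by (rule increment_measurable[OF \<tau>1 that])
    have mP: "P.random_variable borel (increment \<tau> p)" if "p \<in> ?I" for p using m[OF that] by simp
    have mC: "C.random_variable borel (\<lambda>w. increment \<tau> p (perturbed f w))" if "p \<in> ?I" for p
      using measurable_comp[OF perturbed_measurable m[OF that]] by (simp add: comp_def)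
    have "(\<lambda>w. \<lambda>p\<in>?I. increment \<tau> p w) \<in> M \<rightarrow>\<^sub>M PiM ?I (\<lambda>_. borel)" by (intro measurable_restrict m)
    from distr_distr[OF this perturbed_measurable]
    have "distr ?P (PiM ?I (\<lambda>_. borel)) (\<lambda>w. \<lambda>p\<in>?I. increment \<tau> p w)
        = distr (completion M) (PiM ?I (\<lambda>_. borel)) (\<lambda>w. \<lambda>p\<in>?I. increment \<tau> p (perturbed f w))"
      by (simp add: comp_def)
    also have "\<dots> = PiM ?I (\<lambda>p. distr (completion M) borel (\<lambda>w. increment \<tau> p (perturbed f w)))"
      using C.indep_vars_iff_distr_eq_PiM'[where I = ?I and M' = "\<lambda>_. borel" and X = "\<lambda>p w. increment \<tau> p (perturbed f w)", OF I mC]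
        perturbed_increments(1)[OF \<tau>1 \<tau>2] by blast
    also have "\<dots> = PiM ?I (\<lambda>p. distr ?P borel (increment \<tau> p))"
      by (intro PiM_cong refl incr_distr[symmetric] m)
    finally show ?thesis
      using P.indep_vars_iff_distr_eq_PiM'[where I = ?I and M' = "\<lambda>_. borel" and X = "increment \<tau>", OF I mP] by blast
  qed
qed

end

section \<open>A drift that preserves the law is unobserved\<close>

lemma set_integral_zero_sigma_sets:
  fixes h :: "'a \<Rightarrow> real"
  assumes h: "integrable M h" "integral\<^sup>L M h = 0"
    and G: "Int_stable G" "G \<subseteq> sets M" "\<And>A. A \<in> G \<Longrightarrow> (\<integral>x. indicator A x * h x \<partial>M) = 0"
    and A: "A \<in> sigma_sets (space M) G"
  shows "(\<integral>x. indicator A x * h x \<partial>M) = 0"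
proof -
  have sub: "sigma_sets (space M) G \<subseteq> sets M" by (rule sets.sigma_sets_subset[OF G(2)])
  have int: "integrable M (\<lambda>x. indicator B x * h x)" if "B \<in> sets M" for B
    using integrable_mult_indicator[OF that h(1)] by simp
  have "G \<subseteq> Pow (space M)" using G(2) sets.sets_into_space by blast
  from G(1) this A show ?thesis
  proof (induction rule: sigma_sets_induct_disjoint)
    case (basic A)
    then show ?case by (rule G(3))
  next
    case empty
    then show ?case by simp
  next
    case (compl A)
    have "(\<integral>x. indicator (space M - A) x * h x \<partial>M) = (\<integral>x. h x - indicator A x * h x \<partial>M)"
      by (intro Bochner_Integration.integral_cong) (auto simp: indicator_def)
    also have "\<dots> = 0" using compl h int sub by auto
    finally show ?case .
  next
    case (union A)
    have "set_lebesgue_integral M (\<Union>i. A i) h = (\<Sum>i. set_lebesgue_integral M (A i) h)"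
    proof (rule lebesgue_integral_countable_add)
      show "A i \<in> sets M" for i using union(2) sub by auto
      then show "set_integrable M (\<Union>i. A i) h"
        unfolding set_integrable_def by (intro integrable_mult_indicator h) auto
      show "A i \<inter> A j = {}" if "i \<noteq> j" for i j using union(1) that by (auto simp: disjoint_family_on_def)
    qed
    also have "\<dots> = 0" using union(3) by (simp add: set_lebesgue_integral_def)
    finally show ?case by (simp add: set_lebesgue_integral_def)
  qed
qed

lemma AE_zero_if_interval_integrals_zero:
  fixes g :: "real \<Rightarrow> real"
  assumes g: "integrable unit_time g" and u: "0 \<le> u"
    and zero: "\<And>t. u \<le> t \<Longrightarrow> t \<le> 1 \<Longrightarrow> (\<integral>s. indicator {u<..t} s * g s \<partial>unit_time) = 0"
  shows "AE s in unit_time. u < s \<longrightarrow> g s = 0"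
proof -
  define h where "h = (\<lambda>s. indicator {0..1} s * (indicator {u<..1} s * g s))"
  have h: "integrable lborel h"
    using integrable_indicator_unit_time[OF g, of "{u<..1}"]
      integrable_restrict_space[of "{0..1}" lborel "\<lambda>s. indicator {u<..1} s * g s"]
    unfolding h_def by simp
  have int: "(\<integral>s. indicator {..t} s * h s \<partial>lborel) = 0" for t
  proof -
    have "(\<integral>s. indicator {..t} s * h s \<partial>lborel) = (\<integral>s. indicator {u<..min t 1} s * g s \<partial>unit_time)"
      by (subst integral_restrict_space) (use u in \<open>auto intro!: Bochner_Integration.integral_cong simp: h_def indicator_def\<close>)
    also have "\<dots> = 0"
      using zero[of "min t 1"] by (cases "u \<le> min t 1") auto
    finally show ?thesis .
  qed
  have "integral\<^sup>L lborel h = (\<integral>s. indicator {..1} s * h s \<partial>lborel)"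
    by (intro Bochner_Integration.integral_cong) (auto simp: h_def indicator_def)
  then have h0: "integral\<^sup>L lborel h = 0" using int by simp
  have "AE s in lborel. h s = 0"
  proof (rule sigma_finite_measure.density_zero[OF sigma_finite_lborel h])
    fix A :: "real set" assume "A \<in> sets lborel"
    then have A: "A \<in> sigma_sets (space lborel) (range (\<lambda>a. {..a}))"
      by (simp add: borel_eq_atMost)
    have st: "Int_stable (range (\<lambda>a::real. {..a}))"
    proof (rule Int_stableI)
      fix a b :: "real set" assume "a \<in> range atMost" "b \<in> range atMost"
      then obtain x y where "a = {..x}" "b = {..y}" by auto
      then have "a \<inter> b = {..min x y}" by auto
      then show "a \<inter> b \<in> range atMost" by auto
    qed
    have "(\<integral>s. indicator A s * h s \<partial>lborel) = 0"
      by (rule set_integral_zero_sigma_sets[OF h h0 st _ _ A]) (use int in auto)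
    then show "set_lebesgue_integral lborel A h = 0" by (simp add: set_lebesgue_integral_def)
  qed
  then have "AE s in lborel. s \<in> {0..1} \<longrightarrow> u < s \<longrightarrow> g s = 0"
    by eventually_elim (auto simp: h_def)
  then show ?thesis by (subst AE_restrict_space_iff) auto
qed

text \<open>
  Every \<open>A r\<close> with \<open>r \<le> s\<close> is a limit of values at rational times strictly before \<open>s\<close>, also for \<open>r = s\<close>.
  Strictness matters: an event involving only times up to some rational \<open>q\<close> is known to be orthogonal
  to \<open>f s\<close> only for \<open>s > q\<close>.
\<close>

lemma (in drifted_wiener) observed_countably_generated:
  assumes B: "countable \<B>" "topological_basis \<B>" and s: "0 < s" "s \<le> 1"
  shows "sets (observed s) \<subseteq> sigma_sets (space M)
    {{w \<in> space M. \<forall>p\<in>J. perturbed f w (fst p) \<in> snd p} | J. finite J \<and> J \<subseteq> (\<rat> \<inter> {0..<s}) \<times> \<B>}"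
    (is "_ \<subseteq> sigma_sets _ ?G")
proof -
  have G: "?G \<subseteq> Pow (space M)" by auto
  have rat: "(\<lambda>w. perturbed f w q) \<in> borel_measurable (sigma (space M) ?G)" if q: "q \<in> \<rat> \<inter> {0..<s}" for q
    unfolding borel_eq_countable_basis[OF B]
  proof (rule measurable_measure_of)
    fix b assume b: "b \<in> \<B>"
    have "(\<lambda>w. perturbed f w q) -` b \<inter> space M = {w \<in> space M. \<forall>p\<in>{(q, b)}. perturbed f w (fst p) \<in> snd p}"
      by auto
    also have "\<dots> \<in> ?G" using q b by (intro CollectI exI[of _ "{(q, b)}"]) auto
    finally show "(\<lambda>w. perturbed f w q) -` b \<inter> space (sigma (space M) ?G) \<in> sets (sigma (space M) ?G)"
      using G by (simp add: space_measure_of sets_measure_of sigma_sets.Basic)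
  qed auto
  have "sets (observed s) \<subseteq> sets (sigma (space M) ?G)"
    unfolding perturbed_filtration_def
  proof (rule natural_filtration_least)
    fix r assume r: "0 \<le> r" "r \<le> s"
    have "\<exists>q. q \<in> \<rat> \<inter> {0..<s} \<and> \<bar>q - r\<bar> < inverse (real (Suc n))" for n
    proof -
      \<comment> \<open>Even for \<open>r = 0\<close> and \<open>r = s\<close> there are points strictly between 0 and \<open>s\<close> at distance less than \<open>e\<close> from \<open>r\<close>.\<close>
      define e where "e = inverse (real (Suc n))"
      have "0 < e" by (simp add: e_def)
      then have "max 0 (r - e) < min s (r + e)" using r s by auto
      from Rats_dense_in_real[OF this] obtain q where "q \<in> \<rat>" "max 0 (r - e) < q" "q < min s (r + e)" by auto
      then show ?thesis unfolding e_def[symmetric] by (intro exI[of _ q]) auto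
    qed
    then obtain q where q: "\<And>n. q n \<in> \<rat> \<inter> {0..<s}" "\<And>n. \<bar>q n - r\<bar> < inverse (real (Suc n))"
      by metis
    have "(\<lambda>n. q n - r) \<longlonglongrightarrow> 0"
      by (rule Lim_null_comparison[OF _ LIMSEQ_inverse_real_of_nat]) (use q(2) in \<open>auto intro!: always_eventually less_imp_le\<close>)
    then have lim: "q \<longlonglongrightarrow> r" by (simp add: LIM_zero_iff)
    show "(\<lambda>w. perturbed f w r) \<in> borel_measurable (sigma (space M) ?G)"
    proof (rule borel_measurable_LIMSEQ_metric[OF rat[OF q(1)]])
      fix w assume "w \<in> space (sigma (space M) ?G)"
      then have "w \<in> space M" using G by (simp add: space_measure_of)
      then have c: "continuous_on {0..1} (perturbed f w)" using perturbed_in_space by (auto simp: space_eq)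
      show "(\<lambda>n. perturbed f w (q n)) \<longlonglongrightarrow> perturbed f w r"
        by (rule continuous_on_tendsto_compose[OF c lim]) (use q(1) r s in \<open>auto intro!: always_eventually less_imp_le dest: order.strict_trans2\<close>)
    qed
  qed (use G in \<open>simp add: space_measure_of\<close>)
  then show ?thesis using G by (simp add: sets_measure_of)
qed

locale measure_preserving_drift = drifted_wiener M f
  for M :: "('d::finite) path measure" and f :: "real \<Rightarrow> 'd path \<Rightarrow> real ^ 'd" +
  assumes law: "distr (completion M) M (perturbed f) = M"
begin

text \<open>
  A finite set of constraints, each a time paired with a set of values, encodes an event for the
  perturbed path; unlike a family of sets indexed by time, such constraints form a countable
  collection once times and sets of values range over countable collections.
\<close>

definition event :: "(real \<times> (real ^ 'd) set) set \<Rightarrow> 'd path set" where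
  "event J = {w \<in> space M. \<forall>p\<in>J. perturbed f w (fst p) \<in> snd p}"

lemma event_observed:
  assumes "finite J" "\<And>r B. (r, B) \<in> J \<Longrightarrow> 0 \<le> r \<and> r \<le> u \<and> B \<in> sets borel"
  shows "event J \<in> sets (observed u)"
  unfolding event_def perturbed_filtration_def by (rule finite_event_in_natural_filtration) fact+

text \<open>
  The event for the perturbed path is the preimage of the same event for the coordinate process.
  Preservation of the law turns the expectation over the increment of the perturbed path into one over
  a Brownian increment and its past, which is 0; so is the Brownian part of the increment.
\<close>

lemma event_orthogonal_to_drift:
  assumes J: "finite J" "\<And>r B. (r, B) \<in> J \<Longrightarrow> 0 \<le> r \<and> r \<le> u \<and> B \<in> sets borel" and ut: "0 \<le> u" "u < t" "t \<le> 1"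
  shows "(\<integral>w. indicator (event J) w * (drift t w - drift u w) $ i \<partial>completion M) = 0"
proof -
  let ?N = "completion M"
  let ?F = "event J"
  define F' where "F' = {w \<in> space M. \<forall>p\<in>J. w (fst p) \<in> snd p}"
  have u1: "u \<le> 1" "u \<le> t" using ut by auto
  have F': "F' \<in> sets (natural_filtration (space M) (\<lambda>s w. w s) u)"
    unfolding F'_def by (rule finite_event_in_natural_filtration) fact+
  then have F'w: "F' \<in> sets (wiener_filtration M u)" unfolding sets_wiener_filtration by (intro sigma_sets.Basic) auto
  have F'M: "F' \<in> sets M" using F' natural_sub[OF u1(1)] by auto
  have F: "?F \<in> sets (observed u)" by (rule event_observed) fact+
  then have Fw: "?F \<in> sets (wiener_filtration M u)" using observed_sub_wiener_filtration[OF u1(1)] by auto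
  then have FN: "?F \<in> sets ?N" using wiener_filtration_sub[OF u1(1)] by auto
  have \<Delta>: "(\<lambda>w. (w t - w u) $ i) \<in> borel_measurable M"
    using borel_measurable_diff[OF coordinate_measurable coordinate_measurable, of t u] ut by (simp add: borel_measurable_vec_iff)
  have iW: "integrable ?N (\<lambda>w. indicator ?F w * (w t - w u) $ i)"
    using integrable_mult_indicator[OF FN increment_integrals(3)[OF ut, of i]] by simp
  have ia: "integrable ?N (\<lambda>w. indicator ?F w * (drift t w - drift u w) $ i)"
    by (rule weighted_drift_Fubini(3)) (use FN ut u1 in auto)
  have "(\<integral>w. indicator F' w * (w t - w u) $ i \<partial>M) = (\<integral>w. indicator F' w * (w t - w u) $ i \<partial>?N)"
    by (rule integral_completion[symmetric]) (use F'M \<Delta> in \<open>intro borel_measurable_times borel_measurable_indicator\<close>)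
  also have "\<dots> = 0" by (rule increment_mean_past[OF ut]) (use F'w in auto)
  finally have "0 = (\<integral>w. indicator F' w * (w t - w u) $ i \<partial>distr ?N M (perturbed f))" unfolding law by simp
  also have "\<dots> = (\<integral>w. indicator F' (perturbed f w) * (perturbed f w t - perturbed f w u) $ i \<partial>?N)"
    by (rule integral_distr[OF perturbed_measurable]) (use F'M \<Delta> in \<open>intro borel_measurable_times borel_measurable_indicator\<close>)
  also have "\<dots> = (\<integral>w. indicator ?F w * (w t - w u) $ i + indicator ?F w * (drift t w - drift u w) $ i \<partial>?N)"
  proof (intro Bochner_Integration.integral_cong refl)
    fix w assume "w \<in> space ?N"
    then have "w \<in> space M" by simp
    then have "indicator F' (perturbed f w) = (indicator ?F w :: real)"
      using perturbed_in_space by (auto simp: F'_def event_def indicator_def)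
    then show "indicator F' (perturbed f w) * (perturbed f w t - perturbed f w u) $ i
        = indicator ?F w * (w t - w u) $ i + indicator ?F w * (drift t w - drift u w) $ i"
      using ut by (simp add: perturbed_eq algebra_simps)
  qed
  also have "\<dots> = (\<integral>w. indicator ?F w * (w t - w u) $ i \<partial>?N) + (\<integral>w. indicator ?F w * (drift t w - drift u w) $ i \<partial>?N)"
    by (rule Bochner_Integration.integral_add[OF iW ia])
  also have "(\<integral>w. indicator ?F w * (w t - w u) $ i \<partial>?N) = 0"
    by (rule increment_mean_past[OF ut]) (use Fw in auto)
  finally show ?thesis by simp
qed

lemma event_orthogonal_to_density:
  assumes J: "finite J" "\<And>r B. (r, B) \<in> J \<Longrightarrow> 0 \<le> r \<and> r \<le> u \<and> B \<in> sets borel" and u: "0 \<le> u" "u \<le> 1"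
  shows "AE s in unit_time. u < s \<longrightarrow> (\<integral>w. indicator (event J) w * f s w $ i \<partial>completion M) = 0"
proof (rule AE_zero_if_interval_integrals_zero[OF _ u(1)])
  have F: "event J \<in> sets (completion M)"
    using event_observed[OF J] observed_subalgebra[OF u(2)] by (auto simp: subalgebra_def)
  have m: "indicator (event J) \<in> borel_measurable (completion M)" "\<And>w. \<bar>indicator (event J) w :: real\<bar> \<le> 1"
    using F by auto
  show "integrable unit_time (\<lambda>s. \<integral>w. indicator (event J) w * f s w $ i \<partial>completion M)"
    by (rule weighted_drift_Fubini(1)[OF m u(1) u(2)]) simp
  fix t :: real assume t: "u \<le> t" "t \<le> 1"
  show "(\<integral>s. indicator {u<..t} s * (\<integral>w. indicator (event J) w * f s w $ i \<partial>completion M) \<partial>unit_time) = 0"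
  proof (cases "u = t")
    case False
    then have "(\<integral>w. indicator (event J) w * (drift t w - drift u w) $ i \<partial>completion M) = 0"
      using t u by (intro event_orthogonal_to_drift J) auto
    then show ?thesis using weighted_drift_Fubini(4)[OF m u(1) t, of i] by simp
  qed simp
qed

lemma Int_stable_events: "Int_stable {event J | J. finite J \<and> J \<subseteq> D}"
proof (rule Int_stableI)
  fix a b assume "a \<in> {event J | J. finite J \<and> J \<subseteq> D}" "b \<in> {event J | J. finite J \<and> J \<subseteq> D}"
  then obtain J K where "a = event J" "finite J" "J \<subseteq> D" "b = event K" "finite K" "K \<subseteq> D" by auto
  moreover have "event J \<inter> event K = event (J \<union> K)" by (auto simp: event_def)
  ultimately show "a \<inter> b \<in> {event J | J. finite J \<and> J \<subseteq> D}" by (intro CollectI exI[of _ "J \<union> K"]) auto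
qed

text \<open>
  Countability of the index set \<open>\<J>\<close> of events permits a single null set of times outside which \<open>f s\<close> is
  orthogonal to all the events that generate the observed past of \<open>s\<close>.
\<close>

theorem cond_exp_density_zero:
  "AE s in unit_time. \<forall>i. AE w in completion M. real_cond_exp (completion M) (observed s) (\<lambda>w. f s w $ i) w = 0"
proof -
  let ?N = "completion M"
  obtain \<B> :: "(real ^ 'd) set set" where B: "countable \<B>" "topological_basis \<B>"
    using ex_countable_basis by auto
  have Bb: "b \<in> sets borel" if "b \<in> \<B>" for b using topological_basis_open[OF B(2) that] by simp
  define \<J> where "\<J> = {(q :: real, J). q \<in> \<rat> \<inter> {0..1} \<and> J \<in> {J. finite J \<and> J \<subseteq> (\<rat> \<inter> {0..q}) \<times> \<B>}}"
  have "\<J> \<subseteq> \<rat> \<times> {J. finite J \<and> J \<subseteq> \<rat> \<times> \<B>}" unfolding \<J>_def by auto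
  moreover have "countable ((\<rat> :: real set) \<times> {J. finite J \<and> J \<subseteq> (\<rat> :: real set) \<times> \<B>})"
    using B(1) countable_rat by (intro countable_SIGMA countable_Collect_finite_subset) auto
  ultimately have cJ: "countable \<J>" by (rule countable_subset)
  have "AE s in unit_time. \<forall>p\<in>\<J>. \<forall>i. fst p < s \<longrightarrow> (\<integral>w. indicator (event (snd p)) w * f s w $ i \<partial>?N) = 0"
  proof (rule AE_ball_countable'[OF _ cJ])
    fix p assume "p \<in> \<J>"
    then have p: "finite (snd p)" "0 \<le> fst p" "fst p \<le> 1" "snd p \<subseteq> (\<rat> \<inter> {0..fst p}) \<times> \<B>"
      by (auto simp: \<J>_def)
    have "AE s in unit_time. fst p < s \<longrightarrow> (\<integral>w. indicator (event (snd p)) w * f s w $ i \<partial>?N) = 0" for i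
      using p Bb by (intro event_orthogonal_to_density) auto
    then show "AE s in unit_time. \<forall>i. fst p < s \<longrightarrow> (\<integral>w. indicator (event (snd p)) w * f s w $ i \<partial>?N) = 0"
      unfolding AE_all_countable by blast
  qed
  moreover have "AE s in unit_time. \<forall>i. integrable ?N (\<lambda>w. f s w $ i)"
    using weighted_drift_Fubini(2)[of "\<lambda>_. 1" 0 0] by (simp add: AE_all_countable)
  moreover have "AE s in unit_time. 0 < s"
  proof -
    have "AE s in lborel. s \<noteq> (0::real)" by (rule AE_lborel_singleton)
    then have "AE s in lborel. s \<in> {0..1} \<longrightarrow> 0 < (s::real)" by eventually_elim auto
    then show ?thesis by (subst AE_restrict_space_iff) auto
  qed
  ultimately show ?thesis using AE_space
  proof eventually_elim
    case (elim s)
    then have s: "0 < s" "s \<le> 1" by auto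
    interpret S: finite_measure_subalgebra ?N "observed s"
      by standard (use s in \<open>auto intro: observed_subalgebra\<close>)
    let ?D = "(\<rat> \<inter> {0..<s}) \<times> \<B>"
    let ?G = "{event J | J. finite J \<and> J \<subseteq> ?D}"
    show ?case
    proof
      fix i
      have int: "integrable ?N (\<lambda>w. f s w $ i)" using elim by auto
      have zero: "(\<integral>w. indicator (event J) w * f s w $ i \<partial>?N) = 0" if J: "finite J" "J \<subseteq> ?D" for J
      proof -
        \<comment> \<open>A rational time before \<open>s\<close> that bounds all times of the event; 0 covers the case of no constraints.\<close>
        define q where "q = Max (insert 0 (fst ` J))"
        have "q \<in> insert 0 (fst ` J)" unfolding q_def using J(1) by (intro Max_in) auto
        then have q: "q \<in> \<rat>" "0 \<le> q" "q < s" using J(2) s by auto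
        have "J \<subseteq> (\<rat> \<inter> {0..q}) \<times> \<B>"
        proof
          fix p assume p: "p \<in> J"
          then have "fst p \<le> q" unfolding q_def using J(1) by (intro Max_ge) auto
          then show "p \<in> (\<rat> \<inter> {0..q}) \<times> \<B>" using p J(2) by auto
        qed
        then have "(q, J) \<in> \<J>" using q s J(1) by (auto simp: \<J>_def)
        then show ?thesis using elim(1) q(3) by force
      qed
      have zero_all: "(\<integral>w. f s w $ i \<partial>?N) = 0"
      proof -
        have "(\<integral>w. f s w $ i \<partial>?N) = (\<integral>w. indicator (event {}) w * f s w $ i \<partial>?N)"
          by (intro Bochner_Integration.integral_cong) (auto simp: event_def)
        then show ?thesis using zero[of "{}"] by simp
      qed
      show "AE w in ?N. real_cond_exp ?N (observed s) (\<lambda>w. f s w $ i) w = 0"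
      proof (rule S.real_cond_exp_charact[OF _ int])
        fix A assume "A \<in> sets (observed s)"
        then have A: "A \<in> sigma_sets (space ?N) ?G"
          using observed_countably_generated[OF B s] unfolding event_def by auto
        have G: "?G \<subseteq> sets ?N"
        proof safe
          fix J assume J: "finite J" "J \<subseteq> ?D"
          have "event J \<in> sets (observed s)"
            by (rule event_observed[OF J(1)]) (use J(2) Bb in \<open>auto simp: subset_iff intro: less_imp_le\<close>)
          then show "event J \<in> sets ?N" using S.subalg by (auto simp: subalgebra_def)
        qed
        have "(\<integral>w. indicator A w * f s w $ i \<partial>?N) = 0"
          by (rule set_integral_zero_sigma_sets[OF int zero_all Int_stable_events G _ A]) (use zero in auto)
        then show "(LINT w:A|?N. f s w $ i) = (LINT w:A|?N. 0)" by (simp add: set_lebesgue_integral_def)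
      qed auto
    qed
  qed
qed

end

section \<open>The characterisation\<close>

theorem theorem2p17:
  fixes \<mu> :: "(real \<Rightarrow> real ^ ('d::finite)) measure"
    and adot b :: "real \<Rightarrow> (real \<Rightarrow> real ^ 'd) \<Rightarrow> real ^ 'd"
    and delta_a :: "(real \<Rightarrow> real ^ 'd) \<Rightarrow> real"
  assumes "wiener_measure \<mu>"
    and "adot \<in> L2a \<mu>"
    and "ito_integral \<mu> adot delta_a"
    and "(\<integral>w. rho_minus adot delta_a w \<partial>completion \<mu>) = 1"
    and "cond_exp_process (completion \<mu>) (perturbed_filtration \<mu> adot) adot b"
  shows "(distr (completion \<mu>) \<mu> (perturbed adot) = \<mu> \<longleftrightarrow>
            (AE (t, w) in unit_time \<Otimes>\<^sub>M completion \<mu>. b t w = 0)) \<and>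
         (distr (completion \<mu>) \<mu> (perturbed adot) = \<mu> \<longrightarrow>
            (AE w in completion \<mu>. \<forall>t\<in>{0..1}. perturbed adot w t = innovation adot b w t))"
proof -
  interpret drifted_wiener \<mu> adot by standard fact+
  let ?N = "completion \<mu>" and ?law = "distr (completion \<mu>) \<mu> (perturbed adot)"
  have bm: "(\<lambda>(t, w). b t w) \<in> borel_measurable (unit_time \<Otimes>\<^sub>M ?N)"
    and bv: "AE t in unit_time. AE w in ?N. \<forall>i. b t w $ i = real_cond_exp ?N (observed t) (\<lambda>v. adot t v $ i) w"
    using assms(5) by (simp_all add: cond_exp_process_def)
  have zero_set: "{x \<in> space (unit_time \<Otimes>\<^sub>M ?N). case x of (t, w) \<Rightarrow> b t w = 0} \<in> sets (unit_time \<Otimes>\<^sub>M ?N)"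
  proof -
    have "(\<lambda>(t, w). b t w) -` {0} \<inter> space (unit_time \<Otimes>\<^sub>M ?N) \<in> sets (unit_time \<Otimes>\<^sub>M ?N)"
      by (rule measurable_sets[OF bm]) simp
    also have "(\<lambda>(t, w). b t w) -` {0} \<inter> space (unit_time \<Otimes>\<^sub>M ?N)
        = {x \<in> space (unit_time \<Otimes>\<^sub>M ?N). case x of (t, w) \<Rightarrow> b t w = 0}" by auto
    finally show ?thesis .
  qed
  have b_zero: "AE t in unit_time. AE w in ?N. b t w = 0" if law: "?law = \<mu>"
  proof -
    interpret measure_preserving_drift \<mu> adot by standard (rule law)
    from cond_exp_density_zero bv show ?thesis
    proof eventually_elim
      case (elim t)
      have "AE w in ?N. \<forall>i. real_cond_exp ?N (observed t) (\<lambda>v. adot t v $ i) w = 0"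
        using elim(1) by (simp add: AE_all_countable)
      with elim(2) show ?case by eventually_elim (simp add: vec_eq_iff)
    qed
  qed
  have pair: "AE (t, w) in unit_time \<Otimes>\<^sub>M ?N. b t w = 0" if law: "?law = \<mu>"
    using b_zero[OF law] by (intro TC.AE_pair_measure zero_set) simp
  have converse: "?law = \<mu>" if zero: "AE (t, w) in unit_time \<Otimes>\<^sub>M ?N. b t w = 0"
  proof -
    have "AE t in unit_time. AE w in ?N. b t w = 0"
      using TC.AE_pair[OF zero] by simp
    with bv have "AE t in unit_time. \<forall>i. AE w in ?N. real_cond_exp ?N (observed t) (\<lambda>v. adot t v $ i) w = 0"
    proof eventually_elim
      case (elim t)
      from elim have "AE w in ?N. \<forall>i. real_cond_exp ?N (observed t) (\<lambda>v. adot t v $ i) w = 0"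
        by eventually_elim (metis zero_index)
      then show ?case by (simp add: AE_all_countable)
    qed
    then interpret unobserved_drift \<mu> adot by unfold_locales
    show ?thesis by (rule wiener_measure_unique[OF perturbed_law_wiener wiener])
  qed
  have innovation: "AE w in ?N. \<forall>t\<in>{0..1}. perturbed adot w t = innovation adot b w t" if law: "?law = \<mu>"
  proof -
    have "AE w in ?N. AE t in unit_time. b t w = 0"
      using b_zero[OF law] TC.AE_commute[of "\<lambda>t w. b t w = 0"] zero_set by (simp add: case_prod_beta')
    then show ?thesis
    proof eventually_elim
      case (elim w)
      show ?case
      proof
        fix t :: real assume t: "t \<in> {0..1}"
        have "AE s in unit_time. indicator {0..t} s *\<^sub>R b s w = 0" using elim by eventually_elim simp
        then have "primitive (\<lambda>s. b s w) t = 0"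
          using t by (simp add: primitive_unit_time integral_eq_zero_AE)
        then show "perturbed adot w t = innovation adot b w t" by (simp add: innovation_def)
      qed
    qed
  qed
  show ?thesis using pair converse innovation by blast
qed

end
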